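(* There is an absolute constant $C$ (independent of the Hilbert space $\mathcal{H}$, of the set $K$ and of the function $f$) with the following property. Let $K=\{k_j: j\ge 0\}$ be a strongly lacunary set, and let $f\in L^1(\mathbb{T};S_1)$ be such that $\hat f$ vanishes off $K$ (that is, $\hat f(n)=0$ for every integer $n\notin K$). Then $$|||(\hat f(k_j))||| \le C\,\|f\|_{L^1(\mathbb{T};S_1)}.$$
   Context: $\mathcal{H}$ is a (complex) Hilbert space. The Schatten class $S_1=S_1(\mathcal{H})$ consists of the compact operators $A$ on $\mathcal{H}$ with $\|A\|_{S_1}=\operatorname{tr}\sqrt{A^*A}<\infty$. The interval $(-\pi,\pi]$ is identified with the unit circle group $\mathbb{T}$. $L^1(\mathbb{T};S_1)$ is the space of Bochner integrable functions $f:\mathbb{T}\to S_1$, with norm $\|f\|_{L^1(\mathbb{T};S_1)}=\frac1{2\pi}\int_{-\pi}^{\pi}\|f(t)\|_{S_1}\,dt$. The Fourier coefficients of such $f$ are $\hat f(n)=\frac1{2\pi}\int_{-\pi}^{\pi}f(t)e^{-int}\,dt\in S_1$, $n\in\mathbb{Z}$. A set $K$ is strongly lacunary if it is the range of a sequence $(k_j)_{j=0}^\infty$ of nonnegative integers with $k_{j+1}>2k_j$ for all $j$; $(k_j)$ denotes this sequence. Norms on sequences: for a sequence $(c_j)_{j\ge0}$ of compact operators on $\mathcal{H}$, let $$\|(c_j)\|_{\mathcal{C}_E}=\Big\|\sqrt{\textstyle\sum_j c_j^*c_j}\Big\|_{S_1}=\operatorname{tr}\sqrt{\textstyle\sum_j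 c_j^*c_j},$$ which is the $S_1(\ell^2(\mathcal{H}))$ norm of the operator-valued matrix having one column equal to $(c_j)$ and all other columns zero (the norm being $+\infty$ if this matrix does not define an element of $S_1(\ell^2(\mathcal{H}))$). Accordingly $\|(c_j^* )\|_{\mathcal{C}_E}=\operatorname{tr}\sqrt{\sum_j c_jc_j^*}$. Finally, $$|||(c_j)|||=\inf\big\{\|(a_j)\|_{\mathcal{C}_E}+\|(b_j^* )\|_{\mathcal{C}_E}:\ (c_j)=(a_j)+(b_j)\big\},$$ the infimum being over all splittings of $(c_j)$ as a termwise sum of two sequences of compact operators on $\mathcal{H}$. *)

theory Defs
  imports "HOL-Analysis.Analysis"
begin

section \<open>Complex Hilbert spaces\<close>

text \<open>The inner product is conjugate-linear in its first argument.  Separability is not assumed.\<close>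

class chilbert_space = banach +
  fixes scaleC :: "complex \<Rightarrow> 'a \<Rightarrow> 'a"  (infixr \<open>*\<^sub>C\<close> 75)
    and cinner :: "'a \<Rightarrow> 'a \<Rightarrow> complex"
  assumes scaleC_add_right: "c *\<^sub>C (x + y) = c *\<^sub>C x + c *\<^sub>C y"
    and scaleC_add_left: "(c + d) *\<^sub>C x = c *\<^sub>C x + d *\<^sub>C x"
    and scaleC_scaleC: "c *\<^sub>C d *\<^sub>C x = (c * d) *\<^sub>C x"
    and scaleC_of_real: "complex_of_real r *\<^sub>C x = r *\<^sub>R x"
    and cinner_commute: "cinner x y = cnj (cinner y x)"
    and cinner_add_right: "cinner x (y + z) = cinner x y + cinner x z"
    and cinner_scaleC_right: "cinner x (c *\<^sub>C y) = c * cinner x y"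
    and cinner_self: "cinner x x = complex_of_real ((norm x)\<^sup>2)"


section \<open>The space \<open>\<ell>\<^sup>2\<close> of square-summable complex sequences\<close>

definition sq_summable :: "(nat \<Rightarrow> complex) \<Rightarrow> bool" where
  "sq_summable x \<longleftrightarrow> summable (\<lambda>n. (cmod (x n))\<^sup>2)"

definition l2norm :: "(nat \<Rightarrow> complex) \<Rightarrow> real" where
  "l2norm x = sqrt (\<Sum>n. (cmod (x n))\<^sup>2)"

lemma l2norm_upper:
  assumes "sq_summable x"
  shows "L2_set (\<lambda>n. cmod (x n)) {..<N} \<le> l2norm x"
  unfolding L2_set_def l2norm_def
  using assms by (intro real_sqrt_le_mono sum_le_suminf) (auto simp: sq_summable_def)

lemma l2norm_bound:
  assumes "\<And>N. L2_set (\<lambda>n. cmod (x n)) {..<N} \<le> B"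
  shows "sq_summable x" "l2norm x \<le> B"
proof -
  have B: "0 \<le> B" using assms[of 0] by simp
  have s: "(\<Sum>n<N. (cmod (x n))\<^sup>2) \<le> B\<^sup>2" for N
    using assms[of N] B unfolding L2_set_def by (simp add: real_sqrt_le_iff' sqrt_le_D)
  show sx: "sq_summable x"
    unfolding sq_summable_def
    by (rule summableI_nonneg_bounded[where x = "B\<^sup>2"]) (use s in auto)
  have "(\<Sum>n. (cmod (x n))\<^sup>2) \<le> B\<^sup>2"
    using sx s unfolding sq_summable_def by (intro suminf_le_const) auto
  then show "l2norm x \<le> B"
    unfolding l2norm_def using B by (simp add: real_le_lsqrt)
qed

lemma l2norm_nonneg: "sq_summable x \<Longrightarrow> 0 \<le> l2norm x"
  using l2norm_upper[of x 0] by simp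

lemma l2_add:
  assumes "sq_summable x" "sq_summable y"
  shows "sq_summable (\<lambda>n. x n + y n)" "l2norm (\<lambda>n. x n + y n) \<le> l2norm x + l2norm y"
proof -
  have *: "L2_set (\<lambda>n. cmod (x n + y n)) {..<N} \<le> l2norm x + l2norm y" for N
  proof -
    have "L2_set (\<lambda>n. cmod (x n + y n)) {..<N} \<le> L2_set (\<lambda>n. cmod (x n) + cmod (y n)) {..<N}"
      by (intro L2_set_mono) (auto simp: norm_triangle_ineq)
    also have "\<dots> \<le> L2_set (\<lambda>n. cmod (x n)) {..<N} + L2_set (\<lambda>n. cmod (y n)) {..<N}"
      by (rule L2_set_triangle_ineq)
    also have "\<dots> \<le> l2norm x + l2norm y"
      using assms by (intro add_mono l2norm_upper)
    finally show ?thesis .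
  qed
  from l2norm_bound[OF this] show "sq_summable (\<lambda>n. x n + y n)"
    "l2norm (\<lambda>n. x n + y n) \<le> l2norm x + l2norm y" .
qed

lemma l2_mult:
  assumes "sq_summable x"
  shows "sq_summable (\<lambda>n. c * x n)" "l2norm (\<lambda>n. c * x n) = cmod c * l2norm x"
  using assms
  by (auto simp: sq_summable_def l2norm_def norm_mult power_mult_distrib summable_mult
      suminf_mult real_sqrt_mult)

lemma l2_cinner_summable:
  assumes "sq_summable x" "sq_summable y"
  shows "summable (\<lambda>n. cnj (x n) * y n)"
proof (rule summable_comparison_test')
  show "summable (\<lambda>n. (cmod (x n))\<^sup>2 + (cmod (y n))\<^sup>2)"
    using assms by (intro summable_add) (auto simp: sq_summable_def)
  show "norm (cnj (x n) * y n) \<le> (cmod (x n))\<^sup>2 + (cmod (y n))\<^sup>2" for n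
  proof -
    have "2 * cmod (x n) * cmod (y n) \<le> (cmod (x n))\<^sup>2 + (cmod (y n))\<^sup>2"
      by (rule sum_squares_bound)
    moreover have "0 \<le> cmod (x n) * cmod (y n)"
      by simp
    ultimately show ?thesis
      by (simp only: norm_mult complex_mod_cnj)
  qed
qed

typedef ell2 = "{x. sq_summable x}"
  by (rule exI[of _ "\<lambda>_. 0"]) (simp add: sq_summable_def)

lemma Rep_ell2_sq: "sq_summable (Rep_ell2 x)"
  using Rep_ell2 by auto

instantiation ell2 :: real_vector
begin

definition "0 = Abs_ell2 (\<lambda>_. 0)"
definition "x + y = Abs_ell2 (\<lambda>n. Rep_ell2 x n + Rep_ell2 y n)"
definition "- x = Abs_ell2 (\<lambda>n. - Rep_ell2 x n)"
definition "x - y = Abs_ell2 (\<lambda>n. Rep_ell2 x n - Rep_ell2 y n)"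
definition "r *\<^sub>R x = Abs_ell2 (\<lambda>n. complex_of_real r * Rep_ell2 x n)"
lemma Rep_ell2_zero: "Rep_ell2 0 = (\<lambda>_. 0)"
  unfolding zero_ell2_def by (rule Abs_ell2_inverse) (simp add: sq_summable_def)

lemma Rep_ell2_add: "Rep_ell2 (x + y) = (\<lambda>n. Rep_ell2 x n + Rep_ell2 y n)"
  unfolding plus_ell2_def
  by (rule Abs_ell2_inverse) (simp add: l2_add(1) Rep_ell2_sq)

lemma Rep_ell2_uminus: "Rep_ell2 (- x) = (\<lambda>n. - Rep_ell2 x n)"
  unfolding uminus_ell2_def
  using Rep_ell2_sq[of x] by (intro Abs_ell2_inverse) (simp add: sq_summable_def)

lemma Rep_ell2_minus: "Rep_ell2 (x - y) = (\<lambda>n. Rep_ell2 x n - Rep_ell2 y n)"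
  unfolding minus_ell2_def
  using l2_add(1)[OF Rep_ell2_sq[of x] Rep_ell2_sq[of "- y"]]
  by (intro Abs_ell2_inverse) (simp add: Rep_ell2_uminus)

lemma Rep_ell2_scaleR: "Rep_ell2 (r *\<^sub>R x) = (\<lambda>n. complex_of_real r * Rep_ell2 x n)"
  unfolding scaleR_ell2_def
  by (rule Abs_ell2_inverse) (simp add: l2_mult(1) Rep_ell2_sq)

lemmas Rep_ell2_simps =
  Rep_ell2_zero Rep_ell2_add Rep_ell2_uminus Rep_ell2_minus Rep_ell2_scaleR

instance
  by standard (auto simp: Rep_ell2_inject[symmetric] Rep_ell2_simps fun_eq_iff algebra_simps)

end

instantiation ell2 :: real_normed_vector
begin

definition "norm x = l2norm (Rep_ell2 x)"
definition "sgn (x :: ell2) = x /\<^sub>R norm x"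
definition "dist (x :: ell2) y = norm (x - y)"
definition uniformity_ell2_def:
  "(uniformity :: (ell2 \<times> ell2) filter) = (INF e\<in>{0 <..}. principal {(x, y). dist x y < e})"
definition open_ell2_def:
  "open (U :: ell2 set) \<longleftrightarrow> (\<forall>x\<in>U. eventually (\<lambda>(x', y). x' = x \<longrightarrow> y \<in> U) uniformity)"

instance
proof
  fix x y z :: ell2 and a b :: real
  show "norm x = 0 \<longleftrightarrow> x = 0"
  proof
    assume "norm x = 0"
    then have "(\<Sum>n. (cmod (Rep_ell2 x n))\<^sup>2) = 0"
      by (simp add: norm_ell2_def l2norm_def)
    then have "\<forall>n. (cmod (Rep_ell2 x n))\<^sup>2 = 0"
      using Rep_ell2_sq[of x] suminf_eq_zero_iff[of "\<lambda>n. (cmod (Rep_ell2 x n))\<^sup>2"]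
      by (simp add: sq_summable_def)
    then show "x = 0"
      by (intro Rep_ell2_inject[THEN iffD1]) (auto simp: Rep_ell2_zero fun_eq_iff)
  next
    assume "x = 0"
    then show "norm x = 0"
      by (simp add: norm_ell2_def l2norm_def Rep_ell2_zero)
  qed
  show "norm (x + y) \<le> norm x + norm y"
    by (simp add: norm_ell2_def Rep_ell2_add l2_add(2) Rep_ell2_sq)
  show "norm (a *\<^sub>R x) = \<bar>a\<bar> * norm x"
    by (simp add: norm_ell2_def Rep_ell2_scaleR l2_mult(2) Rep_ell2_sq)
qed (auto simp: sgn_ell2_def dist_ell2_def uniformity_ell2_def open_ell2_def)

end

instance ell2 :: banach
proof
  fix X :: "nat \<Rightarrow> ell2"
  assume X: "Cauchy X"
  define x where "x i = Rep_ell2 (X i)" for i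
  have sq: "sq_summable (x i)" for i
    by (simp add: x_def Rep_ell2_sq)
  have coord: "cmod (x i n - x j n) \<le> dist (X i) (X j)" for i j n
  proof -
    have "cmod (x i n - x j n) \<le> L2_set (\<lambda>n. cmod (Rep_ell2 (X i - X j) n)) {..<Suc n}"
      using member_le_L2_set[of "{..<Suc n}" n "\<lambda>n. cmod (Rep_ell2 (X i - X j) n)"]
      by (simp add: Rep_ell2_minus x_def)
    also have "\<dots> \<le> dist (X i) (X j)"
      unfolding dist_norm norm_ell2_def by (rule l2norm_upper[OF Rep_ell2_sq])
    finally show ?thesis .
  qed
  have "Cauchy (\<lambda>i. x i n)" for n
    using X coord[of _ n] unfolding Cauchy_def dist_norm[where 'a = complex]
    by (meson le_less_trans)
  then have "\<exists>l. (\<lambda>i. x i n) \<longlonglongrightarrow> l" for n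
    by (simp add: Cauchy_convergent_iff convergent_def)
  then obtain l where l: "\<And>n. (\<lambda>i. x i n) \<longlonglongrightarrow> l n"
    by metis
  have close: "\<exists>M. \<forall>i\<ge>M. \<forall>N. L2_set (\<lambda>n. cmod (x i n - l n)) {..<N} \<le> e" if "e > 0" for e
  proof -
    obtain M where M: "\<And>i j. i \<ge> M \<Longrightarrow> j \<ge> M \<Longrightarrow> dist (X i) (X j) < e"
      using metric_CauchyD[OF X \<open>e > 0\<close>] by blast
    have "L2_set (\<lambda>n. cmod (x i n - l n)) {..<N} \<le> e" if "i \<ge> M" for i N
    proof (rule LIMSEQ_le_const2)
      show "(\<lambda>j. L2_set (\<lambda>n. cmod (x i n - x j n)) {..<N})
          \<longlonglongrightarrow> L2_set (\<lambda>n. cmod (x i n - l n)) {..<N}"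
        unfolding L2_set_def by (intro tendsto_intros l)
      have "L2_set (\<lambda>n. cmod (x i n - x j n)) {..<N} \<le> e" if "j \<ge> M" for j
      proof -
        have "L2_set (\<lambda>n. cmod (x i n - x j n)) {..<N} \<le> dist (X i) (X j)"
          using l2norm_upper[OF Rep_ell2_sq, of "X i - X j" N]
          by (simp add: dist_norm norm_ell2_def Rep_ell2_minus x_def)
        with M[OF \<open>i \<ge> M\<close> that] show ?thesis by simp
      qed
      then show "\<exists>M. \<forall>j\<ge>M. L2_set (\<lambda>n. cmod (x i n - x j n)) {..<N} \<le> e"
        by blast
    qed
    then show ?thesis by blast
  qed
  obtain M where "\<And>N. L2_set (\<lambda>n. cmod (x M n - l n)) {..<N} \<le> 1"
    using close[of 1] by auto
  then have d: "sq_summable (\<lambda>n. x M n - l n)"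
    by (rule l2norm_bound)
  have "sq_summable (\<lambda>n. x M n + (- 1) * (x M n - l n))"
    by (rule l2_add(1)[OF sq l2_mult(1)[OF d]])
  then have L: "Rep_ell2 (Abs_ell2 l) = l"
    by (intro Abs_ell2_inverse) simp
  have "X \<longlonglongrightarrow> Abs_ell2 l"
  proof (rule metric_LIMSEQ_I)
    fix e :: real assume "0 < e"
    then obtain M where M: "\<And>i N. i \<ge> M \<Longrightarrow> L2_set (\<lambda>n. cmod (x i n - l n)) {..<N} \<le> e / 2"
      using close[of "e / 2"] by auto
    have "dist (X i) (Abs_ell2 l) < e" if "i \<ge> M" for i
      using l2norm_bound(2)[OF M[OF that]] \<open>0 < e\<close>
      by (simp add: dist_norm norm_ell2_def Rep_ell2_minus L x_def)
    then show "\<exists>M. \<forall>i\<ge>M. dist (X i) (Abs_ell2 l) < e" by blast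
  qed
  then show "convergent X"
    by (auto simp: convergent_def)
qed

instantiation ell2 :: chilbert_space
begin

definition "c *\<^sub>C x = Abs_ell2 (\<lambda>n. c * Rep_ell2 x n)"
definition "cinner x y = (\<Sum>n. cnj (Rep_ell2 x n) * Rep_ell2 y n)"

lemma Rep_ell2_scaleC: "Rep_ell2 (c *\<^sub>C x) = (\<lambda>n. c * Rep_ell2 x n)"
  unfolding scaleC_ell2_def
  by (rule Abs_ell2_inverse) (simp add: l2_mult(1) Rep_ell2_sq)

instance
proof
  fix x y z :: ell2 and c d :: complex and r :: real
  note S = l2_cinner_summable[OF Rep_ell2_sq Rep_ell2_sq]
  show "c *\<^sub>C (x + y) = c *\<^sub>C x + c *\<^sub>C y" "(c + d) *\<^sub>C x = c *\<^sub>C x + d *\<^sub>C x"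
    "c *\<^sub>C d *\<^sub>C x = (c * d) *\<^sub>C x" "complex_of_real r *\<^sub>C x = r *\<^sub>R x"
    by (auto simp: Rep_ell2_inject[symmetric] Rep_ell2_simps Rep_ell2_scaleC fun_eq_iff
        algebra_simps)
  show "cinner x y = cnj (cinner y x)"
  proof -
    have "(\<lambda>n. cnj (cnj (Rep_ell2 y n) * Rep_ell2 x n)) sums cnj (cinner y x)"
      unfolding cinner_ell2_def by (intro sums_cnj[THEN iffD2] summable_sums S)
    then show ?thesis
      unfolding cinner_ell2_def by (simp add: sums_iff mult.commute)
  qed
  show "cinner x (y + z) = cinner x y + cinner x z"
    unfolding cinner_ell2_def Rep_ell2_add
    by (simp add: ring_distribs suminf_add[OF S S])
  show "cinner x (c *\<^sub>C y) = c * cinner x y"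
    unfolding cinner_ell2_def Rep_ell2_scaleC
    by (simp add: suminf_mult[OF S, symmetric] mult.left_commute)
  show "cinner x x = complex_of_real ((norm x)\<^sup>2)"
  proof -
    have s: "summable (\<lambda>n. (cmod (Rep_ell2 x n))\<^sup>2)"
      using Rep_ell2_sq[of x] by (simp add: sq_summable_def)
    have "(norm x)\<^sup>2 = (\<Sum>n. (cmod (Rep_ell2 x n))\<^sup>2)"
      unfolding norm_ell2_def l2norm_def
      by (intro real_sqrt_pow2 suminf_nonneg s) simp
    then have "complex_of_real ((norm x)\<^sup>2) = (\<Sum>n. complex_of_real ((cmod (Rep_ell2 x n))\<^sup>2))"
      using suminf_of_real[OF s, where 'a = complex] by simp
    also have "\<dots> = cinner x x"
      unfolding cinner_ell2_def
      by (intro suminf_cong) (simp only: complex_norm_square mult.commute)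
    finally show ?thesis by simp
  qed
qed

end


section \<open>Operators and the trace class\<close>

text \<open>The elements of \<^typ>\<open>'h \<Rightarrow>\<^sub>L 'h\<close> are only real-linear.\<close>

definition clinear_op :: "('h::chilbert_space \<Rightarrow>\<^sub>L 'h) \<Rightarrow> bool" where
  "clinear_op A \<longleftrightarrow> (\<forall>c x. blinfun_apply A (c *\<^sub>C x) = c *\<^sub>C blinfun_apply A x)"

definition op_scaleC :: "complex \<Rightarrow> ('h::chilbert_space \<Rightarrow>\<^sub>L 'h) \<Rightarrow> ('h \<Rightarrow>\<^sub>L 'h)" where
  "op_scaleC c A = Blinfun (\<lambda>x. c *\<^sub>C blinfun_apply A x)"

definition op_adj :: "('h::chilbert_space \<Rightarrow>\<^sub>L 'h) \<Rightarrow> ('h \<Rightarrow>\<^sub>L 'h)" where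
  "op_adj A = (THE B. \<forall>x y. cinner (blinfun_apply A x) y = cinner x (blinfun_apply B y))"

definition positive_op :: "('h::chilbert_space \<Rightarrow>\<^sub>L 'h) \<Rightarrow> bool" where
  "positive_op A \<longleftrightarrow> clinear_op A \<and> (\<forall>x. cinner x (blinfun_apply A x) \<in> \<real>\<^sub>\<ge>\<^sub>0)"

definition op_sqrt :: "('h::chilbert_space \<Rightarrow>\<^sub>L 'h) \<Rightarrow> ('h \<Rightarrow>\<^sub>L 'h)" where
  "op_sqrt A = (THE P. positive_op P \<and> P o\<^sub>L P = A)"

definition compact_op :: "('h::chilbert_space \<Rightarrow>\<^sub>L 'h) \<Rightarrow> bool" where
  "compact_op A \<longleftrightarrow> clinear_op A \<and> compact (closure (blinfun_apply A ` cball 0 1))"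

definition orthonormal_basis :: "'h::chilbert_space set \<Rightarrow> bool" where
  "orthonormal_basis E \<longleftrightarrow>
     (\<forall>e\<in>E. norm e = 1) \<and> (\<forall>e\<in>E. \<forall>e'\<in>E. e \<noteq> e' \<longrightarrow> cinner e e' = 0) \<and>
     (\<forall>x. (\<forall>e\<in>E. cinner e x = 0) \<longrightarrow> x = 0)"

text \<open>The \<open>[0, \<infinity>]\<close>-valued trace of a positive operator; it does not depend on the basis.\<close>

definition op_trace :: "('h::chilbert_space \<Rightarrow>\<^sub>L 'h) \<Rightarrow> ennreal" where
  "op_trace P = (\<Sum>\<^sub>\<infinity>e\<in>(SOME E. orthonormal_basis E). ennreal (Re (cinner e (blinfun_apply P e))))"

definition S1_norm :: "('h::chilbert_space \<Rightarrow>\<^sub>L 'h) \<Rightarrow> ennreal" where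
  "S1_norm A = op_trace (op_sqrt (op_adj A o\<^sub>L A))"

definition S1 :: "('h::chilbert_space \<Rightarrow>\<^sub>L 'h) set" where
  "S1 = {A. compact_op A \<and> S1_norm A < \<infinity>}"


section \<open>Bochner integrable \<open>S\<^sub>1\<close>-valued functions on the circle\<close>

text \<open>The library's Bochner integral requires a second countable range, which \<open>S\<^sub>1\<close> is not when
  the Hilbert space is not separable; hence the usual definition by simple functions, with
  convergence in the \<open>S\<^sub>1\<close>-norm.  Functions on the circle are functions on \<open>\<real>\<close> of which only
  the restriction to \<open>(-\<pi>, \<pi>]\<close> matters.\<close>

definition circle :: "real measure" where
  "circle = lebesgue_on {-pi<..pi}"

definition S1_simple :: "(real \<Rightarrow> ('h::chilbert_space \<Rightarrow>\<^sub>L 'h)) \<Rightarrow> bool" where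
  "S1_simple s \<longleftrightarrow> simple_function circle s \<and> s ` space circle \<subseteq> S1"

definition L1_S1 :: "(real \<Rightarrow> ('h::chilbert_space \<Rightarrow>\<^sub>L 'h)) set" where
  "L1_S1 = {f. f ` space circle \<subseteq> S1 \<and>
     (\<exists>s. (\<forall>i. S1_simple (s i)) \<and> (AE t in circle. (\<lambda>i. S1_norm (f t - s i t)) \<longlonglongrightarrow> 0)) \<and>
     (\<integral>\<^sup>+t. S1_norm (f t) \<partial>circle) < \<infinity>}"

definition L1_norm :: "(real \<Rightarrow> ('h::chilbert_space \<Rightarrow>\<^sub>L 'h)) \<Rightarrow> ennreal" where
  "L1_norm f = ennreal (1 / (2 * pi)) * (\<integral>\<^sup>+t. S1_norm (f t) \<partial>circle)"

definition has_S1_integral ::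
    "(real \<Rightarrow> ('h::chilbert_space \<Rightarrow>\<^sub>L 'h)) \<Rightarrow> ('h \<Rightarrow>\<^sub>L 'h) \<Rightarrow> bool" where
  "has_S1_integral f I \<longleftrightarrow> I \<in> S1 \<and>
     (\<exists>s. (\<forall>i. S1_simple (s i)) \<and>
          (\<lambda>i. \<integral>\<^sup>+t. S1_norm (f t - s i t) \<partial>circle) \<longlonglongrightarrow> 0 \<and>
          (\<lambda>i. S1_norm (Bochner_Integration.simple_bochner_integral circle (s i) - I)) \<longlonglongrightarrow> 0)"

definition S1_integral :: "(real \<Rightarrow> ('h::chilbert_space \<Rightarrow>\<^sub>L 'h)) \<Rightarrow> ('h \<Rightarrow>\<^sub>L 'h)" where
  "S1_integral f = (THE I. has_S1_integral f I)"

definition fourier_coeff ::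
    "(real \<Rightarrow> ('h::chilbert_space \<Rightarrow>\<^sub>L 'h)) \<Rightarrow> int \<Rightarrow> ('h \<Rightarrow>\<^sub>L 'h)" where
  "fourier_coeff f n =
     (1 / (2 * pi)) *\<^sub>R S1_integral (\<lambda>t. op_scaleC (exp (- \<i> * of_int n * of_real t)) (f t))"


section \<open>Lacunary sequences and norms of operator sequences\<close>

definition strongly_lacunary_seq :: "(nat \<Rightarrow> nat) \<Rightarrow> bool" where
  "strongly_lacunary_seq k \<longleftrightarrow> (\<forall>j. k (Suc j) > 2 * k j)"

text \<open>If the column with entries \<open>c\<^sub>j\<close> is a compact operator, then \<open>\<Sum>\<^sub>j c\<^sub>j\<^sup>* c\<^sub>j\<close> converges
  in operator norm; so where this series diverges the column is not in \<open>S\<^sub>1\<close> and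
  the value is \<open>\<infinity>\<close>.\<close>

definition CE_norm :: "(nat \<Rightarrow> ('h::chilbert_space \<Rightarrow>\<^sub>L 'h)) \<Rightarrow> ennreal" where
  "CE_norm c =
     (if summable (\<lambda>j. op_adj (c j) o\<^sub>L c j)
      then op_trace (op_sqrt (\<Sum>j. op_adj (c j) o\<^sub>L c j)) else \<infinity>)"

definition triple_norm :: "(nat \<Rightarrow> ('h::chilbert_space \<Rightarrow>\<^sub>L 'h)) \<Rightarrow> ennreal" where
  "triple_norm c =
     (INF (a, b)\<in>{(a, b). (\<forall>j. compact_op (a j)) \<and> (\<forall>j. compact_op (b j)) \<and>
                           (\<forall>j. c j = a j + b j)}.
        CE_norm a + CE_norm (\<lambda>j. op_adj (b j)))"


section \<open>The absolute constant\<close>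

text \<open>HOL cannot place \<open>\<exists>C\<close> in front of a quantification over all Hilbert space types, and
  with \<open>\<exists>C\<close> inside a statement about a type \<open>'h\<close> the constant could depend on \<open>'h\<close>.
  The existential is therefore Skolemized: the constant is a closed real number, chosen among those
  that are valid for \<open>\<ell>\<^sup>2\<close>, if there are any.  No generality is lost: an absolute
  constant is valid for \<open>\<ell>\<^sup>2\<close>; and since countably many compact operators live on
  a common separable closed subspace, to which \<open>f\<close> can be compressed, every constant valid
  for \<open>\<ell>\<^sup>2\<close> is valid for every Hilbert space.\<close>

definition absolute_constant :: real where
  "absolute_constant =
     (SOME C. \<forall>k (K :: int set) (f :: real \<Rightarrow> (ell2 \<Rightarrow>\<^sub>L ell2)).
        strongly_lacunary_seq k \<longrightarrow> K = range (\<lambda>j. int (k j)) \<longrightarrow>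
        f \<in> L1_S1 \<longrightarrow> (\<forall>n. n \<notin> K \<longrightarrow> fourier_coeff f n = 0) \<longrightarrow>
        triple_norm (\<lambda>j. fourier_coeff f (int (k j))) \<le> ennreal C * L1_norm f)"

end

(* By Hahn-Banach it suffices to bound sum_j tr(v_j^* fhat(k_j)) by a multiple of the norm of f, for
   finite sequences (v_j) whose column and row norms are at most 1.  Put Y = sum_j v_j z^(k_j).  Strong
   lacunarity makes the differences k_j - k_i (i ~= j) distinct, so the mean of (Y^* Y)^2, as well as
   that of (Y Y^* )^2, is at most 2.  Split Y = B + D with B = Y (1 + Y^* Y / 2)^(-1): then B is a
   contraction, while D^* D <= (Y^* Y)^2 / 8 and D D^* <= (Y Y^* )^2 / 8, so by Bessel's inequality the
   coefficients of D at the k_j have column and row norms at most 1/2.  As fhat vanishes off K, the part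
   of the pairing that comes from B is at most the norm of f, and so the supremum s of the pairings
   satisfies s <= norm f + s / 2.  Replacing the circle by a large finite cyclic group and f by its
   Fejer means makes all the sums finite.

   The trace norm is handled through tr |A| = sup Re sum_i <y_i, A x_i> over finite Bessel families
   (x_i), (y_i): this makes it monotone with respect to |A x| <= |B x| and contractive under A |-> V A W. *)
theory Submission
  imports Defs
begin

section \<open>Complex Hilbert spaces\<close>

text \<open>Admissible families are cut out by two operator norms, of the column
  \<open>(v j)\<close> and of the column \<open>(adj (v j))\<close>; hence the Hahn-Banach
  functional falls apart into a column part and a row part, the two terms of
  \<open>triple_norm\<close>. To represent these parts by operators, a whole sequence of operators
  is coded as one vector of \<open>ell2\<close>, its matrix entries. Both operator norms are
  dominated by the Hilbert-Schmidt norm, so the Riesz representation suffices and the parts are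
  compact. The coding uses the basis of \<open>ell2\<close>; a general space is compressed to
  \<open>ell2\<close>, contractively throughout. The number 1/2 in the truncation fits the fourth
  moment: at a singular value \<sigma> the remainder
  \<open>\<sigma> - \<sigma> / (1 + \<sigma>^2 / 2)\<close> is at most
  \<open>\<sigma>^2 / sqrt 8\<close>, so its mean square is at most 2/8, and twice the remainder is
  admissible again. Absorbing half of the supremum requires it to be finite; therefore only finitely
  many frequencies are treated at a time. The final constant on \<open>ell2\<close> is 4: one factor
  2 from the absorption, one because column and row part are each bounded by the full
  supremum.\<close>

lemma scaleC_zero_right [simp]: "c *\<^sub>C (0::'a::chilbert_space) = 0"
  using scaleC_add_right[of c "0::'a" 0] by simp

lemma scaleC_zero_left [simp]: "0 *\<^sub>C (x::'a::chilbert_space) = 0"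
  using scaleC_of_real[of 0 x] by simp

lemma scaleC_one [simp]: "1 *\<^sub>C (x::'a::chilbert_space) = x"
  using scaleC_of_real[of 1 x] by simp

lemma scaleC_minus_right: "c *\<^sub>C (- x) = - (c *\<^sub>C (x::'a::chilbert_space))"
  using scaleC_add_right[of c x "- x"] by (simp add: eq_neg_iff_add_eq_0 add.commute)

lemma scaleC_diff_right: "c *\<^sub>C (x - y) = c *\<^sub>C x - c *\<^sub>C (y::'a::chilbert_space)"
  using scaleC_add_right[of c x "- y"] by (simp add: scaleC_minus_right)

lemma scaleC_sum_right: "c *\<^sub>C (\<Sum>i\<in>I. f i) = (\<Sum>i\<in>I. c *\<^sub>C (f i :: 'a::chilbert_space))"
  by (induction I rule: infinite_finite_induct) (auto simp: scaleC_add_right)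

lemma scaleC_sum_left: "(\<Sum>i\<in>I. f i) *\<^sub>C (x :: 'a::chilbert_space) = (\<Sum>i\<in>I. f i *\<^sub>C x)"
  by (induction I rule: infinite_finite_induct) (auto simp: scaleC_add_left)

lemma scaleC_scaleR: "c *\<^sub>C (r *\<^sub>R x) = r *\<^sub>R (c *\<^sub>C (x::'a::chilbert_space))"
  unfolding scaleC_of_real[symmetric] scaleC_scaleC by (simp add: mult.commute)

lemma cinner_add_left: "cinner (x + y) z = cinner x z + cinner y (z::'a::chilbert_space)"
  by (metis cinner_add_right cinner_commute complex_cnj_add)

lemma cinner_scaleC_left: "cinner (c *\<^sub>C x) y = cnj c * cinner x (y::'a::chilbert_space)"
  by (metis cinner_commute cinner_scaleC_right complex_cnj_mult)

lemma cinner_scaleR_right: "cinner x (r *\<^sub>R y) = of_real r * cinner x (y::'a::chilbert_space)"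
  by (metis cinner_scaleC_right scaleC_of_real)

lemma cinner_scaleR_left: "cinner (r *\<^sub>R x) y = of_real r * cinner x (y::'a::chilbert_space)"
  by (metis cinner_scaleC_left complex_cnj_complex_of_real scaleC_of_real)

lemma cinner_zero_right [simp]: "cinner x (0::'a::chilbert_space) = 0"
  using cinner_scaleR_right[of x 0 0] by simp

lemma cinner_zero_left [simp]: "cinner 0 (x::'a::chilbert_space) = 0"
  using cinner_scaleR_left[of 0 0 x] by simp

lemma cinner_minus_right [simp]: "cinner x (- y) = - cinner x (y::'a::chilbert_space)"
  using cinner_scaleR_right[of x "-1" y] by simp

lemma cinner_minus_left [simp]: "cinner (- x) y = - cinner x (y::'a::chilbert_space)"
  using cinner_scaleR_left[of "-1" x y] by simp

lemma cinner_diff_right: "cinner x (y - z) = cinner x y - cinner x (z::'a::chilbert_space)"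
  using cinner_add_right[of x y "- z"] by simp

lemma cinner_diff_left: "cinner (x - y) z = cinner x z - cinner y (z::'a::chilbert_space)"
  using cinner_add_left[of x "- y" z] by simp

lemma cinner_sum_right: "cinner x (\<Sum>i\<in>I. f i) = (\<Sum>i\<in>I. cinner x (f i :: 'a::chilbert_space))"
  by (induction I rule: infinite_finite_induct) (auto simp: cinner_add_right)

lemma cinner_sum_left: "cinner (\<Sum>i\<in>I. f i) x = (\<Sum>i\<in>I. cinner (f i) (x :: 'a::chilbert_space))"
  by (induction I rule: infinite_finite_induct) (auto simp: cinner_add_left)

lemmas cinner_simps = cinner_add_left cinner_add_right cinner_diff_left cinner_diff_right
  cinner_scaleC_left cinner_scaleC_right cinner_scaleR_left cinner_scaleR_right

lemma Re_cinner_commute: "Re (cinner x y) = Re (cinner y (x::'a::chilbert_space))"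
  by (subst cinner_commute) simp

lemma cmod_cinner_commute: "cmod (cinner x y) = cmod (cinner y (x::'a::chilbert_space))"
  by (subst cinner_commute) simp

lemma Re_cinner_self: "Re (cinner x x) = (norm (x::'a::chilbert_space))\<^sup>2"
  by (simp add: cinner_self)

lemma norm_add_sq: "(norm (x + y))\<^sup>2 = (norm x)\<^sup>2 + (norm y)\<^sup>2 + 2 * Re (cinner x (y::'a::chilbert_space))"
  unfolding Re_cinner_self[symmetric] cinner_simps by (simp add: Re_cinner_commute[of y x])

lemma norm_diff_sq: "(norm (x - y))\<^sup>2 = (norm x)\<^sup>2 + (norm y)\<^sup>2 - 2 * Re (cinner x (y::'a::chilbert_space))"
  using norm_add_sq[of x "- y"] by simp

lemma norm_scaleC: "norm (c *\<^sub>C (x::'a::chilbert_space)) = cmod c * norm x"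
proof -
  have "cinner (c *\<^sub>C x) (c *\<^sub>C x) = (cnj c * c) * cinner x x"
    by (simp add: cinner_simps)
  also have "cnj c * c = complex_of_real ((cmod c)\<^sup>2)"
    by (metis complex_norm_square mult.commute)
  also have "complex_of_real ((cmod c)\<^sup>2) * cinner x x = complex_of_real ((cmod c * norm x)\<^sup>2)"
    by (simp add: cinner_self power_mult_distrib)
  finally have "(norm (c *\<^sub>C x))\<^sup>2 = (cmod c * norm x)\<^sup>2"
    unfolding cinner_self of_real_eq_iff .
  then show ?thesis by (simp add: power2_eq_iff_nonneg)
qed

lemma cauchy_schwarz: "cmod (cinner x y) \<le> norm x * norm (y::'a::chilbert_space)"
proof (cases "x = 0")
  case False
  define c where "c = cinner x y"
  define r where "r = (norm x)\<^sup>2"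
  have r: "r > 0" using False by (simp add: r_def)
  have "0 \<le> (norm (r *\<^sub>R y - c *\<^sub>C x))\<^sup>2" by simp
  also have "\<dots> = r\<^sup>2 * (norm y)\<^sup>2 + (cmod c)\<^sup>2 * r - 2 * Re (r * (c * cnj c))"
  proof -
    have "cinner (r *\<^sub>R y) (c *\<^sub>C x) = r * (c * cnj c)"
      unfolding cinner_scaleR_left cinner_scaleC_right using cinner_commute[of y x] by (simp add: c_def)
    then show ?thesis
      unfolding norm_diff_sq norm_scaleC by (simp add: power_mult_distrib r_def)
  qed
  also have "Re (r * (c * cnj c)) = r * (cmod c)\<^sup>2"
    by (metis Re_complex_of_real complex_norm_square of_real_mult)
  finally have "r * (cmod c)\<^sup>2 \<le> r * (r * (norm y)\<^sup>2)" by (simp add: power2_eq_square algebra_simps)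
  then have "(cmod c)\<^sup>2 \<le> (norm x * norm y)\<^sup>2"
    unfolding power_mult_distrib r_def[symmetric] using r by simp
  then show ?thesis
    unfolding c_def by (rule power2_le_imp_le) simp
qed simp

lemma Re_cinner_le: "Re (cinner x y) \<le> norm x * norm (y::'a::chilbert_space)"
  using cauchy_schwarz[of x y] complex_Re_le_cmod[of "cinner x y"] by linarith

lemma bounded_bilinear_cinner: "bounded_bilinear (cinner :: 'a::chilbert_space \<Rightarrow> 'a \<Rightarrow> complex)"
  by standard (auto simp: cinner_simps scaleR_conv_of_real intro!: exI[of _ 1] cauchy_schwarz)

lemma bounded_bilinear_scaleC: "bounded_bilinear (scaleC :: complex \<Rightarrow> 'a::chilbert_space \<Rightarrow> 'a)"
proof
  fix r :: real and a :: complex and b :: 'a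
  show "(r *\<^sub>R a) *\<^sub>C b = r *\<^sub>R a *\<^sub>C b"
    by (simp add: scaleR_conv_of_real scaleC_scaleC[symmetric] scaleC_of_real)
qed (auto simp: scaleC_add_left scaleC_add_right scaleC_scaleR norm_scaleC intro!: exI[of _ 1])

lemmas tendsto_cinner = bounded_bilinear.tendsto[OF bounded_bilinear_cinner]
lemmas tendsto_scaleC = bounded_bilinear.tendsto[OF bounded_bilinear_scaleC]
lemmas bounded_linear_scaleC_right = bounded_bilinear.bounded_linear_right[OF bounded_bilinear_scaleC]

lemma cinner_eqI: "(\<And>y. cinner y x = cinner y z) \<Longrightarrow> x = (z::'a::chilbert_space)"
proof -
  assume *: "\<And>y. cinner y x = cinner y z"
  have "cinner (x - z) (x - z) = 0" using *[of "x - z"] by (simp add: cinner_diff_right)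
  then show ?thesis by (simp add: cinner_self)
qed


section \<open>Riesz representation of bounded functionals\<close>

lemma norm_le_cinnerI:
  assumes B: "0 \<le> B" and *: "\<And>y. Re (cinner y x) \<le> B * norm y"
  shows "norm (x::'a::chilbert_space) \<le> B"
proof -
  have "norm x * norm x \<le> B * norm x"
    using *[of x] by (simp add: Re_cinner_self power2_eq_square)
  then show ?thesis
    using B by (cases "norm x = 0") auto
qed

text \<open>The representing vector is the minimiser of
  \<open>g x = (norm x)^2 - 2 * \<phi> x\<close>: by the parallelogram law minimising sequences are
  Cauchy, and the vanishing of the first variation at the minimum is the claim.\<close>

lemma riesz_real:
  fixes \<phi> :: "'a::chilbert_space \<Rightarrow> real"
  assumes \<phi>: "bounded_linear \<phi>"
  obtains z where "\<And>x. \<phi> x = Re (cinner z x)"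
proof -
  interpret bounded_linear \<phi> by (rule \<phi>)
  define g where "g x = (norm x)\<^sup>2 - 2 * \<phi> x" for x
  obtain K where K: "\<And>x. norm (\<phi> x) \<le> norm x * K" using bounded by blast
  have g_ge: "g x \<ge> - K\<^sup>2" for x
  proof -
    have "0 \<le> (norm x - K)\<^sup>2" by simp
    then show ?thesis using K[of x] by (simp add: g_def power2_diff algebra_simps abs_le_iff)
  qed
  have bdd: "bdd_below (range g)" using g_ge by (intro bdd_belowI) auto
  define m where "m = Inf (range g)"
  have m_le: "m \<le> g x" for x unfolding m_def by (rule cInf_lower[OF _ bdd]) simp
  have "\<exists>x. g x < m + inverse (real (Suc n))" for n
  proof -
    have "Inf (range g) < m + inverse (real (Suc n))" by (simp add: m_def)
    then show ?thesis using cInf_lessD[of "range g"] by fastforce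
  qed
  then obtain X where X: "\<And>n. g (X n) < m + inverse (real (Suc n))" by metis
  have par: "(norm (x - y))\<^sup>2 = 2 * (g x + g y - 2 * g ((1/2) *\<^sub>R (x + y)))" for x y
  proof -
    have "(norm ((1/2) *\<^sub>R (x + y)))\<^sup>2 = (norm (x + y))\<^sup>2 / 4"
      by (simp add: power_divide)
    moreover have "\<phi> ((1/2) *\<^sub>R (x + y)) = (\<phi> x + \<phi> y) / 2"
      by (simp only: scaleR add) simp
    ultimately show ?thesis
      unfolding g_def norm_add_sq[of x y] norm_diff_sq[of x y] by (simp add: field_simps)
  qed
  have close: "(norm (X a - X b))\<^sup>2 \<le> 4 * inverse (real (Suc n))" if "a \<ge> n" "b \<ge> n" for a b n
  proof -
    have "inverse (real (Suc a)) \<le> inverse (real (Suc n))" "inverse (real (Suc b)) \<le> inverse (real (Suc n))"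
      using that by (auto intro!: le_imp_inverse_le)
    moreover have "s \<le> 4 * w"
      if "u \<le> w" "v \<le> w" "s = 2 * (p + q - 2 * r)" "p < m + u" "q < m + v" "m \<le> r"
      for s p q r u v w :: real
      using that by (simp add: algebra_simps)
    ultimately show ?thesis
      using par[of "X a" "X b"] X[of a] X[of b] m_le[of "(1/2) *\<^sub>R (X a + X b)"] by blast
  qed
  have "Cauchy X"
  proof (rule metric_CauchyI)
    fix e :: real assume e: "e > 0"
    obtain n where n: "inverse (real (Suc n)) < e\<^sup>2 / 4"
      using reals_Archimedean[of "e\<^sup>2 / 4"] e by auto
    have "dist (X a) (X b) < e" if "a \<ge> n" "b \<ge> n" for a b
    proof -
      have "(norm (X a - X b))\<^sup>2 < e\<^sup>2" using close[OF that] n by linarith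
      then show ?thesis unfolding dist_norm using e by (intro power2_less_imp_less[of _ e]) auto
    qed
    then show "\<exists>M. \<forall>m\<ge>M. \<forall>n\<ge>M. dist (X m) (X n) < e" by blast
  qed
  then obtain z where z: "X \<longlonglongrightarrow> z" by (auto simp: Cauchy_convergent_iff convergent_def)
  have "(\<lambda>n. g (X n)) \<longlonglongrightarrow> g z"
    unfolding g_def by (intro tendsto_intros tendsto z)
  moreover have "(\<lambda>n. g (X n)) \<longlonglongrightarrow> m"
  proof (rule tendsto_sandwich[of "\<lambda>_. m" _ _ "\<lambda>n. m + inverse (real (Suc n))"])
    show "(\<lambda>n. m + inverse (real (Suc n))) \<longlonglongrightarrow> m"
      by (rule LIMSEQ_inverse_real_of_nat_add)
    show "\<forall>\<^sub>F n in sequentially. g (X n) \<le> m + inverse (real (Suc n))"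
      by (intro always_eventually allI less_imp_le X)
  qed (use m_le in auto)
  ultimately have gz: "g z = m" by (rule LIMSEQ_unique)
  have "\<phi> x = Re (cinner z x)" for x
  proof -
    define r where "r = Re (cinner z x) - \<phi> x"
    have q: "0 \<le> t\<^sup>2 * (norm x)\<^sup>2 + 2 * t * r" for t
      using m_le[of "z + t *\<^sub>R x"] gz
      by (simp add: g_def norm_add_sq add scaleR r_def cinner_simps power_mult_distrib algebra_simps)
    have "r = 0"
    proof (rule ccontr)
      assume r: "r \<noteq> 0"
      \<comment> \<open>The step \<open>t = - r / N\<close> is nearly optimal for the quadratic
        bound \<open>q\<close>; the summand 1 keeps \<open>N\<close> positive when
        \<open>x = 0\<close>.\<close>
      define N where "N = (norm x)\<^sup>2 + 1"
      have N: "N > 0" by (simp add: N_def add_nonneg_pos)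
      have "0 \<le> (- r / N)\<^sup>2 * (norm x)\<^sup>2 + 2 * (- r / N) * r" by (rule q)
      also have "\<dots> \<le> (- r / N)\<^sup>2 * N + 2 * (- r / N) * r"
        by (intro add_right_mono mult_left_mono) (auto simp: N_def)
      also have "\<dots> = - r\<^sup>2 / N" using N by (simp add: field_simps power2_eq_square)
      finally show False using r N by (simp add: divide_le_0_iff)
    qed
    then show ?thesis by (simp add: r_def)
  qed
  then show ?thesis by (rule that)
qed

text \<open>The real version represents the real part; complex linearity at
  \<open>\<i> *\<^sub>C x\<close> recovers the imaginary part.\<close>

lemma riesz:
  fixes \<phi> :: "'a::chilbert_space \<Rightarrow> complex"
  assumes \<phi>: "bounded_linear \<phi>" and C: "\<And>c x. \<phi> (c *\<^sub>C x) = c * \<phi> x"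
  obtains z where "\<And>x. \<phi> x = cinner z x"
proof -
  obtain z where z: "\<And>x. Re (\<phi> x) = Re (cinner z x)"
    using riesz_real[OF bounded_linear_compose[OF bounded_linear_Re \<phi>]] by metis
  have "\<phi> x = cinner z x" for x
    using z[of x] z[of "\<i> *\<^sub>C x"] by (simp add: C cinner_simps complex_eq_iff)
  then show ?thesis by (rule that)
qed


section \<open>Complex-linear operators and adjoints\<close>

text \<open>\<open>clinear_op\<close> speaks of operators on one space; operators between different
  spaces, such as the coordinate map into \<open>ell2\<close>, call for this version.\<close>

definition clin :: "('a::chilbert_space \<Rightarrow>\<^sub>L 'b::chilbert_space) \<Rightarrow> bool" where
  "clin A \<longleftrightarrow> (\<forall>c x. blinfun_apply A (c *\<^sub>C x) = c *\<^sub>C blinfun_apply A x)"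

lemma clinear_op_clin: "clinear_op A \<longleftrightarrow> clin A"
  by (simp add: clin_def clinear_op_def)

lemma clinD: "clin A \<Longrightarrow> blinfun_apply A (c *\<^sub>C x) = c *\<^sub>C blinfun_apply A x"
  by (simp add: clin_def)

lemma clin_zero [intro, simp]: "clin 0"
  by (simp add: clin_def)

lemma clin_id [intro, simp]: "clin id_blinfun"
  by (simp add: clin_def)

lemma clin_add [intro]: "clin A \<Longrightarrow> clin B \<Longrightarrow> clin (A + B)"
  by (simp add: clin_def blinfun.bilinear_simps scaleC_add_right)

lemma clin_diff [intro]: "clin A \<Longrightarrow> clin B \<Longrightarrow> clin (A - B)"
  by (simp add: clin_def blinfun.bilinear_simps scaleC_diff_right)

lemma clin_scaleR [intro]: "clin A \<Longrightarrow> clin (r *\<^sub>R A)"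
  by (simp add: clin_def blinfun.bilinear_simps scaleC_scaleR)

lemma clin_compose [intro]: "clin A \<Longrightarrow> clin B \<Longrightarrow> clin (A o\<^sub>L B)"
  by (simp add: clin_def)

lemma clin_sum [intro]: "(\<And>i. i \<in> I \<Longrightarrow> clin (f i)) \<Longrightarrow> clin (\<Sum>i\<in>I. f i)"
  by (induction I rule: infinite_finite_induct) auto

lemma clin_lim:
  assumes "(f \<longlongrightarrow> A) F" "\<And>n. clin (f n)" "F \<noteq> bot"
  shows "clin A"
  unfolding clin_def
proof (intro allI)
  fix c x
  have "((\<lambda>n. f n (c *\<^sub>C x)) \<longlongrightarrow> A (c *\<^sub>C x)) F"
    by (intro blinfun.tendsto assms tendsto_const)
  moreover have "((\<lambda>n. f n (c *\<^sub>C x)) \<longlongrightarrow> c *\<^sub>C A x) F"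
    unfolding clinD[OF assms(2)] by (intro tendsto_scaleC blinfun.tendsto assms tendsto_const)
  ultimately show "A (c *\<^sub>C x) = c *\<^sub>C A x" using assms(3) tendsto_unique by blast
qed

lemma apply_op_scaleC: "blinfun_apply (op_scaleC c A) x = c *\<^sub>C blinfun_apply A x"
  unfolding op_scaleC_def
  by (subst bounded_linear_Blinfun_apply)
     (auto intro!: bounded_linear_compose[OF bounded_linear_scaleC_right] blinfun.bounded_linear_right)

lemma clin_op_scaleC [intro]: "clin A \<Longrightarrow> clin (op_scaleC c A)"
  by (simp add: clin_def apply_op_scaleC scaleC_scaleC mult.commute)

text \<open>\<open>op_adj\<close> extended to operators between two spaces. The choice is made
  vector by vector, so that the Riesz representation gives existence; for complex-linear operators
  on one space \<open>op_adj_eq\<close> identifies the two.\<close>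

definition adj :: "('a::chilbert_space \<Rightarrow>\<^sub>L 'b::chilbert_space) \<Rightarrow> ('b \<Rightarrow>\<^sub>L 'a)" where
  "adj A = Blinfun (\<lambda>y. SOME z. \<forall>x. cinner z x = cinner y (blinfun_apply A x))"

lemma assumes A: "clin A"
  shows cinner_adj_left: "cinner (adj A y) x = cinner y (A x)"
    and clin_adj [intro]: "clin (adj A)"
    and norm_adj_le: "norm (adj A) \<le> norm A"
proof -
  define f where "f y = (SOME z. \<forall>x. cinner z x = cinner y (A x))" for y
  have ex: "\<exists>z. \<forall>x. cinner z x = cinner y (A x)" for y
  proof -
    have "bounded_linear (\<lambda>x. cinner y (A x))"
      by (intro bounded_linear_compose[OF bounded_bilinear.bounded_linear_right[OF bounded_bilinear_cinner]]
          blinfun.bounded_linear_right)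
    then obtain z where "\<And>x. cinner y (A x) = cinner z x"
      by (rule riesz) (auto simp: clinD[OF A] cinner_simps)
    then show ?thesis by metis
  qed
  have f: "cinner (f y) x = cinner y (A x)" for x y
    using someI_ex[OF ex[of y]] unfolding f_def by blast
  have f': "cinner x (f y) = cinner (A x) y" for x y
    by (subst (1 2) cinner_commute) (simp add: f)
  have nf: "norm (f y) \<le> norm A * norm y" for y
  proof (rule norm_le_cinnerI)
    fix x
    have "Re (cinner x (f y)) \<le> norm (A x) * norm y" unfolding f' by (rule Re_cinner_le)
    also have "\<dots> \<le> norm A * norm x * norm y" by (intro mult_right_mono norm_blinfun) auto
    finally show "Re (cinner x (f y)) \<le> norm A * norm y * norm x" by (simp add: mult_ac)
  qed simp
  have "bounded_linear f"
  proof (rule bounded_linear_intro[where K = "norm A"])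
    show "f (x + y) = f x + f y" for x y
      by (rule cinner_eqI) (simp only: cinner_add_right f')
    show "f (r *\<^sub>R x) = r *\<^sub>R f x" for r x
      by (rule cinner_eqI) (simp only: cinner_scaleR_right f')
    show "norm (f x) \<le> norm x * norm A" for x
      using nf[of x] by (simp only: mult.commute)
  qed
  then have ap: "adj A y = f y" for y
    unfolding adj_def f_def[symmetric] by (simp add: bounded_linear_Blinfun_apply)
  show "cinner (adj A y) x = cinner y (A x)" unfolding ap by (rule f)
  show "clin (adj A)" unfolding clin_def ap
  proof (intro allI)
    show "f (c *\<^sub>C x) = c *\<^sub>C f x" for c x
      by (rule cinner_eqI) (simp only: cinner_scaleC_right f')
  qed
  show "norm (adj A) \<le> norm A" by (rule norm_blinfun_bound) (simp_all add: ap nf)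
qed

lemma cinner_adj_right: "clin A \<Longrightarrow> cinner x (adj A y) = cinner (A x) y"
  by (subst (1 2) cinner_commute) (simp add: cinner_adj_left)

lemma adj_eqI:
  fixes B :: "'b::chilbert_space \<Rightarrow>\<^sub>L 'a::chilbert_space"
  assumes "clin A" "\<And>x y. cinner (A x) y = cinner x (B y)"
  shows "adj A = B"
  by (intro blinfun_eqI cinner_eqI) (simp add: assms cinner_adj_right)

lemma op_adj_eq: assumes "clin A" shows "op_adj A = adj A"
  unfolding op_adj_def
proof (rule the_equality)
  show "\<forall>x y. cinner (A x) y = cinner x (adj A y)" using assms by (simp add: cinner_adj_right)
  show "B = adj A" if "\<forall>x y. cinner (A x) y = cinner x (B y)" for B :: "'a \<Rightarrow>\<^sub>L 'a"
    using adj_eqI[OF assms, of B] that by simp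
qed

lemma adj_adj: "clin A \<Longrightarrow> adj (adj A) = A"
  by (rule adj_eqI) (auto simp: cinner_adj_left)

lemma adj_add: "clin A \<Longrightarrow> clin B \<Longrightarrow> adj (A + B) = adj A + adj B"
  by (rule adj_eqI) (auto simp: cinner_adj_right cinner_simps blinfun.bilinear_simps)

lemma adj_diff: "clin A \<Longrightarrow> clin B \<Longrightarrow> adj (A - B) = adj A - adj B"
  by (rule adj_eqI) (auto simp: cinner_adj_right cinner_simps blinfun.bilinear_simps)

lemma adj_scaleR: "clin A \<Longrightarrow> adj (r *\<^sub>R A) = r *\<^sub>R adj A"
  by (rule adj_eqI) (auto simp: cinner_adj_right cinner_simps blinfun.bilinear_simps)

lemma adj_op_scaleC: "clin A \<Longrightarrow> adj (op_scaleC c A) = op_scaleC (cnj c) (adj A)"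
  by (rule adj_eqI) (auto simp: cinner_adj_right cinner_simps apply_op_scaleC)

lemma adj_sum: "(\<And>i. i \<in> I \<Longrightarrow> clin (f i)) \<Longrightarrow> adj (\<Sum>i\<in>I. f i) = (\<Sum>i\<in>I. adj (f i))"
  by (rule adj_eqI)
     (auto simp: cinner_adj_right cinner_sum_left cinner_sum_right blinfun.sum_left)

lemma norm_sq_adj: "clin A \<Longrightarrow> Re (cinner x (adj A (A x))) = (norm (A x))\<^sup>2"
  by (simp add: cinner_adj_right Re_cinner_self)

lemma ell2_eqI: "(\<And>n. Rep_ell2 x n = Rep_ell2 y n) \<Longrightarrow> x = y"
  by (metis Rep_ell2_inject ext)

section \<open>Resolvents and square roots of positive operators\<close>

text \<open>Since the form of \<open>S\<close> has nonnegative real part,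
  \<open>u - \<tau> *\<^sub>R (S u + \<epsilon> *\<^sub>R u - z)\<close> is a strict contraction in
  \<open>u\<close>, so Banach's fixed point theorem inverts \<open>S + \<epsilon>\<close>. Such
  resolvents do the work of spectral calculus in what follows.\<close>

lemma resolvent:
  fixes S :: "'a::chilbert_space \<Rightarrow>\<^sub>L 'a"
  assumes S: "clin S" and pos: "\<And>x. 0 \<le> Re (cinner x (S x))" and e: "0 < \<epsilon>"
  obtains R where "clin R" "\<And>z. S (R z) + \<epsilon> *\<^sub>R R z = z" "\<And>z. R (S z + \<epsilon> *\<^sub>R z) = z"
proof -
  define T where "T = S + \<epsilon> *\<^sub>R id_blinfun"
  have T: "T u = S u + \<epsilon> *\<^sub>R u" for u by (simp add: T_def blinfun.bilinear_simps)
  have clT: "clin T" unfolding T_def using S by auto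
  define K where "K = norm S + \<epsilon>"
  have K: "K > 0" "norm (T u) \<le> K * norm u" for u
  proof -
    show "K > 0" using e by (simp add: K_def add_nonneg_pos)
    have "norm (T u) \<le> norm (S u) + \<epsilon> * norm u"
      unfolding T using norm_triangle_ineq[of "S u" "\<epsilon> *\<^sub>R u"] e by simp
    then show "norm (T u) \<le> K * norm u"
      using norm_blinfun[of S u] by (simp add: K_def algebra_simps)
  qed
  have low: "\<epsilon> * (norm u)\<^sup>2 \<le> Re (cinner u (T u))" for u
    using pos[of u] by (simp add: T cinner_simps Re_cinner_self)
  \<comment> \<open>This \<open>\<tau>\<close> minimises
    \<open>1 - 2 * \<tau> * \<epsilon> + \<tau>^2 * K^2\<close>, the bound for the squared
    contraction factor; the minimum is the square of \<open>c\<close>.\<close>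
  define \<tau> where "\<tau> = \<epsilon> / K\<^sup>2"
  define c where "c = sqrt (1 - \<epsilon>\<^sup>2 / K\<^sup>2)"
  have "\<epsilon> \<le> K" by (simp add: K_def)
  then have "\<epsilon>\<^sup>2 \<le> K\<^sup>2" using e by (intro power_mono) auto
  then have c01: "0 \<le> 1 - \<epsilon>\<^sup>2 / K\<^sup>2" using K by (simp add: divide_le_eq)
  have "1 - \<epsilon>\<^sup>2 / K\<^sup>2 < 1" using e K(1) by simp
  then have c: "0 \<le> c" "c < 1" unfolding c_def using c01 by (simp_all add: real_sqrt_lt_1_iff)
  have contr: "norm (u - \<tau> *\<^sub>R T u) \<le> c * norm u" for u
  proof -
    have "(norm (u - \<tau> *\<^sub>R T u))\<^sup>2 = (norm u)\<^sup>2 + \<tau>\<^sup>2 * (norm (T u))\<^sup>2 - 2 * \<tau> * Re (cinner u (T u))"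
      unfolding norm_diff_sq by (simp add: cinner_simps power_mult_distrib)
    also have "\<dots> \<le> (norm u)\<^sup>2 + \<tau>\<^sup>2 * (K * norm u)\<^sup>2 - 2 * \<tau> * (\<epsilon> * (norm u)\<^sup>2)"
      using e K low[of u]
      by (intro diff_mono add_mono mult_left_mono power_mono order_refl) (auto simp: \<tau>_def)
    also have "\<dots> = (1 - \<epsilon>\<^sup>2 / K\<^sup>2) * (norm u)\<^sup>2"
      using K(1) by (simp add: \<tau>_def field_simps power2_eq_square)
    also have "\<dots> = (c * norm u)\<^sup>2" using c01 by (simp add: c_def power_mult_distrib)
    finally show ?thesis by (rule power2_le_imp_le) (use c in auto)
  qed
  have ex: "\<exists>!u. T u = z" for z
  proof -
    define f where "f u = u - \<tau> *\<^sub>R (T u - z)" for u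
    have "dist (f u) (f v) \<le> c * dist u v" for u v
    proof -
      have "f u - f v = (u - v) - \<tau> *\<^sub>R T (u - v)"
        by (simp add: f_def blinfun.bilinear_simps algebra_simps)
      then show ?thesis using contr[of "u - v"] by (simp add: dist_norm)
    qed
    then have "\<exists>!u. f u = u" using c by (intro banach_fix_type) auto
    moreover have "f u = u \<longleftrightarrow> T u = z" for u
      using e K(1) by (auto simp: f_def \<tau>_def)
    ultimately show ?thesis by simp
  qed
  define R where "R z = (THE u. T u = z)" for z
  have R: "T (R z) = z" for z unfolding R_def using theI'[OF ex] .
  have RT: "R (T z) = z" for z using ex[of "T z"] R[of "T z"] by blast
  have bd: "norm (R z) \<le> norm z * (1 / \<epsilon>)" for z
  proof -
    have "\<epsilon> * (norm (R z))\<^sup>2 \<le> norm (R z) * norm z"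
      using low[of "R z"] Re_cinner_le[of "R z" "T (R z)"] by (simp add: R)
    then have "\<epsilon> * norm (R z) \<le> norm z"
      by (cases "norm (R z) = 0") (auto simp: power2_eq_square)
    then show ?thesis using e by (simp add: field_simps)
  qed
  have bl: "bounded_linear R"
  proof (rule bounded_linear_intro[OF _ _ bd])
    show "R (x + y) = R x + R y" for x y
      using RT[of "R x + R y"] by (simp add: blinfun.add_right R)
    show "R (r *\<^sub>R x) = r *\<^sub>R R x" for r x
      using RT[of "r *\<^sub>R R x"] by (simp add: blinfun.scaleR_right R)
  qed
  have clR: "R (s *\<^sub>C x) = s *\<^sub>C R x" for s x
    using RT[of "s *\<^sub>C R x"] by (simp add: clinD[OF clT] R)
  show ?thesis
    by (rule that[of "Blinfun R"])
       (use bl clR R RT in \<open>auto simp: clin_def bounded_linear_Blinfun_apply T\<close>)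
qed

section \<open>Positive operators and their square roots\<close>

lemma positive_op_clin: "positive_op P \<Longrightarrow> clin P"
  by (simp add: positive_op_def clinear_op_clin)

lemma positive_op_Re: "positive_op P \<Longrightarrow> 0 \<le> Re (cinner x (P x))"
  by (auto simp: positive_op_def complex_nonneg_Reals_iff)

lemma positive_op_Im: "positive_op P \<Longrightarrow> Im (cinner x (P x)) = 0"
  by (auto simp: positive_op_def complex_nonneg_Reals_iff)

text \<open>Polarization: the form is real at \<open>u\<close>, \<open>v\<close> and
  \<open>u + v\<close>, so the imaginary parts of the two mixed terms cancel; replacing
  \<open>v\<close> by \<open>\<i> *\<^sub>C v\<close> turns this into equality of the real
  parts.\<close>

lemma positive_op_self_adjoint:
  assumes P: "positive_op P"
  shows "cinner (P x) y = cinner x (P y)"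
proof -
  note cl = clinD[OF positive_op_clin[OF P]]
  have 1: "Im (cinner u (P v)) + Im (cinner v (P u)) = 0" for u v
    using positive_op_Im[OF P, of "u + v"] positive_op_Im[OF P, of u] positive_op_Im[OF P, of v]
    by (simp add: cinner_simps blinfun.bilinear_simps)
  have 2: "Re (cinner u (P v)) = Re (cinner v (P u))" for u v
    using 1[of u "\<i> *\<^sub>C v"] by (simp add: cl cinner_simps)
  have "cinner x (P y) = cnj (cinner y (P x))"
    using 1[of x y] 2[of x y] by (simp add: complex_eq_iff)
  then show ?thesis by (metis cinner_commute)
qed

lemma positive_opI:
  assumes "clin P" "\<And>x y. cinner (P x) y = cinner x (P y)" "\<And>x. 0 \<le> Re (cinner x (P x))"
  shows "positive_op P"
  unfolding positive_op_def clinear_op_clin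
proof (intro conjI allI assms(1))
  fix x
  have "cinner x (P x) = cnj (cinner x (P x))"
    by (metis assms(2) cinner_commute)
  then have "Im (cinner x (P x)) = 0" by (simp add: complex_eq_iff)
  then show "cinner x (P x) \<in> \<real>\<^sub>\<ge>\<^sub>0" using assms(3) by (simp add: complex_nonneg_Reals_iff)
qed

lemma positive_adj_compose: "clin A \<Longrightarrow> positive_op (adj A o\<^sub>L A)"
  by (rule positive_opI) (auto simp: cinner_adj_right cinner_adj_left Re_cinner_self)

lemma blinfun_compose_assoc: "(A o\<^sub>L B) o\<^sub>L C = A o\<^sub>L (B o\<^sub>L C)"
  by (rule blinfun_eqI) simp

lemma blinfun_compose_id [simp]: "A o\<^sub>L id_blinfun = A" "id_blinfun o\<^sub>L A = A"
  by (rule blinfun_eqI; simp)+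

text \<open>With \<open>S = 1 - Y\<close> and \<open>P = 1 - Z\<close> the equation
  \<open>P o P = S\<close> becomes \<open>Z = (Y + Z o Z) / 2\<close>, which is solved by iteration
  from 0. The iterates are polynomials in \<open>S\<close>, whence the last clause: the root
  commutes with everything that commutes with \<open>S\<close>. Uniqueness of the root will rest on
  it.\<close>

lemma positive_sqrt_exists_contraction:
  fixes S :: "'a::chilbert_space \<Rightarrow>\<^sub>L 'a"
  assumes S: "positive_op S" "norm S \<le> 1"
  shows "\<exists>P. positive_op P \<and> P o\<^sub>L P = S \<and> (\<forall>Z. Z o\<^sub>L S = S o\<^sub>L Z \<longrightarrow> Z o\<^sub>L P = P o\<^sub>L Z)"
proof -
  interpret bc: bounded_bilinear "(o\<^sub>L) :: ('a \<Rightarrow>\<^sub>L 'a) \<Rightarrow> ('a \<Rightarrow>\<^sub>L 'a) \<Rightarrow> ('a \<Rightarrow>\<^sub>L 'a)"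
    by (rule bounded_bilinear_blinfun_compose)
  define Y where "Y = id_blinfun - S"
  \<comment> \<open>Positivity of \<open>S\<close> at \<open>x - S x\<close> yields
    \<open>S o S <= S\<close> before any square root is available.\<close>
  have normY: "norm Y \<le> 1"
  proof (rule norm_blinfun_bound)
    fix x
    have S1: "norm (S u) \<le> norm u" for u
      using norm_blinfun[of S u] S(2) mult_right_mono[of "norm S" 1 "norm u"] by simp
    have "0 \<le> Re (cinner (x - S x) (S (x - S x)))" by (rule positive_op_Re[OF S(1)])
    also have "\<dots> = Re (cinner x (S x)) - 2 * (norm (S x))\<^sup>2 + Re (cinner (S x) (S (S x)))"
      unfolding Re_cinner_self[symmetric]
      by (simp add: cinner_simps blinfun.bilinear_simps positive_op_self_adjoint[OF S(1)])
    also have "Re (cinner (S x) (S (S x))) \<le> norm (S x) * norm (S x)"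
      using Re_cinner_le[of "S x" "S (S x)"] S1[of "S x"] mult_left_mono[of _ _ "norm (S x)"]
      by (meson norm_ge_zero order_trans)
    finally have "(norm (S x))\<^sup>2 \<le> Re (cinner x (S x))" by (simp add: power2_eq_square)
    moreover have "(norm (Y x))\<^sup>2 = (norm x)\<^sup>2 + (norm (S x))\<^sup>2 - 2 * Re (cinner x (S x))"
      unfolding Y_def by (simp add: blinfun.bilinear_simps norm_diff_sq)
    ultimately have "(norm (Y x))\<^sup>2 \<le> (norm x)\<^sup>2" using positive_op_Re[OF S(1), of x] by linarith
    then show "norm (Y x) \<le> 1 * norm x" unfolding mult_1 by (rule power2_le_imp_le) simp
  qed simp
  define X where "X = rec_nat (0 :: 'a \<Rightarrow>\<^sub>L 'a) (\<lambda>_ Z. (1/2) *\<^sub>R (Y + (Z o\<^sub>L Z)))"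
  have X0: "X 0 = 0" and XS: "X (Suc n) = (1/2) *\<^sub>R (Y + (X n o\<^sub>L X n))" for n
    by (simp_all add: X_def)
  \<comment> \<open>The scalar majorant is the same iteration with 1 in place of
    \<open>norm Y\<close>. It increases to a limit and its increments dominate those of
    \<open>X\<close>, so \<open>X\<close> converges in norm even when
    \<open>norm Y = 1\<close>.\<close>
  define \<xi> where "\<xi> = rec_nat (0 :: real) (\<lambda>_ z. (1 + z * z) / 2)"
  have \<xi>0: "\<xi> 0 = 0" and \<xi>S: "\<xi> (Suc n) = (1 + \<xi> n * \<xi> n) / 2" for n
    by (simp_all add: \<xi>_def)
  have \<xi>01: "0 \<le> \<xi> n \<and> \<xi> n \<le> 1" for n
  proof (induction n)
    case (Suc n)
    then have "\<xi> n * \<xi> n \<le> 1" by (simp add: mult_le_one)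
    then show ?case by (simp add: \<xi>S)
  qed (simp add: \<xi>0)
  have nX: "norm (X n) \<le> \<xi> n" for n
  proof (induction n)
    case (Suc n)
    have "norm (Y + (X n o\<^sub>L X n)) \<le> 1 + \<xi> n * \<xi> n"
      by (intro norm_triangle_le add_mono normY order_trans[OF norm_blinfun_compose] mult_mono Suc)
         (use \<xi>01 in auto)
    then show ?case by (simp add: XS \<xi>S)
  qed (simp add: X0 \<xi>0)
  have step: "norm (X (Suc n) - X n) \<le> \<xi> (Suc n) - \<xi> n" for n
  proof (induction n)
    case 0
    then show ?case using normY by (simp add: X0 XS \<xi>S \<xi>0)
  next
    case (Suc n)
    let ?D = "X (Suc n) - X n" and ?d = "\<xi> (Suc n) - \<xi> n"
    have "X (Suc (Suc n)) - X (Suc n) = (1/2) *\<^sub>R ((X (Suc n) o\<^sub>L X (Suc n)) - (X n o\<^sub>L X n))"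
      unfolding XS[of "Suc n"] by (subst (3) XS) (simp add: algebra_simps)
    also have "(X (Suc n) o\<^sub>L X (Suc n)) - (X n o\<^sub>L X n) = (X (Suc n) o\<^sub>L ?D) + (?D o\<^sub>L X n)"
      by (simp add: bc.diff_left bc.diff_right)
    also have "norm ((1/2) *\<^sub>R \<dots>) \<le> (1/2) * (\<xi> (Suc n) * ?d + ?d * \<xi> n)"
      unfolding norm_scaleR
      by (intro mult_mono norm_triangle_le add_mono order_trans[OF norm_blinfun_compose] nX Suc)
         (use \<xi>01 order_trans[OF norm_ge_zero Suc] in auto)
    also have "\<dots> = \<xi> (Suc (Suc n)) - \<xi> (Suc n)"
      unfolding \<xi>S[of "Suc n"] by (subst (5) \<xi>S) (simp add: algebra_simps)
    finally show ?case .
  qed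
  have diff: "norm (X (m + k) - X m) \<le> \<xi> (m + k) - \<xi> m" for m k
  proof (induction k)
    case (Suc k)
    have "norm (X (m + Suc k) - X m) \<le> norm (X (Suc (m + k)) - X (m + k)) + norm (X (m + k) - X m)"
      using norm_triangle_ineq[of "X (Suc (m + k)) - X (m + k)" "X (m + k) - X m"] by simp
    then show ?case using Suc step[of "m + k"] by simp
  qed simp
  have "incseq \<xi>"
    by (rule incseq_SucI) (use step order_trans[OF norm_ge_zero step] in auto)
  moreover have "bdd_above (range \<xi>)" using \<xi>01 by (intro bdd_aboveI[of _ 1]) auto
  ultimately have "convergent \<xi>" using \<xi>01 by (intro Bseq_mono_convergent) (auto simp: Bseq_def incseq_def intro!: exI[of _ 1])
  then have "Cauchy \<xi>" by (rule convergent_Cauchy)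
  have "Cauchy X"
  proof (rule metric_CauchyI)
    fix e :: real assume "e > 0"
    then obtain M where M: "\<And>m n. m \<ge> M \<Longrightarrow> n \<ge> M \<Longrightarrow> dist (\<xi> m) (\<xi> n) < e"
      using metric_CauchyD[OF \<open>Cauchy \<xi>\<close>] by blast
    have *: "dist (X m) (X n) < e" if "m \<ge> M" "n \<ge> m" for m n
      using diff[of m "n - m"] M[of n m] that
      by (simp add: dist_norm norm_minus_commute)
    have "dist (X m) (X n) < e" if "m \<ge> M" "n \<ge> M" for m n
      using *[of m n] *[of n m] that by (cases "m \<le> n") (auto simp: dist_commute)
    then show "\<exists>M. \<forall>m\<ge>M. \<forall>n\<ge>M. dist (X m) (X n) < e" by blast
  qed
  then obtain Z where Z: "X \<longlonglongrightarrow> Z" by (auto simp: Cauchy_convergent_iff convergent_def)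
  have "(\<lambda>n. X (Suc n)) \<longlonglongrightarrow> (1/2) *\<^sub>R (Y + (Z o\<^sub>L Z))"
    unfolding XS by (intro tendsto_intros bc.tendsto Z)
  moreover have "(\<lambda>n. X (Suc n)) \<longlonglongrightarrow> Z" using Z by (rule LIMSEQ_Suc)
  ultimately have Zeq: "(1/2) *\<^sub>R (Y + (Z o\<^sub>L Z)) = Z" by (rule LIMSEQ_unique)
  have ZZ: "Z o\<^sub>L Z = 2 *\<^sub>R Z - Y"
    using arg_cong[OF Zeq, of "\<lambda>A. 2 *\<^sub>R A"] by (simp add: algebra_simps)
  have clS: "clin S" using S(1) by (rule positive_op_clin)
  have clX: "clin (X n)" for n
    by (induction n) (auto simp: X0 XS Y_def intro!: clin_scaleR clin_add clin_compose clin_diff clS)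
  have clZ: "clin Z" using clin_lim[OF Z clX] by simp
  have saX: "cinner (X n x) y = cinner x (X n y)" for n x y
    by (induction n arbitrary: x y)
       (simp_all add: X0 XS Y_def blinfun.bilinear_simps cinner_simps positive_op_self_adjoint[OF S(1)])
  have saZ: "cinner (Z x) y = cinner x (Z y)" for x y
  proof -
    have "(\<lambda>n. cinner (X n x) y) \<longlonglongrightarrow> cinner (Z x) y"
      by (intro tendsto_cinner blinfun.tendsto Z tendsto_const)
    moreover have "(\<lambda>n. cinner (X n x) y) \<longlonglongrightarrow> cinner x (Z y)"
      unfolding saX by (intro tendsto_cinner blinfun.tendsto Z tendsto_const)
    ultimately show ?thesis by (rule LIMSEQ_unique)
  qed
  have "norm Z \<le> 1"
    using Z nX \<xi>01 by (intro LIMSEQ_le_const2[OF tendsto_norm[OF Z]]) (meson order_trans)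
  define P where "P = id_blinfun - Z"
  have PP: "P o\<^sub>L P = S"
    unfolding P_def bc.diff_left bc.diff_right ZZ
    by (intro blinfun_eqI) (simp add: Y_def blinfun.bilinear_simps scaleR_2)
  have "positive_op P"
  proof (rule positive_opI)
    show "clin P" unfolding P_def using clZ by auto
    show "cinner (P x) y = cinner x (P y)" for x y
      by (simp add: P_def blinfun.bilinear_simps cinner_simps saZ)
    fix x
    have "Re (cinner x (Z x)) \<le> norm x * (norm Z * norm x)"
      by (rule order_trans[OF Re_cinner_le]) (intro mult_left_mono norm_blinfun norm_ge_zero)
    also have "\<dots> \<le> norm x * (1 * norm x)"
      by (intro mult_left_mono mult_right_mono \<open>norm Z \<le> 1\<close>) auto
    finally show "0 \<le> Re (cinner x (P x))"
      by (simp add: P_def blinfun.bilinear_simps cinner_simps Re_cinner_self power2_eq_square)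
  qed
  moreover have "W o\<^sub>L P = P o\<^sub>L W" if W: "W o\<^sub>L S = S o\<^sub>L W" for W
  proof -
    have "W o\<^sub>L X n = X n o\<^sub>L W" for n
    proof (induction n)
      case (Suc n)
      have "W o\<^sub>L (X n o\<^sub>L X n) = (X n o\<^sub>L X n) o\<^sub>L W"
        by (metis Suc blinfun_compose_assoc)
      then show ?case using W
        by (simp add: XS Y_def bc.add_left bc.add_right bc.diff_left bc.diff_right
            bc.scaleR_left bc.scaleR_right)
    qed (simp add: X0 bc.zero_left bc.zero_right)
    moreover have "(\<lambda>n. W o\<^sub>L X n) \<longlonglongrightarrow> (W o\<^sub>L Z)" "(\<lambda>n. X n o\<^sub>L W) \<longlonglongrightarrow> (Z o\<^sub>L W)"
      by (intro bc.tendsto Z tendsto_const)+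
    ultimately have "W o\<^sub>L Z = Z o\<^sub>L W" by (simp add: LIMSEQ_unique)
    then show ?thesis by (simp add: P_def bc.diff_left bc.diff_right)
  qed
  ultimately show ?thesis using PP by blast
qed

lemma positive_op_scaleR: "positive_op P \<Longrightarrow> 0 \<le> r \<Longrightarrow> positive_op (r *\<^sub>R P)"
  by (rule positive_opI)
     (auto simp: positive_op_clin positive_op_self_adjoint positive_op_Re blinfun.bilinear_simps cinner_simps)

lemma positive_sqrt_exists:
  fixes S :: "'a::chilbert_space \<Rightarrow>\<^sub>L 'a"
  assumes S: "positive_op S"
  shows "\<exists>P. positive_op P \<and> P o\<^sub>L P = S \<and> (\<forall>Z. Z o\<^sub>L S = S o\<^sub>L Z \<longrightarrow> Z o\<^sub>L P = P o\<^sub>L Z)"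
proof (cases "S = 0")
  case True
  then show ?thesis
    by (intro exI[of _ 0])
       (auto intro!: positive_opI simp: bounded_bilinear.zero_left[OF bounded_bilinear_blinfun_compose]
          bounded_bilinear.zero_right[OF bounded_bilinear_blinfun_compose])
next
  case False
  interpret bc: bounded_bilinear "(o\<^sub>L) :: ('a \<Rightarrow>\<^sub>L 'a) \<Rightarrow> ('a \<Rightarrow>\<^sub>L 'a) \<Rightarrow> ('a \<Rightarrow>\<^sub>L 'a)"
    by (rule bounded_bilinear_blinfun_compose)
  define r where "r = norm S"
  have r: "r > 0" using False by (simp add: r_def)
  have "positive_op ((1/r) *\<^sub>R S)" "norm ((1/r) *\<^sub>R S) \<le> 1"
    using r S by (auto intro: positive_op_scaleR simp: r_def)
  from positive_sqrt_exists_contraction[OF this] obtain P where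
    P: "positive_op P" "P o\<^sub>L P = (1/r) *\<^sub>R S"
      "\<And>Z. Z o\<^sub>L ((1/r) *\<^sub>R S) = ((1/r) *\<^sub>R S) o\<^sub>L Z \<Longrightarrow> Z o\<^sub>L P = P o\<^sub>L Z"
    by blast
  show ?thesis
  proof (intro exI[of _ "sqrt r *\<^sub>R P"] conjI allI impI)
    show "positive_op (sqrt r *\<^sub>R P)" using r by (intro positive_op_scaleR[OF P(1)]) simp
    show "(sqrt r *\<^sub>R P) o\<^sub>L (sqrt r *\<^sub>R P) = S"
      using r by (simp add: bc.scaleR_left bc.scaleR_right P(2))
    show "Z o\<^sub>L sqrt r *\<^sub>R P = sqrt r *\<^sub>R P o\<^sub>L Z" if "Z o\<^sub>L S = S o\<^sub>L Z" for Z
      using P(3)[of Z] that by (simp add: bc.scaleR_left bc.scaleR_right)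
  qed
qed

text \<open>\<open>op_sqrt\<close> is a definite description, so uniqueness is the point. A second
  root \<open>Q\<close> commutes with \<open>S = Q o Q\<close>, hence with \<open>P\<close>; then
  \<open>P + Q\<close> annihilates \<open>y = P x - Q x\<close>, both forms vanish at
  \<open>y\<close>, and \<open>y = 0\<close> follows.\<close>

lemma op_sqrt:
  assumes S: "positive_op S"
  shows "positive_op (op_sqrt S)" "op_sqrt S o\<^sub>L op_sqrt S = S"
proof -
  interpret bc: bounded_bilinear "(o\<^sub>L) :: ('a \<Rightarrow>\<^sub>L 'a) \<Rightarrow> ('a \<Rightarrow>\<^sub>L 'a) \<Rightarrow> ('a \<Rightarrow>\<^sub>L 'a)"
    by (rule bounded_bilinear_blinfun_compose)
  obtain P where P: "positive_op P" "P o\<^sub>L P = S" "\<And>Z. Z o\<^sub>L S = S o\<^sub>L Z \<Longrightarrow> Z o\<^sub>L P = P o\<^sub>L Z"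
    using positive_sqrt_exists[OF S] by blast
  have uniq: "Q = P" if Q: "positive_op Q" "Q o\<^sub>L Q = S" for Q
  proof -
    have "Q o\<^sub>L P = P o\<^sub>L Q" by (rule P(3)) (metis Q(2) blinfun_compose_assoc)
    then have QP: "Q (P x) = P (Q x)" for x by (metis blinfun_apply_blinfun_compose)
    have QQ: "Q (Q x) = P (P x)" for x by (metis blinfun_apply_blinfun_compose P(2) Q(2))
    have "Q x = P x" for x
    proof -
      define y where "y = P x - Q x"
      have "P y + Q y = 0" by (simp add: y_def blinfun.bilinear_simps QP QQ)
      then have "Re (cinner y (P y)) + Re (cinner y (Q y)) = 0"
        by (metis cinner_add_right cinner_zero_right plus_complex.sel(1) zero_complex.sel(1))
      then have "Re (cinner y (P y)) = 0" "Re (cinner y (Q y)) = 0"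
        using positive_op_Re[OF P(1), of y] positive_op_Re[OF Q(1), of y] by linarith+
      \<comment> \<open>A root \<open>R\<close> of \<open>T\<close> shows that a vector at which the
        form of \<open>T\<close> vanishes lies in the kernel of \<open>T\<close>.\<close>
      moreover have null: "T y = 0" if T: "positive_op T" and "Re (cinner y (T y)) = 0" for T
      proof -
        obtain R where R: "positive_op R" "R o\<^sub>L R = T" using positive_sqrt_exists[OF T] by blast
        have "(norm (R y))\<^sup>2 = Re (cinner y (T y))"
          unfolding R(2)[symmetric] by (simp add: positive_op_self_adjoint[OF R(1)] flip: Re_cinner_self)
        then have "R y = 0" using that by simp
        then show ?thesis unfolding R(2)[symmetric] by (simp add: blinfun.zero_right)
      qed
      ultimately have y: "P y = 0" "Q y = 0" using P(1) Q(1) by blast+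
      have "(norm y)\<^sup>2 = Re (cinner x (P y - Q y))"
        unfolding Re_cinner_self[symmetric] y_def
        by (simp add: cinner_simps blinfun.bilinear_simps positive_op_self_adjoint[OF P(1)]
            positive_op_self_adjoint[OF Q(1)])
      then show ?thesis using y by (simp add: y_def)
    qed
    then show ?thesis by (rule blinfun_eqI)
  qed
  have "positive_op (op_sqrt S) \<and> op_sqrt S o\<^sub>L op_sqrt S = S"
    unfolding op_sqrt_def using theI[of "\<lambda>P. positive_op P \<and> P o\<^sub>L P = S", OF conjI[OF P(1,2)]] uniq by blast
  then show "positive_op (op_sqrt S)" "op_sqrt S o\<^sub>L op_sqrt S = S" by auto
qed

lemma norm_sq_op_sqrt:
  assumes "positive_op S"
  shows "(norm (op_sqrt S x))\<^sup>2 = Re (cinner x (S x))"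
proof -
  have "cinner x (S x) = cinner x (op_sqrt S (op_sqrt S x))"
    by (metis op_sqrt(2)[OF assms] blinfun_apply_blinfun_compose)
  also have "\<dots> = cinner (op_sqrt S x) (op_sqrt S x)"
    by (rule positive_op_self_adjoint[OF op_sqrt(1)[OF assms], symmetric])
  finally show ?thesis by (simp add: Re_cinner_self)
qed

section \<open>Orthonormal bases\<close>

definition orthonormal :: "'a::chilbert_space set \<Rightarrow> bool" where
  "orthonormal E \<longleftrightarrow> (\<forall>e\<in>E. norm e = 1) \<and> (\<forall>e\<in>E. \<forall>e'\<in>E. e \<noteq> e' \<longrightarrow> cinner e e' = 0)"

lemma orthonormal_basis_iff:
  "orthonormal_basis E \<longleftrightarrow> orthonormal E \<and> (\<forall>x. (\<forall>e\<in>E. cinner e x = 0) \<longrightarrow> x = 0)"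
  by (simp add: orthonormal_basis_def orthonormal_def)

lemma orthonormal_cinner:
  "orthonormal E \<Longrightarrow> e \<in> E \<Longrightarrow> e' \<in> E \<Longrightarrow> cinner e e' = (if e = e' then 1 else 0)"
  by (auto simp: orthonormal_def cinner_self)

lemma orthonormal_subset: "orthonormal E \<Longrightarrow> F \<subseteq> E \<Longrightarrow> orthonormal F"
  by (auto simp: orthonormal_def subset_iff)

lemma orthonormal_basis_exists: "\<exists>E :: 'a::chilbert_space set. orthonormal_basis E"
proof -
  have "\<exists>M\<in>Collect (orthonormal :: 'a set \<Rightarrow> bool). \<forall>X\<in>Collect orthonormal. M \<subseteq> X \<longrightarrow> X = M"
  proof (rule subset_Zorn_nonempty)
    show "Collect (orthonormal :: 'a set \<Rightarrow> bool) \<noteq> {}"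
      by (auto simp: orthonormal_def intro!: exI[of _ "{}"])
    fix \<C> :: "'a set set"
    assume c: "\<C> \<noteq> {}" "subset.chain (Collect orthonormal) \<C>"
    have on: "orthonormal X" if "X \<in> \<C>" for X using c(2) that by (auto simp: subset.chain_def)
    have "\<exists>X\<in>\<C>. e \<in> X \<and> e' \<in> X" if "e \<in> \<Union>\<C>" "e' \<in> \<Union>\<C>" for e e'
    proof -
      from that obtain X X' where X: "X \<in> \<C>" "X' \<in> \<C>" "e \<in> X" "e' \<in> X'" by blast
      then have "X \<subseteq> X' \<or> X' \<subseteq> X" using c(2) by (auto simp: subset_chain_def)
      then show ?thesis using X by blast
    qed
    then show "\<Union>\<C> \<in> Collect orthonormal"
      using on unfolding orthonormal_def mem_Collect_eq by (metis UnionE)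
  qed
  then obtain M :: "'a set" where M: "orthonormal M" "\<And>X. orthonormal X \<Longrightarrow> M \<subseteq> X \<Longrightarrow> X = M"
    by auto
  have "x = 0" if x: "\<forall>e\<in>M. cinner e x = 0" for x
  proof (rule ccontr)
    assume "x \<noteq> 0"
    define u where "u = (1 / norm x) *\<^sub>R x"
    have nu: "norm u = 1" using \<open>x \<noteq> 0\<close> by (simp add: u_def)
    have u0: "cinner e u = 0" "cinner u e = 0" if "e \<in> M" for e
    proof -
      show "cinner e u = 0" using x that by (simp add: u_def cinner_simps)
      then show "cinner u e = 0" using cinner_commute[of u e] by simp
    qed
    have "orthonormal (insert u M)"
      using M(1) nu u0 unfolding orthonormal_def by auto
    then have "u \<in> M" using M(2) by blast
    then have "cinner u u = 0" by (rule u0)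
    then show False using nu by (simp add: cinner_self)
  qed
  then show ?thesis using M(1) by (auto simp: orthonormal_basis_iff)
qed

lemma cinner_orthonormal_sum:
  assumes "orthonormal E" "finite F" "F \<subseteq> E" "e \<in> E"
  shows "cinner e (\<Sum>f\<in>F. c f *\<^sub>C f) = (if e \<in> F then c e else 0)"
proof -
  have "cinner e (\<Sum>f\<in>F. c f *\<^sub>C f) = (\<Sum>f\<in>F. c f * (if e = f then 1 else 0))"
    unfolding cinner_sum_right cinner_scaleC_right
    using assms by (intro sum.cong) (auto simp: orthonormal_cinner)
  also have "\<dots> = (\<Sum>f\<in>F. if e = f then c f else 0)" by (intro sum.cong) auto
  also have "\<dots> = (if e \<in> F then c e else 0)" using assms(2) by (rule sum.delta')
  finally show ?thesis .
qed

lemma norm_orthonormal_residual: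
  assumes "orthonormal F" "finite F"
  shows "(norm (x - (\<Sum>e\<in>F. cinner e x *\<^sub>C e)))\<^sup>2 = (norm x)\<^sup>2 - (\<Sum>e\<in>F. (cmod (cinner e x))\<^sup>2)"
proof -
  let ?p = "\<Sum>e\<in>F. cinner e x *\<^sub>C e"
  have "Re (cinner y ?p) = Re (\<Sum>e\<in>F. cinner e x * cnj (cinner e y))" for y
    unfolding cinner_sum_right cinner_scaleC_right by (subst (2) cinner_commute) simp
  moreover have "cinner x ?p = cinner ?p ?p"
  proof -
    have "cinner ?p ?p = (\<Sum>e\<in>F. cinner e x * cnj (cinner e ?p))"
      unfolding cinner_sum_right[of ?p] cinner_scaleC_right by (subst (4) cinner_commute) simp
    also have "\<dots> = (\<Sum>e\<in>F. cinner e x * cnj (cinner e x))"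
      by (intro sum.cong refl) (simp add: cinner_orthonormal_sum[OF assms(1,2) order_refl])
    also have "\<dots> = cinner x ?p"
      unfolding cinner_sum_right cinner_scaleC_right by (subst (2) cinner_commute) simp
    finally show ?thesis by simp
  qed
  moreover have "(\<Sum>e\<in>F. cinner e x * cnj (cinner e x)) = of_real (\<Sum>e\<in>F. (cmod (cinner e x))\<^sup>2)"
    by (simp only: of_real_sum complex_norm_square)
  ultimately have "Re (cinner x ?p) = (\<Sum>e\<in>F. (cmod (cinner e x))\<^sup>2)"
    "Re (cinner ?p ?p) = Re (cinner x ?p)"
    by (metis Re_complex_of_real)+
  then show ?thesis unfolding norm_diff_sq by (simp add: Re_cinner_self)
qed

lemma bessel_inequality:
  assumes "orthonormal F" "finite F"
  shows "(\<Sum>e\<in>F. (cmod (cinner e x))\<^sup>2) \<le> (norm x)\<^sup>2"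
  using norm_orthonormal_residual[OF assms, of x] zero_le_power2[of "norm (x - (\<Sum>e\<in>F. cinner e x *\<^sub>C e))"]
  by linarith

lemma infsum_SUP_ennreal:
  fixes f :: "'b \<Rightarrow> ennreal"
  shows "infsum f A = (SUP F\<in>{F. finite F \<and> F \<subseteq> A}. sum f F)"
  by (rule nonneg_infsum_complete) simp

text \<open>The basis may be uncountable, so increasing finite sets \<open>G n\<close> are chosen
  whose partial sums approach the supremum \<open>\<sigma>\<close>. The projections
  \<open>p (G n)\<close> converge, and the limit is \<open>x\<close> because a basis vector outside
  \<open>G n\<close> cannot contribute more than \<open>\<sigma> - S (G n)\<close>.\<close>

lemma parseval_le:
  assumes E: "orthonormal_basis E"
  shows "ennreal ((norm x)\<^sup>2) \<le> (\<Sum>\<^sub>\<infinity>e\<in>E. ennreal ((cmod (cinner e x))\<^sup>2))"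
proof -
  have on: "orthonormal E" and tot: "\<And>x. (\<And>e. e \<in> E \<Longrightarrow> cinner e x = 0) \<Longrightarrow> x = 0"
    using E by (auto simp: orthonormal_basis_iff)
  define S where "S F = (\<Sum>e\<in>F. (cmod (cinner e x))\<^sup>2)" for F
  define p where "p F = (\<Sum>e\<in>F. cinner e x *\<^sub>C e)" for F
  define FF where "FF = {F. finite F \<and> F \<subseteq> E}"
  have FFon: "orthonormal F" "finite F" if "F \<in> FF" for F
    using that orthonormal_subset[OF on] by (auto simp: FF_def)
  have S_le: "S F \<le> (norm x)\<^sup>2" if "F \<in> FF" for F
    unfolding S_def by (intro bessel_inequality FFon that)
  have bdd: "bdd_above (S ` FF)" using S_le by (intro bdd_aboveI) auto
  define \<sigma> where "\<sigma> = (SUP F\<in>FF. S F)"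
  have S_sig: "S F \<le> \<sigma>" if "F \<in> FF" for F
    unfolding \<sigma>_def by (rule cSUP_upper[OF that bdd])
  have "\<exists>F\<in>FF. \<sigma> - inverse (real (Suc n)) < S F" for n
  proof -
    have "{} \<in> FF" by (simp add: FF_def)
    then show ?thesis using less_cSUP_iff[of FF S "\<sigma> - inverse (real (Suc n))"] bdd
      unfolding \<sigma>_def[symmetric] by (auto simp: \<sigma>_def)
  qed
  then obtain F where F: "\<And>n. F n \<in> FF" "\<And>n. \<sigma> - inverse (real (Suc n)) < S (F n)" by metis
  define G where "G n = (\<Union>k\<le>n. F k)" for n
  have GFF: "G n \<in> FF" for n using F(1) by (auto simp: G_def FF_def)
  have Smono: "S X \<le> S Y" if "X \<subseteq> Y" "Y \<in> FF" for X Y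
    unfolding S_def using that by (intro sum_mono2) (auto simp: FF_def)
  have SG: "\<sigma> - inverse (real (Suc n)) < S (G n)" for n
  proof -
    have "F n \<subseteq> G n" by (auto simp: G_def)
    then show ?thesis using F(2)[of n] Smono[of "F n" "G n"] GFF[of n] by linarith
  qed
  have mono: "G m \<subseteq> G n" if "m \<le> n" for m n
    unfolding G_def using that by (intro UN_mono) auto
  have res: "(norm (x - p X))\<^sup>2 = (norm x)\<^sup>2 - S X" if "X \<in> FF" for X
    unfolding p_def S_def using norm_orthonormal_residual[OF FFon[OF that]] .
  have cip: "cinner e (p X) = (if e \<in> X then cinner e x else 0)" if "e \<in> E" "X \<in> FF" for e X
    unfolding p_def using that by (intro cinner_orthonormal_sum[OF on]) (auto simp: FF_def)
  have diff: "(norm (p (G n) - p (G m)))\<^sup>2 \<le> inverse (real (Suc m))" if "m \<le> n" for m n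
  proof -
    have D: "G n - G m \<in> FF" using GFF[of n] by (auto simp: FF_def)
    have fG: "finite (G n)" using GFF[of n] by (simp add: FF_def)
    have sd: "p (G n) - p (G m) = p (G n - G m)" "S (G n) - S (G m) = S (G n - G m)"
      unfolding p_def S_def by (simp_all add: sum_diff[OF fG mono[OF that]])
    have "(norm (p (G n - G m)))\<^sup>2 = S (G n - G m)"
    proof -
      let ?D = "G n - G m"
      have "cinner (p ?D) (p ?D) = (\<Sum>e\<in>?D. cnj (cinner e x) * cinner e (p ?D))"
        by (subst (1) p_def) (simp add: cinner_sum_left cinner_scaleC_left)
      also have "\<dots> = (\<Sum>e\<in>?D. cnj (cinner e x) * cinner e x)"
        using D by (intro sum.cong) (auto simp: cip[OF _ D] FF_def)
      also have "\<dots> = of_real (S ?D)"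
        unfolding S_def of_real_sum by (simp only: complex_norm_square mult.commute)
      finally show ?thesis by (metis Re_complex_of_real Re_cinner_self)
    qed
    then show ?thesis using sd SG[of m] S_sig[OF GFF[of n]] by simp
  qed
  have inv0: "(\<lambda>n. inverse (real (Suc n))) \<longlonglongrightarrow> 0" by (rule LIMSEQ_inverse_real_of_nat)
  have "Cauchy (\<lambda>n. p (G n))"
  proof (rule metric_CauchyI)
    fix e :: real assume e: "e > 0"
    obtain M where M: "inverse (real (Suc M)) < e\<^sup>2" using reals_Archimedean[of "e\<^sup>2"] e by auto
    have *: "dist (p (G n)) (p (G m)) < e" if "M \<le> m" "m \<le> n" for m n
    proof -
      have "inverse (real (Suc m)) \<le> inverse (real (Suc M))" using that by (simp add: le_imp_inverse_le)
      then have "(norm (p (G n) - p (G m)))\<^sup>2 < e\<^sup>2" using diff[OF that(2)] M by linarith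
      then show ?thesis unfolding dist_norm using e by (intro power2_less_imp_less[of _ e]) auto
    qed
    have "dist (p (G m)) (p (G n)) < e" if "m \<ge> M" "n \<ge> M" for m n
      using *[of m n] *[of n m] that by (cases "m \<le> n") (auto simp: dist_commute)
    then show "\<exists>M. \<forall>m\<ge>M. \<forall>n\<ge>M. dist (p (G m)) (p (G n)) < e" by blast
  qed
  then obtain z where z: "(\<lambda>n. p (G n)) \<longlonglongrightarrow> z" by (auto simp: Cauchy_convergent_iff convergent_def)
  have "cinner e (x - z) = 0" if e: "e \<in> E" for e
  proof -
    have "(\<lambda>n. cinner e (x - p (G n))) \<longlonglongrightarrow> cinner e (x - z)"
      by (intro tendsto_cinner tendsto_const tendsto_diff z)
    moreover have "(\<lambda>n. cinner e (x - p (G n))) \<longlonglongrightarrow> 0"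
    proof -
      have "(cmod (cinner e (x - p (G n))))\<^sup>2 \<le> inverse (real (Suc n))" for n
      proof (cases "e \<in> G n")
        case False
        have "insert e (G n) \<in> FF" using GFF[of n] e by (auto simp: FF_def)
        then have "S (insert e (G n)) \<le> \<sigma>" by (rule S_sig)
        moreover have "S (insert e (G n)) = S (G n) + (cmod (cinner e x))\<^sup>2"
          unfolding S_def using False GFF[of n] by (subst sum.insert) (auto simp: FF_def)
        ultimately show ?thesis using SG[of n] False by (simp add: cinner_diff_right cip e GFF)
      qed (simp add: cinner_diff_right cip e GFF)
      then have "(\<lambda>n. (cmod (cinner e (x - p (G n))))\<^sup>2) \<longlonglongrightarrow> 0"
        by (intro tendsto_sandwich[OF _ _ tendsto_const inv0]) auto
      then show ?thesis by (simp add: tendsto_norm_zero_iff)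
    qed
    ultimately show ?thesis by (rule LIMSEQ_unique)
  qed
  then have "z = x" using tot[of "x - z"] by simp
  have lim: "(\<lambda>n. (norm x)\<^sup>2 - S (G n)) \<longlonglongrightarrow> 0"
  proof -
    have "(\<lambda>n. (norm (x - p (G n)))\<^sup>2) \<longlonglongrightarrow> (norm (x - x))\<^sup>2"
      using z unfolding \<open>z = x\<close> by (intro tendsto_intros)
    then show ?thesis by (simp add: res GFF)
  qed
  then have "(\<lambda>n. ennreal (S (G n))) \<longlonglongrightarrow> ennreal ((norm x)\<^sup>2)"
    using tendsto_diff[OF tendsto_const[of "(norm x)\<^sup>2"] lim] by (intro tendsto_ennrealI) simp
  then show ?thesis
  proof (rule LIMSEQ_le_const2, intro exI allI impI)
    fix n
    have "ennreal (S (G n)) = sum (\<lambda>e. ennreal ((cmod (cinner e x))\<^sup>2)) (G n)"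
      unfolding S_def by (subst sum_ennreal) auto
    also have "\<dots> \<le> (\<Sum>\<^sub>\<infinity>e\<in>E. ennreal ((cmod (cinner e x))\<^sup>2))"
      unfolding infsum_SUP_ennreal using GFF[of n] by (intro SUP_upper) (simp add: FF_def)
    finally show "ennreal (S (G n)) \<le> (\<Sum>\<^sub>\<infinity>e\<in>E. ennreal ((cmod (cinner e x))\<^sup>2))" .
  qed
qed


section \<open>The trace norm as a supremum over Bessel families\<close>

text \<open>The map \<open>h \<mapsto> (cinner (x i) h)\<close> is a contraction into
  \<open>n\<close>-dimensional space. Unlike orthonormal families, these families are carried to
  families of the same kind by every contraction and its adjoint.\<close>

definition bessel :: "nat \<Rightarrow> (nat \<Rightarrow> 'a::chilbert_space) \<Rightarrow> bool" where
  "bessel n x \<longleftrightarrow> (\<forall>h. (\<Sum>i<n. (cmod (cinner (x i) h))\<^sup>2) \<le> (norm h)\<^sup>2)"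

text \<open>The trace norm as the supremum of \<open>Re (tr (A W))\<close> over the finite rank
  contractions \<open>W\<close> that send \<open>h\<close> to the sum of the
  \<open>cinner (y i) h *\<^sub>C x i\<close>. This form avoids the polar decomposition and makes
  sense between two spaces.\<close>

definition nuc :: "('a::chilbert_space \<Rightarrow>\<^sub>L 'b::chilbert_space) \<Rightarrow> ennreal" where
  "nuc A = (SUP (n, x, y)\<in>{(n, x, y). bessel n x \<and> bessel n y}.
     ennreal (Re (\<Sum>i<n. cinner (y i) (blinfun_apply A (x i)))))"

lemma nuc_ge: "bessel n x \<Longrightarrow> bessel n y \<Longrightarrow> ennreal (Re (\<Sum>i<n. cinner (y i) (blinfun_apply A (x i)))) \<le> nuc A"
  unfolding nuc_def by (rule SUP_upper2[of "(n, x, y)"]) auto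

lemma nuc_leI:
  "(\<And>n x y. bessel n x \<Longrightarrow> bessel n y \<Longrightarrow> ennreal (Re (\<Sum>i<n. cinner (y i) (blinfun_apply A (x i)))) \<le> B) \<Longrightarrow> nuc A \<le> B"
  unfolding nuc_def by (rule SUP_least) auto

lemma bessel_map:
  assumes "clin V" "\<And>h. norm (blinfun_apply V h) \<le> norm h" "bessel n x"
  shows "bessel n (\<lambda>i. adj V (x i))"
  unfolding bessel_def
proof
  fix h
  have "(\<Sum>i<n. (cmod (cinner (adj V (x i)) h))\<^sup>2) \<le> (norm (blinfun_apply V h))\<^sup>2"
    unfolding cinner_adj_left[OF assms(1)] using assms(3) by (simp add: bessel_def)
  also have "\<dots> \<le> (norm h)\<^sup>2" by (intro power_mono assms(2)) simp
  finally show "(\<Sum>i<n. (cmod (cinner (adj V (x i)) h))\<^sup>2) \<le> (norm h)\<^sup>2" .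
qed

lemma norm_adj_contraction:
  assumes "clin V" "\<And>h. norm (blinfun_apply V h) \<le> norm h"
  shows "norm (adj V h) \<le> norm h"
proof -
  have "norm V \<le> 1" by (rule norm_blinfun_bound) (use assms in auto)
  then have "norm (adj V) \<le> 1" using norm_adj_le[OF assms(1)] by linarith
  then show ?thesis using norm_blinfun[of "adj V" h] mult_right_mono[of "norm (adj V)" 1 "norm h"] by simp
qed

lemma bessel_map':
  assumes "clin V" "\<And>h. norm (blinfun_apply V h) \<le> norm h" "bessel n x"
  shows "bessel n (\<lambda>i. V (x i))"
  using bessel_map[OF clin_adj[OF assms(1)] norm_adj_contraction[OF assms(1,2)] assms(3)]
  by (simp add: adj_adj assms)

lemma bessel_orthonormal:
  assumes "orthonormal E" "inj_on x {..<n}" "x ` {..<n} \<subseteq> E"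
  shows "bessel n x"
  unfolding bessel_def
proof
  fix h
  have "(\<Sum>i<n. (cmod (cinner (x i) h))\<^sup>2) = (\<Sum>e\<in>x ` {..<n}. (cmod (cinner e h))\<^sup>2)"
    using assms(2) by (simp add: sum.reindex)
  also have "\<dots> \<le> (norm h)\<^sup>2"
    using assms orthonormal_subset by (intro bessel_inequality) blast+
  finally show "(\<Sum>i<n. (cmod (cinner (x i) h))\<^sup>2) \<le> (norm h)\<^sup>2" .
qed

lemma ennreal_add_le: "ennreal (a + b) \<le> ennreal a + ennreal b"
proof -
  have "ennreal (a + b) \<le> ennreal (max 0 a + max 0 b)" by (rule ennreal_leI) auto
  also have "\<dots> = ennreal a + ennreal b" by (simp add: ennreal_plus ennreal_max_0)
  finally show ?thesis .
qed

text \<open>Domination means \<open>A = W o B\<close> with a contraction \<open>W\<close>. Instead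
  of extending \<open>W\<close> from the range of \<open>B\<close>, take
  \<open>W = A o R o adj B\<close> with \<open>R\<close> the inverse of
  \<open>adj B o B + \<epsilon>\<close>; this is a contraction, and \<open>W o B\<close> misses
  \<open>A\<close> by a term of norm at most \<open>sqrt \<epsilon>\<close>.\<close>

lemma nuc_mono:
  fixes A :: "'a::chilbert_space \<Rightarrow>\<^sub>L 'b::chilbert_space" and B :: "'a \<Rightarrow>\<^sub>L 'c::chilbert_space"
  assumes A: "clin A" and B: "clin B" and dom: "\<And>x. norm (A x) \<le> norm (B x)"
  shows "nuc A \<le> nuc B"
proof (rule nuc_leI)
  fix n and x :: "nat \<Rightarrow> 'a" and y :: "nat \<Rightarrow> 'b"
  assume x: "bessel n x" and y: "bessel n y"
  define c where "c = (\<Sum>i<n. norm (y i) * norm (x i))"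
  have c: "0 \<le> c" unfolding c_def by (intro sum_nonneg) simp
  show "ennreal (Re (\<Sum>i<n. cinner (y i) (A (x i)))) \<le> nuc B"
  proof (rule ennreal_le_epsilon)
    fix e :: real assume e: "0 < e"
    \<comment> \<open>\<open>c\<close> is the factor with which an error in \<open>A\<close> enters
      the sum; with \<open>\<epsilon> = \<delta>^2\<close> that error is at most
      \<open>\<delta>\<close> in norm.\<close>
    define \<delta> where "\<delta> = e / (c + 1)"
    have \<delta>: "\<delta> > 0" "\<delta> * c \<le> e" using e c by (auto simp: \<delta>_def field_simps)
    define \<epsilon> where "\<epsilon> = \<delta>\<^sup>2"
    have \<epsilon>: "\<epsilon> > 0" using \<delta> by (simp add: \<epsilon>_def)
    obtain R where R: "clin R" "\<And>z. (adj B o\<^sub>L B) (R z) + \<epsilon> *\<^sub>R R z = z"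
      "\<And>z. R ((adj B o\<^sub>L B) z + \<epsilon> *\<^sub>R z) = z"
    proof (rule resolvent[OF _ _ \<epsilon>])
      show "clin (adj B o\<^sub>L B)" using B by auto
      show "0 \<le> Re (cinner x ((adj B o\<^sub>L B) x))" for x by (simp add: norm_sq_adj B)
    qed blast
    have key: "(norm (B (R z)))\<^sup>2 + \<epsilon> * (norm (R z))\<^sup>2 = Re (cinner (R z) z)" for z
    proof -
      have "cinner (R z) z = cinner (R z) ((adj B o\<^sub>L B) (R z) + \<epsilon> *\<^sub>R R z)" by (simp only: R(2))
      then show ?thesis by (simp add: cinner_simps cinner_adj_right B Re_cinner_self)
    qed
    define W where "W = A o\<^sub>L (R o\<^sub>L adj B)"
    have clW: "clin W" unfolding W_def using A B R(1) by auto
    have W: "norm (W z) \<le> norm z" for z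
    proof -
      define u where "u = R (adj B z)"
      have "(norm (B u))\<^sup>2 \<le> (norm (B u))\<^sup>2 + \<epsilon> * (norm u)\<^sup>2" using \<epsilon> by simp
      also have "\<dots> = Re (cinner (B u) z)"
        unfolding u_def key by (simp add: cinner_adj_right B)
      also have "\<dots> \<le> norm (B u) * norm z" by (rule Re_cinner_le)
      finally have "norm (B u) \<le> norm z" by (cases "norm (B u) = 0") (auto simp: power2_eq_square)
      then show ?thesis using dom[of u] by (simp add: W_def u_def)
    qed
    have Aeq: "A h = W (B h) + \<epsilon> *\<^sub>R A (R h)" for h
    proof -
      have "A h = A (R ((adj B o\<^sub>L B) h + \<epsilon> *\<^sub>R h))" by (simp only: R(3))
      then show ?thesis by (simp add: W_def blinfun.bilinear_simps)
    qed
    \<comment> \<open>For a singular value \<sigma> of \<open>B\<close> this is \<open>\<epsilon> *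
      \<sigma> / (\<sigma>^2 + \<epsilon>) <= sqrt \<epsilon>\<close>; here it comes from
      \<open>key\<close> by completing the square.\<close>
    have small: "norm (\<epsilon> *\<^sub>R A (R h)) \<le> \<delta> * norm h" for h
    proof -
      define a where "a = norm (R h)" 
      define b where "b = norm h"
      have "(norm (B (R h)))\<^sup>2 + \<epsilon> * a\<^sup>2 \<le> a * b"
        unfolding key a_def b_def by (rule Re_cinner_le)
      then have "\<epsilon> * (norm (B (R h)))\<^sup>2 \<le> \<epsilon> * (a * b - \<epsilon> * a\<^sup>2)"
        using \<epsilon> by (intro mult_left_mono) auto
      also have "\<dots> = b\<^sup>2 - (b - \<epsilon> * a / 2)\<^sup>2 - 3/4 * (\<epsilon> * a)\<^sup>2"
        by (simp add: power2_eq_square field_simps)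
      also have "\<dots> \<le> b\<^sup>2"
        using zero_le_power2[of "b - \<epsilon> * a / 2"] zero_le_power2[of "\<epsilon> * a"] by linarith
      finally have "\<epsilon> * (\<epsilon> * (norm (B (R h)))\<^sup>2) \<le> \<epsilon> * b\<^sup>2"
        using \<epsilon> by (intro mult_left_mono) auto
      then have "(\<epsilon> * norm (B (R h)))\<^sup>2 \<le> (\<delta> * b)\<^sup>2"
        by (simp add: power2_eq_square \<epsilon>_def algebra_simps)
      then have "\<epsilon> * norm (B (R h)) \<le> \<delta> * b"
        by (rule power2_le_imp_le) (use \<delta> in \<open>simp add: b_def\<close>)
      moreover have "norm (\<epsilon> *\<^sub>R A (R h)) \<le> \<epsilon> * norm (B (R h))"
        using dom[of "R h"] \<epsilon> by simp
      ultimately show ?thesis by (simp add: b_def)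
    qed
    have "Re (\<Sum>i<n. cinner (y i) (A (x i))) =
        Re (\<Sum>i<n. cinner (adj W (y i)) (B (x i))) + (\<Sum>i<n. Re (cinner (y i) (\<epsilon> *\<^sub>R A (R (x i)))))"
      unfolding cinner_adj_left[OF clW] by (subst Aeq) (simp add: cinner_add_right sum.distrib)
    also have "\<dots> \<le> Re (\<Sum>i<n. cinner (adj W (y i)) (B (x i))) + e"
    proof -
      have "(\<Sum>i<n. Re (cinner (y i) (\<epsilon> *\<^sub>R A (R (x i))))) \<le> (\<Sum>i<n. \<delta> * (norm (y i) * norm (x i)))"
      proof (rule sum_mono)
        fix i
        have "Re (cinner (y i) (\<epsilon> *\<^sub>R A (R (x i)))) \<le> norm (y i) * (\<delta> * norm (x i))"
          by (rule order_trans[OF Re_cinner_le]) (intro mult_left_mono small norm_ge_zero)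
        then show "Re (cinner (y i) (\<epsilon> *\<^sub>R A (R (x i)))) \<le> \<delta> * (norm (y i) * norm (x i))"
          by (simp only: mult_ac)
      qed
      also have "\<dots> = \<delta> * c" by (simp add: c_def sum_distrib_left)
      finally show ?thesis using \<delta>(2) by linarith
    qed
    finally have "ennreal (Re (\<Sum>i<n. cinner (y i) (A (x i))))
        \<le> ennreal (Re (\<Sum>i<n. cinner (adj W (y i)) (B (x i)))) + ennreal e"
      by (meson ennreal_leI ennreal_add_le order_trans)
    also have "\<dots> \<le> nuc B + ennreal e"
      by (intro add_right_mono nuc_ge x bessel_map[OF clW W y])
    finally show "ennreal (Re (\<Sum>i<n. cinner (y i) (A (x i)))) \<le> nuc B + ennreal e" .
  qed
qed

lemma infsum_sum_ennreal:
  fixes f :: "'i \<Rightarrow> 'b \<Rightarrow> ennreal"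
  assumes "finite I"
  shows "(\<Sum>i\<in>I. infsum (f i) E) = infsum (\<lambda>e. \<Sum>i\<in>I. f i e) E"
  using assms
proof (induction I)
  case (insert i I)
  have "infsum (\<lambda>e. f i e + (\<Sum>i\<in>I. f i e)) E = infsum (f i) E + infsum (\<lambda>e. \<Sum>i\<in>I. f i e) E"
    by (intro infsum_add nonneg_summable_on_complete) auto
  then show ?case using insert by simp
qed simp

text \<open>Basis independence of the trace, which disposes of the \<open>SOME\<close> in
  \<open>op_trace\<close>. One direction takes a finite part of the basis for both families. For the
  other, \<open>Q = op_sqrt P\<close> turns the pairing into
  \<open>cinner (Q (y i)) (Q (x i))\<close>, and the sum of the \<open>(norm (Q (x i)))^2\<close>,
  expanded in the basis and summed in the other order, is at most the trace.\<close>

lemma trace_basis: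
  assumes E: "orthonormal_basis E" and P: "positive_op P"
  shows "(\<Sum>\<^sub>\<infinity>e\<in>E. ennreal (Re (cinner e (P e)))) = nuc P"
proof (rule antisym)
  note clP = positive_op_clin[OF P]
  have on: "orthonormal E" using E by (simp add: orthonormal_basis_iff)
  show "(\<Sum>\<^sub>\<infinity>e\<in>E. ennreal (Re (cinner e (P e)))) \<le> nuc P"
    unfolding infsum_SUP_ennreal
  proof (rule SUP_least)
    fix F assume "F \<in> {F. finite F \<and> F \<subseteq> E}"
    then have F: "finite F" "F \<subseteq> E" by auto
    then obtain x where x: "bij_betw x {0..<card F} F" using ex_bij_betw_nat_finite by blast
    have b: "bessel (card F) x"
      using x F by (intro bessel_orthonormal[OF on]) (auto simp: bij_betw_def atLeast0LessThan)
    have "(\<Sum>e\<in>F. ennreal (Re (cinner e (P e)))) = ennreal (\<Sum>e\<in>F. Re (cinner e (P e)))"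
      using positive_op_Re[OF P] by (intro sum_ennreal)
    also have "(\<Sum>e\<in>F. Re (cinner e (P e))) = Re (\<Sum>i<card F. cinner (x i) (P (x i)))"
      using sum.reindex_bij_betw[OF x, of "\<lambda>e. Re (cinner e (P e))"] by (simp add: atLeast0LessThan)
    also have "ennreal \<dots> \<le> nuc P" by (rule nuc_ge[OF b b])
    finally show "(\<Sum>e\<in>F. ennreal (Re (cinner e (P e)))) \<le> nuc P" .
  qed
  show "nuc P \<le> (\<Sum>\<^sub>\<infinity>e\<in>E. ennreal (Re (cinner e (P e))))" (is "_ \<le> ?tr")
  proof (rule nuc_leI)
    define Q where "Q = op_sqrt P"
    have Q: "positive_op Q" "Q o\<^sub>L Q = P" unfolding Q_def using op_sqrt[OF P] by auto
    have QQ: "cinner a (P b) = cinner (Q a) (Q b)" for a b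
      unfolding Q(2)[symmetric] by (simp add: positive_op_self_adjoint[OF Q(1)])
    have b: "ennreal (\<Sum>i<n. (norm (Q (x i)))\<^sup>2) \<le> ?tr" if x: "bessel n x" for n x
    proof -
      have "ennreal (\<Sum>i<n. (norm (Q (x i)))\<^sup>2) = (\<Sum>i<n. ennreal ((norm (Q (x i)))\<^sup>2))"
        by (simp add: sum_ennreal)
      also have "\<dots> \<le> (\<Sum>i<n. \<Sum>\<^sub>\<infinity>e\<in>E. ennreal ((cmod (cinner e (Q (x i))))\<^sup>2))"
        by (intro sum_mono parseval_le E)
      also have "\<dots> = (\<Sum>\<^sub>\<infinity>e\<in>E. \<Sum>i<n. ennreal ((cmod (cinner e (Q (x i))))\<^sup>2))"
        by (intro infsum_sum_ennreal) simp
      also have "\<dots> \<le> ?tr"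
      proof (intro infsum_mono nonneg_summable_on_complete zero_le)
        fix e
        have "(\<Sum>i<n. ennreal ((cmod (cinner e (Q (x i))))\<^sup>2)) = ennreal (\<Sum>i<n. (cmod (cinner (x i) (Q e)))\<^sup>2)"
        proof -
          have "cmod (cinner e (Q (x i))) = cmod (cinner (x i) (Q e))" for i
            by (subst cmod_cinner_commute) (simp only: positive_op_self_adjoint[OF Q(1)])
          then show ?thesis by (simp add: sum_ennreal)
        qed
        also have "\<dots> \<le> ennreal ((norm (Q e))\<^sup>2)"
          using x by (intro ennreal_leI) (simp add: bessel_def)
        also have "(norm (Q e))\<^sup>2 = Re (cinner e (P e))" by (simp add: QQ Re_cinner_self)
        finally show "(\<Sum>i<n. ennreal ((cmod (cinner e (Q (x i))))\<^sup>2)) \<le> ennreal (Re (cinner e (P e)))" .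
      qed
      finally show ?thesis .
    qed
    fix n and x y :: "nat \<Rightarrow> 'a" assume x: "bessel n x" and y: "bessel n y"
    define s where "s = (\<Sum>i<n. (norm (Q (x i)))\<^sup>2)"
    define t where "t = (\<Sum>i<n. (norm (Q (y i)))\<^sup>2)"
    have "Re (\<Sum>i<n. cinner (y i) (P (x i))) \<le> (\<Sum>i<n. ((norm (Q (y i)))\<^sup>2 + (norm (Q (x i)))\<^sup>2) / 2)"
      unfolding QQ Re_sum
    proof (rule sum_mono)
      fix i
      have "0 \<le> (norm (Q (y i) - Q (x i)))\<^sup>2" by simp
      then show "Re (cinner (Q (y i)) (Q (x i))) \<le> ((norm (Q (y i)))\<^sup>2 + (norm (Q (x i)))\<^sup>2) / 2"
        unfolding norm_diff_sq by simp
    qed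
    also have "\<dots> = (t + s) / 2"
      by (simp add: s_def t_def sum_divide_distrib[symmetric] sum.distrib)
    also have "\<dots> \<le> max s t" by simp
    finally have "ennreal (Re (\<Sum>i<n. cinner (y i) (P (x i)))) \<le> ennreal (max s t)"
      by (rule ennreal_leI)
    also have "\<dots> \<le> ?tr" using b[OF x] b[OF y] by (simp add: s_def t_def max_def)
    finally show "ennreal (Re (\<Sum>i<n. cinner (y i) (P (x i)))) \<le> ?tr" .
  qed
qed

lemma op_trace_eq_nuc: "positive_op P \<Longrightarrow> op_trace P = nuc P"
  unfolding op_trace_def by (rule trace_basis[OF someI_ex[OF orthonormal_basis_exists]])

lemma nuc_eqI:
  assumes "clin A" "clin B" "\<And>x. norm (blinfun_apply A x) = norm (blinfun_apply B x)"
  shows "nuc A = nuc B"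
  by (rule antisym; rule nuc_mono) (simp_all add: assms)

text \<open>\<open>A\<close> and its modulus have the same norm at every vector, and by
  \<open>nuc_eqI\<close> the value of \<open>nuc\<close> depends on these norms only.\<close>

lemma S1_norm_eq_nuc:
  fixes A :: "'a::chilbert_space \<Rightarrow>\<^sub>L 'a"
  assumes A: "clin A"
  shows "S1_norm A = nuc A"
proof -
  have pos: "positive_op (adj A o\<^sub>L A)" by (rule positive_adj_compose[OF A])
  have "norm (op_sqrt (adj A o\<^sub>L A) x) = norm (A x)" for x
    using norm_sq_op_sqrt[OF pos, of x] by (simp add: norm_sq_adj A)
  then have "nuc (op_sqrt (adj A o\<^sub>L A)) = nuc A"
    by (intro nuc_eqI positive_op_clin op_sqrt pos A)
  then show ?thesis
    unfolding S1_norm_def op_adj_eq[OF A] by (simp add: op_trace_eq_nuc op_sqrt pos)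
qed

section \<open>Norm properties of \<open>nuc\<close>\<close>

lemma bessel_unit: "norm (x 0) \<le> 1 \<Longrightarrow> bessel (Suc 0) x"
proof -
  assume x: "norm (x 0) \<le> 1"
  have "(cmod (cinner (x 0) h))\<^sup>2 \<le> (norm h)\<^sup>2" for h
  proof (intro power_mono)
    show "cmod (cinner (x 0) h) \<le> norm h"
      using cauchy_schwarz[of "x 0" h] mult_right_mono[OF x, of "norm h"] by simp
  qed simp
  then show ?thesis by (simp add: bessel_def)
qed

lemma bessel_phase: "bessel n x \<Longrightarrow> cmod u \<le> 1 \<Longrightarrow> bessel n (\<lambda>i. u *\<^sub>C x i)"
  unfolding bessel_def cinner_scaleC_left norm_mult complex_mod_cnj power_mult_distrib
    sum_distrib_left[symmetric]
proof (intro allI)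
  fix h assume *: "\<forall>h. (\<Sum>i<n. (cmod (cinner (x i) h))\<^sup>2) \<le> (norm h)\<^sup>2" "cmod u \<le> 1"
  have "(cmod u)\<^sup>2 * (\<Sum>i<n. (cmod (cinner (x i) h))\<^sup>2) \<le> 1 * (\<Sum>i<n. (cmod (cinner (x i) h))\<^sup>2)"
    using *(2) by (intro mult_right_mono) (auto simp: power_le_one_iff abs_square_le_1 intro: sum_nonneg)
  then show "(cmod u)\<^sup>2 * (\<Sum>i<n. (cmod (cinner (x i) h))\<^sup>2) \<le> (norm h)\<^sup>2"
    using spec[OF *(1), of h] by simp
qed

lemma nuc_add:
  fixes A B :: "'a::chilbert_space \<Rightarrow>\<^sub>L 'b::chilbert_space"
  shows "nuc (A + B) \<le> nuc A + nuc B"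
proof (rule nuc_leI)
  fix n and x :: "nat \<Rightarrow> 'a" and y :: "nat \<Rightarrow> 'b"
  assume xy: "bessel n x" "bessel n y"
  have "Re (\<Sum>i<n. cinner (y i) ((A + B) (x i))) =
      Re (\<Sum>i<n. cinner (y i) (A (x i))) + Re (\<Sum>i<n. cinner (y i) (B (x i)))"
    by (simp add: blinfun.bilinear_simps cinner_add_right sum.distrib)
  then have "ennreal (Re (\<Sum>i<n. cinner (y i) ((A + B) (x i)))) \<le>
      ennreal (Re (\<Sum>i<n. cinner (y i) (A (x i)))) + ennreal (Re (\<Sum>i<n. cinner (y i) (B (x i))))"
    by (simp only: ennreal_add_le)
  also have "\<dots> \<le> nuc A + nuc B" by (intro add_mono nuc_ge xy)
  finally show "ennreal (Re (\<Sum>i<n. cinner (y i) ((A + B) (x i)))) \<le> nuc A + nuc B" .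
qed

lemma nuc_zero [simp]: "nuc 0 = 0"
  unfolding le_zero_eq[symmetric] by (rule nuc_leI) simp

lemma nuc_op_scaleC_le:
  fixes A :: "'a::chilbert_space \<Rightarrow>\<^sub>L 'a"
  shows "nuc (op_scaleC c A) \<le> ennreal (cmod c) * nuc A"
proof (rule nuc_leI)
  fix n and x y :: "nat \<Rightarrow> 'a"
  assume xy: "bessel n x" "bessel n y"
  \<comment> \<open>The phase of \<open>c\<close> is moved into the family \<open>y\<close>; for
    \<open>c = 0\<close> any unimodular value would do.\<close>
  define u where "u = (if c = 0 then 1 else c / complex_of_real (cmod c))"
  have c: "c = complex_of_real (cmod c) * u" and u: "cmod (cnj u) \<le> 1" by (auto simp: u_def norm_divide)
  have "(\<Sum>i<n. cinner (y i) (op_scaleC c A (x i))) = c * (\<Sum>i<n. cinner (y i) (A (x i)))"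
    by (simp add: apply_op_scaleC cinner_scaleC_right sum_distrib_left)
  also have "\<dots> = complex_of_real (cmod c) * (\<Sum>i<n. cinner (cnj u *\<^sub>C y i) (A (x i)))"
    by (subst c) (simp add: cinner_scaleC_left sum_distrib_left mult.assoc)
  finally have "ennreal (Re (\<Sum>i<n. cinner (y i) (op_scaleC c A (x i)))) =
      ennreal (cmod c) * ennreal (Re (\<Sum>i<n. cinner (cnj u *\<^sub>C y i) (A (x i))))"
    by (simp add: ennreal_mult')
  also have "\<dots> \<le> ennreal (cmod c) * nuc A"
    by (intro mult_left_mono nuc_ge xy bessel_phase u) auto
  finally show "ennreal (Re (\<Sum>i<n. cinner (y i) (op_scaleC c A (x i)))) \<le> ennreal (cmod c) * nuc A" .
qed

lemma op_scaleC_simps: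
  "op_scaleC c (A + B) = op_scaleC c A + op_scaleC c B"
  "op_scaleC c (A - B) = op_scaleC c A - op_scaleC c B"
  "op_scaleC (c - d) A = op_scaleC c A - op_scaleC d A"
  "op_scaleC c (op_scaleC d A) = op_scaleC (c * d) A"
  "op_scaleC (of_real r) A = r *\<^sub>R A"
  "op_scaleC 1 A = A"
  "op_scaleC c 0 = 0"
  "op_scaleC 0 A = 0"
proof -
  have "(c - d) *\<^sub>C x = c *\<^sub>C x - d *\<^sub>C x" for x :: 'a
    using scaleC_add_left[of "c - d" d x] by simp
  then show "op_scaleC (c - d) A = op_scaleC c A - op_scaleC d A"
    by (intro blinfun_eqI) (simp add: apply_op_scaleC blinfun.bilinear_simps)
qed (auto intro!: blinfun_eqI simp: apply_op_scaleC blinfun.bilinear_simps scaleC_add_right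
      scaleC_diff_right scaleC_scaleC scaleC_of_real)

lemma nuc_scaleR_le: "nuc (r *\<^sub>R A) \<le> ennreal \<bar>r\<bar> * nuc (A :: 'a::chilbert_space \<Rightarrow>\<^sub>L 'a)"
  using nuc_op_scaleC_le[of "of_real r" A] by (simp add: op_scaleC_simps)

lemma nuc_minus [simp]: "nuc (- A) = nuc (A :: 'a::chilbert_space \<Rightarrow>\<^sub>L 'a)"
  using nuc_scaleR_le[of "-1" A] nuc_scaleR_le[of "-1" "- A"] by (simp add: antisym)

lemma nuc_diff: "nuc (A - B) \<le> nuc A + nuc (B :: 'a::chilbert_space \<Rightarrow>\<^sub>L 'a)"
  using nuc_add[of A "- B"] by simp

lemma nuc_minus_commute: "nuc (A - B) = nuc (B - A :: 'a::chilbert_space \<Rightarrow>\<^sub>L 'a)"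
  using nuc_minus[of "A - B"] by simp

lemma nuc_triangle: "nuc (A - C) \<le> nuc (A - B) + nuc (B - C)"
  using nuc_add[of "A - B" "B - C"] by simp

lemma nuc_sum: "nuc (\<Sum>i\<in>I. f i) \<le> (\<Sum>i\<in>I. nuc (f i))"
  by (induction I rule: infinite_finite_induct) (auto intro: order_trans[OF nuc_add] add_left_mono)

lemma norm_le_nuc:
  fixes A :: "'a::chilbert_space \<Rightarrow>\<^sub>L 'b::chilbert_space"
  shows "ennreal (norm A) \<le> nuc A"
proof (cases "nuc A")
  case (real B)
  have "norm A \<le> B"
  proof (rule norm_blinfun_bound)
    fix x
    show "norm (A x) \<le> B * norm x"
    proof (cases "x = 0 \<or> A x = 0")
      case False
      define u where "u = (1 / norm x) *\<^sub>R x"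
      define v where "v = (1 / norm (A x)) *\<^sub>R A x"
      have b: "bessel (Suc 0) (\<lambda>_. u)" "bessel (Suc 0) (\<lambda>_. v)"
        using False by (auto intro!: bessel_unit simp: u_def v_def)
      have "Re (cinner v (A u)) = norm (A x) / norm x"
        using False by (simp add: u_def v_def blinfun.bilinear_simps cinner_simps cinner_self
            power2_eq_square)
      then have "ennreal (norm (A x) / norm x) \<le> ennreal B" using nuc_ge[OF b, of A] real by simp
      then show ?thesis using False real by (simp add: field_simps)
    qed (use real in auto)
  qed (use real in auto)
  then show ?thesis using real by simp
qed simp

lemma nuc_eq_0: "nuc A = 0 \<Longrightarrow> A = 0"
  using norm_le_nuc[of A] by (simp add: ennreal_eq_0_iff)

lemma nuc_compose:
  fixes V :: "'b::chilbert_space \<Rightarrow>\<^sub>L 'd::chilbert_space" and A :: "'a::chilbert_space \<Rightarrow>\<^sub>L 'b"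
    and W :: "'c::chilbert_space \<Rightarrow>\<^sub>L 'a"
  assumes V: "clin V" "\<And>h. norm (blinfun_apply V h) \<le> norm h"
    and W: "clin W" "\<And>h. norm (blinfun_apply W h) \<le> norm h"
  shows "nuc (V o\<^sub>L A o\<^sub>L W) \<le> nuc A"
proof (rule nuc_leI)
  fix n and x :: "nat \<Rightarrow> 'c" and y :: "nat \<Rightarrow> 'd"
  assume xy: "bessel n x" "bessel n y"
  have "(\<Sum>i<n. cinner (y i) ((V o\<^sub>L A o\<^sub>L W) (x i))) = (\<Sum>i<n. cinner (adj V (y i)) (A (W (x i))))"
    by (simp add: cinner_adj_left V)
  then show "ennreal (Re (\<Sum>i<n. cinner (y i) ((V o\<^sub>L A o\<^sub>L W) (x i)))) \<le> nuc A"
    using nuc_ge[OF bessel_map'[OF W xy(1)] bessel_map[OF V xy(2)]] by simp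
qed

lemma nuc_adj: assumes A: "clin A" shows "nuc (adj A) = nuc A"
proof -
  have *: "nuc (adj B) \<le> nuc B" if B: "clin B" for B :: "'c::chilbert_space \<Rightarrow>\<^sub>L 'd::chilbert_space"
  proof (rule nuc_leI)
    fix n and x :: "nat \<Rightarrow> 'd" and y :: "nat \<Rightarrow> 'c"
    assume xy: "bessel n x" "bessel n y"
    have "Re (\<Sum>i<n. cinner (y i) (adj B (x i))) = Re (\<Sum>i<n. cinner (x i) (B (y i)))"
      unfolding Re_sum cinner_adj_right[OF B] by (intro sum.cong refl Re_cinner_commute)
    then show "ennreal (Re (\<Sum>i<n. cinner (y i) (adj B (x i)))) \<le> nuc B"
      using nuc_ge[OF xy(2,1), of B] by simp
  qed
  show ?thesis using *[OF A] *[OF clin_adj[OF A]] by (simp add: adj_adj A)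
qed

text \<open>\<open>nuc\<close> is a supremum of functionals that are continuous for the operator
  norm. This transfers trace norm estimates to limits that are known in operator norm only.\<close>

lemma nuc_lsc:
  fixes A :: "'a::chilbert_space \<Rightarrow>\<^sub>L 'b::chilbert_space"
  assumes X: "X \<longlonglongrightarrow> A" and le: "\<forall>\<^sub>F k in sequentially. nuc (X k) \<le> B"
  shows "nuc A \<le> B"
proof (rule nuc_leI)
  fix n and x :: "nat \<Rightarrow> 'a" and y :: "nat \<Rightarrow> 'b"
  assume xy: "bessel n x" "bessel n y"
  have "(\<lambda>k. ennreal (Re (\<Sum>i<n. cinner (y i) (X k (x i))))) \<longlonglongrightarrow> ennreal (Re (\<Sum>i<n. cinner (y i) (A (x i))))"
    by (intro tendsto_ennrealI tendsto_Re tendsto_sum tendsto_cinner blinfun.tendsto X tendsto_const)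
  then show "ennreal (Re (\<Sum>i<n. cinner (y i) (A (x i)))) \<le> B"
  proof (rule tendsto_upperbound)
    show "\<forall>\<^sub>F k in sequentially. ennreal (Re (\<Sum>i<n. cinner (y i) (X k (x i)))) \<le> B"
      using le by eventually_elim (use nuc_ge[OF xy] order_trans in blast)
  qed simp
qed


section \<open>Compact operators and the trace class\<close>

text \<open>Compactness without the closure: total boundedness of the image of the unit ball passes
  directly to sums, compositions and norm limits.\<close>

definition totbdd :: "('a::real_normed_vector \<Rightarrow>\<^sub>L 'b::real_normed_vector) \<Rightarrow> bool" where
  "totbdd A \<longleftrightarrow> (\<forall>e>0. \<exists>k. finite k \<and> (\<forall>x. norm x \<le> 1 \<longrightarrow> (\<exists>y\<in>k. norm (blinfun_apply A x - y) < e)))"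

lemma compact_op_iff: "compact_op A \<longleftrightarrow> clin A \<and> totbdd A"
proof -
  let ?S = "blinfun_apply A ` cball 0 1"
  have "compact (closure ?S) \<longleftrightarrow> totbdd A"
  proof
    assume "compact (closure ?S)"
    then have *: "\<forall>e>0. \<exists>k. finite k \<and> closure ?S \<subseteq> (\<Union>x\<in>k. ball x e)"
      by (simp add: compact_eq_totally_bounded)
    show "totbdd A" unfolding totbdd_def
    proof (intro allI impI)
      fix e :: real assume "e > 0"
      then obtain k where k: "finite k" "closure ?S \<subseteq> (\<Union>x\<in>k. ball x e)" using * by blast
      have "\<exists>y\<in>k. norm (A x - y) < e" if "norm x \<le> 1" for x
      proof -
        have "A x \<in> closure ?S" using that closure_subset by force
        then obtain y where "y \<in> k" "A x \<in> ball y e" using k(2) by blast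
        then show ?thesis by (auto simp: dist_norm norm_minus_commute)
      qed
      then show "\<exists>k. finite k \<and> (\<forall>x. norm x \<le> 1 \<longrightarrow> (\<exists>y\<in>k. norm (A x - y) < e))" using k(1) by blast
    qed
  next
    assume tb: "totbdd A"
    have "\<exists>k. finite k \<and> closure ?S \<subseteq> (\<Union>x\<in>k. ball x e)" if "e > 0" for e
    proof -
      obtain k where k: "finite k" "\<And>x. norm x \<le> 1 \<Longrightarrow> \<exists>y\<in>k. norm (A x - y) < e / 2"
        using tb \<open>e > 0\<close> unfolding totbdd_def by (metis half_gt_zero)
      have "?S \<subseteq> (\<Union>y\<in>k. cball y (e/2))"
        using k(2) by (force simp: dist_norm norm_minus_commute)
      moreover have "closed (\<Union>y\<in>k. cball y (e/2))" using k(1) by (intro closed_UN) auto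
      ultimately have "closure ?S \<subseteq> (\<Union>y\<in>k. cball y (e/2))" by (rule closure_minimal)
      also have "\<dots> \<subseteq> (\<Union>y\<in>k. ball y e)" using \<open>e > 0\<close> by (intro UN_mono) auto
      finally show ?thesis using k(1) by blast
    qed
    then show "compact (closure ?S)"
      by (simp add: compact_eq_totally_bounded complete_eq_closed)
  qed
  then show ?thesis by (simp add: compact_op_def clinear_op_clin)
qed

lemma totbdd_zero: "totbdd 0"
  unfolding totbdd_def by (auto intro!: exI[of _ "{0}"])

lemma totbdd_add:
  assumes "totbdd A" "totbdd B" shows "totbdd (A + B)"
  unfolding totbdd_def
proof (intro allI impI)
  fix e :: real assume "e > 0"
  then have "e / 2 > 0" by simp
  obtain k where k: "finite k" "\<And>x. norm x \<le> 1 \<Longrightarrow> \<exists>y\<in>k. norm (A x - y) < e / 2"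
    using assms(1) \<open>e / 2 > 0\<close> unfolding totbdd_def by metis
  obtain l where l: "finite l" "\<And>x. norm x \<le> 1 \<Longrightarrow> \<exists>y\<in>l. norm (B x - y) < e / 2"
    using assms(2) \<open>e / 2 > 0\<close> unfolding totbdd_def by metis
  have "\<exists>z\<in>(\<lambda>(y, z). y + z) ` (k \<times> l). norm ((A + B) x - z) < e" if x: "norm x \<le> 1" for x
  proof -
    obtain y z where yz: "y \<in> k" "z \<in> l" "norm (A x - y) < e / 2" "norm (B x - z) < e / 2"
      using k(2)[OF x] l(2)[OF x] by blast
    have "norm ((A + B) x - (y + z)) \<le> norm (A x - y) + norm (B x - z)"
      using norm_triangle_ineq[of "A x - y" "B x - z"] by (simp add: blinfun.bilinear_simps algebra_simps)
    then show ?thesis using yz by force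
  qed
  then show "\<exists>k. finite k \<and> (\<forall>x. norm x \<le> 1 \<longrightarrow> (\<exists>y\<in>k. norm ((A + B) x - y) < e))"
    using k(1) l(1) by (intro exI[of _ "(\<lambda>(y, z). y + z) ` (k \<times> l)"]) auto
qed

text \<open>\<open>f\<close> will be a bounded operator applied from the left, or multiplication by
  a complex scalar.\<close>

lemma totbdd_lipschitz_image:
  assumes A: "totbdd A" and V: "\<And>u v. norm (f u - f v) \<le> K * norm (u - v)"
    and B: "\<And>x. blinfun_apply B x = f (blinfun_apply A x)"
  shows "totbdd B"
  unfolding totbdd_def
proof (intro allI impI)
  fix e :: real assume e: "e > 0"
  define d where "d = e / (\<bar>K\<bar> + 1)"
  have d: "d > 0" using e by (simp add: d_def add_nonneg_pos)
  obtain k where k: "finite k" "\<And>x. norm x \<le> 1 \<Longrightarrow> \<exists>y\<in>k. norm (A x - y) < d"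
    using A d unfolding totbdd_def by metis
  have "\<exists>z\<in>f ` k. norm (B x - z) < e" if x: "norm x \<le> 1" for x
  proof -
    obtain y where y: "y \<in> k" "norm (A x - y) < d" using k(2)[OF x] by blast
    have "norm (B x - f y) \<le> K * norm (A x - y)" unfolding B by (rule V)
    also have "\<dots> \<le> (\<bar>K\<bar> + 1) * norm (A x - y)" by (intro mult_right_mono) auto
    also have "\<dots> < (\<bar>K\<bar> + 1) * d" using y(2) by (intro mult_strict_left_mono) auto
    also have "\<dots> = e" by (simp add: d_def)
    finally show ?thesis using y(1) by blast
  qed
  then show "\<exists>k. finite k \<and> (\<forall>x. norm x \<le> 1 \<longrightarrow> (\<exists>y\<in>k. norm (B x - y) < e))"
    using k(1) by (intro exI[of _ "f ` k"]) auto
qed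

lemma totbdd_compose:
  assumes "totbdd A" "\<And>h. norm (blinfun_apply W h) \<le> norm h"
  shows "totbdd (V o\<^sub>L A o\<^sub>L W)"
proof -
  have "totbdd (A o\<^sub>L W)"
    using assms unfolding totbdd_def by (metis blinfun_apply_blinfun_compose order_trans)
  then show ?thesis
    by (rule totbdd_lipschitz_image[where f = "blinfun_apply V" and K = "norm V"])
       (auto simp: blinfun.diff_right[symmetric] intro: norm_blinfun)
qed

lemma totbdd_op_scaleC: "totbdd A \<Longrightarrow> totbdd (op_scaleC c A)"
  by (rule totbdd_lipschitz_image[where f = "scaleC c" and K = "cmod c"])
     (auto simp: apply_op_scaleC scaleC_diff_right[symmetric] norm_scaleC)

lemma totbdd_approx:
  assumes "\<And>e. e > 0 \<Longrightarrow> \<exists>B. totbdd B \<and> norm (A - B) < e"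
  shows "totbdd A"
  unfolding totbdd_def
proof (intro allI impI)
  fix e :: real assume "e > 0"
  then have e2: "e / 2 > 0" by simp
  obtain B where B: "totbdd B" "norm (A - B) < e / 2" using assms[OF e2] by blast
  obtain k where k: "finite k" "\<And>x. norm x \<le> 1 \<Longrightarrow> \<exists>y\<in>k. norm (B x - y) < e / 2"
    using B(1) e2 unfolding totbdd_def by metis
  have "\<exists>y\<in>k. norm (A x - y) < e" if x: "norm x \<le> 1" for x
  proof -
    obtain y where y: "y \<in> k" "norm (B x - y) < e / 2" using k(2)[OF x] by blast
    have "norm ((A - B) x) \<le> norm (A - B) * 1"
      by (rule order_trans[OF norm_blinfun]) (intro mult_left_mono x norm_ge_zero)
    then have "norm (A x - B x) < e / 2" using B(2) by (simp add: blinfun.bilinear_simps)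
    moreover have "norm (A x - y) \<le> norm (A x - B x) + norm (B x - y)"
      using norm_triangle_ineq[of "A x - B x" "B x - y"] by simp
    ultimately show ?thesis using y by (intro bexI[of _ y]) auto
  qed
  then show "\<exists>k. finite k \<and> (\<forall>x. norm x \<le> 1 \<longrightarrow> (\<exists>y\<in>k. norm (A x - y) < e))" using k(1) by blast
qed

lemma totbdd_rank_one:
  assumes A: "\<And>x. blinfun_apply A x = cinner u x *\<^sub>C y"
  shows "totbdd A"
  unfolding totbdd_def
proof (intro allI impI)
  fix e :: real assume e: "e > 0"
  let ?S = "(\<lambda>c. c *\<^sub>C y) ` cball 0 (norm u)"
  have "compact ?S"
    by (intro compact_continuous_image compact_cball linear_continuous_on
        bounded_bilinear.bounded_linear_left[OF bounded_bilinear_scaleC])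
  then obtain k where k: "finite k" "?S \<subseteq> (\<Union>x\<in>k. ball x e)"
    using e unfolding compact_eq_totally_bounded by blast
  have "\<exists>z\<in>k. norm (A x - z) < e" if x: "norm x \<le> 1" for x
  proof -
    have "cmod (cinner u x) \<le> norm u"
      using cauchy_schwarz[of u x] mult_left_mono[OF x, of "norm u"] by simp
    then have "A x \<in> ?S" unfolding A by simp
    then obtain z where "z \<in> k" "A x \<in> ball z e" using k(2) by blast
    then show ?thesis by (auto simp: dist_norm norm_minus_commute)
  qed
  then show "\<exists>k. finite k \<and> (\<forall>x. norm x \<le> 1 \<longrightarrow> (\<exists>z\<in>k. norm (A x - z) < e))" using k(1) by blast
qed

lemma S1_iff: "A \<in> S1 \<longleftrightarrow> clin A \<and> totbdd A \<and> nuc A < \<infinity>"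
  by (auto simp: S1_def compact_op_iff S1_norm_eq_nuc)

lemma S1_clin: "A \<in> S1 \<Longrightarrow> clin A"
  by (simp add: S1_iff)

lemma S1_nuc: "A \<in> S1 \<Longrightarrow> nuc A < \<infinity>"
  by (simp add: S1_iff)

lemma S1_zero [intro, simp]: "0 \<in> S1"
  by (simp add: S1_iff totbdd_zero)

lemma S1_add [intro]: "A \<in> S1 \<Longrightarrow> B \<in> S1 \<Longrightarrow> A + B \<in> S1"
  unfolding S1_iff
proof (intro conjI)
  assume "clin A \<and> totbdd A \<and> nuc A < \<infinity>" "clin B \<and> totbdd B \<and> nuc B < \<infinity>"
  then show "nuc (A + B) < \<infinity>" by (intro le_less_trans[OF nuc_add]) (simp add: ennreal_add_less_top)
qed (auto intro: totbdd_add)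

lemma S1_op_scaleC [intro]: "A \<in> S1 \<Longrightarrow> op_scaleC c A \<in> S1"
  unfolding S1_iff
proof (intro conjI)
  assume "clin A \<and> totbdd A \<and> nuc A < \<infinity>"
  then show "nuc (op_scaleC c A) < \<infinity>"
    by (intro le_less_trans[OF nuc_op_scaleC_le]) (simp add: ennreal_mult_less_top)
qed (auto intro: totbdd_op_scaleC)

lemma S1_scaleR [intro]: "A \<in> S1 \<Longrightarrow> r *\<^sub>R A \<in> S1"
  using S1_op_scaleC[of A "of_real r"] by (simp add: op_scaleC_simps)

lemma S1_diff [intro]: "A \<in> S1 \<Longrightarrow> B \<in> S1 \<Longrightarrow> A - B \<in> S1"
  using S1_add[of A "- B"] S1_scaleR[of B "-1"] by simp

lemma S1_sum [intro]: "(\<And>i. i \<in> I \<Longrightarrow> f i \<in> S1) \<Longrightarrow> (\<Sum>i\<in>I. f i) \<in> S1"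
  by (induction I rule: infinite_finite_induct) auto

lemma S1_compose:
  assumes "clin V" "\<And>h. norm (blinfun_apply V h) \<le> norm h"
    and "clin W" "\<And>h. norm (blinfun_apply W h) \<le> norm h" "A \<in> S1"
  shows "V o\<^sub>L A o\<^sub>L W \<in> S1"
  using assms nuc_compose[OF assms(1-4), of A] unfolding S1_iff
  by (auto intro: totbdd_compose)

lemma S1_lim:
  assumes "X \<longlonglongrightarrow> A" "\<And>n. X n \<in> S1" "nuc A < \<infinity>"
  shows "A \<in> S1"
  unfolding S1_iff
proof (intro conjI assms totbdd_approx)
  show "clin A" using assms(2) by (intro clin_lim[OF assms(1)]) (auto simp: S1_iff)
  fix e :: real assume "e > 0"
  then obtain n where "dist (X n) A < e" using metric_LIMSEQ_D[OF assms(1)] by blast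
  then show "\<exists>B. totbdd B \<and> norm (A - B) < e"
    using assms(2)[of n] by (auto simp: S1_iff dist_norm norm_minus_commute)
qed

lemma S1_norm_diff: "A \<in> S1 \<Longrightarrow> B \<in> S1 \<Longrightarrow> S1_norm (A - B) = nuc (A - B)"
  by (intro S1_norm_eq_nuc clin_diff S1_clin)

section \<open>Integration of trace class valued functions\<close>

lemma emeasure_circle: "emeasure circle (space circle) = ennreal (2 * pi)"
  by (simp add: circle_def emeasure_restrict_space)

lemma finite_measure_circle: "finite_measure circle"
  by (rule finite_measureI) (simp add: emeasure_circle)

interpretation circle: finite_measure circle
  by (rule finite_measure_circle)

text \<open>Lebesgue measure is complete. Measurability of trace norms along \<open>L1_S1\<close>
  functions rests on this, since the definition supplies convergence almost everywhere only.\<close>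

lemma circle_null_subset:
  assumes "N \<in> null_sets circle" "A \<subseteq> N"
  shows "A \<in> sets circle"
proof -
  have N: "N \<subseteq> {-pi<..pi}" "N \<in> null_sets lebesgue"
    using assms(1) unfolding circle_def by (simp_all add: null_sets_restrict_space)
  have "A \<in> null_sets lebesgue" using assms(2) N(2) by (rule completion.complete2)
  then show ?thesis using assms(2) N(1) unfolding circle_def
    by (auto simp: sets_restrict_space_iff)
qed

lemma circle_AE_measurable:
  assumes h0: "h0 \<in> borel_measurable circle" and ae: "AE t in circle. h t = h0 t"
  shows "h \<in> borel_measurable circle"
proof (rule measurableI)
  obtain N where N: "{t \<in> space circle. h t \<noteq> h0 t} \<subseteq> N" "emeasure circle N = 0" "N \<in> sets circle"
    using ae by (rule AE_E)
  then have null: "N \<in> null_sets circle" by auto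
  fix A :: "'a set" assume A: "A \<in> sets borel"
  have "h -` A \<inter> space circle = ((h0 -` A \<inter> space circle) - N) \<union> (h -` A \<inter> N)"
    using N(1) sets.sets_into_space[OF N(3)] by auto
  moreover have "h -` A \<inter> N \<in> sets circle"
    using circle_null_subset[OF null] by blast
  moreover have "(h0 -` A \<inter> space circle) - N \<in> sets circle"
    using measurable_sets[OF h0 A] N(3) by blast
  ultimately show "h -` A \<inter> space circle \<in> sets circle" by (metis sets.Un)
qed simp

text \<open>Overwriting by the constant \<open>c\<close> on a null set turns convergence almost
  everywhere into convergence everywhere, for which limits of measurable functions are
  measurable.\<close>

lemma circle_AE_lim:
  assumes ae: "AE t in circle. (\<lambda>i. u i t) \<longlonglongrightarrow> h t" and u: "\<And>i. u i \<in> borel_measurable circle"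
  obtains N where "N \<in> sets circle" "AE t in circle. t \<notin> N"
    "\<And>t. t \<in> space circle \<Longrightarrow> (\<lambda>i. if t \<in> N then c else u i t) \<longlonglongrightarrow> (if t \<in> N then c else h t)"
    "\<And>i. (\<lambda>t. if t \<in> N then c else u i t) \<in> borel_measurable circle"
proof -
  obtain N where N: "{t \<in> space circle. \<not> (\<lambda>i. u i t) \<longlonglongrightarrow> h t} \<subseteq> N" "emeasure circle N = 0" "N \<in> sets circle"
    using ae by (rule AE_E)
  show ?thesis
  proof (rule that[of N])
    show "AE t in circle. t \<notin> N" using N by (intro AE_not_in) auto
    show "(\<lambda>t. if t \<in> N then c else u i t) \<in> borel_measurable circle" for i
      using N(3) u[of i] by (intro measurable_If_set) (auto intro: sets.Int)
  qed (use N in auto)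
qed

lemma circle_AE_lim_ennreal:
  fixes u :: "nat \<Rightarrow> real \<Rightarrow> ennreal"
  assumes ae: "AE t in circle. (\<lambda>i. u i t) \<longlonglongrightarrow> h t" and u: "\<And>i. u i \<in> borel_measurable circle"
  shows "h \<in> borel_measurable circle"
proof -
  obtain N where N: "N \<in> sets circle" "AE t in circle. t \<notin> N"
    "\<And>t. t \<in> space circle \<Longrightarrow> (\<lambda>i. if t \<in> N then 0 else u i t) \<longlonglongrightarrow> (if t \<in> N then 0 else h t)"
    "\<And>i. (\<lambda>t. if t \<in> N then 0 else u i t) \<in> borel_measurable circle"
    by (rule circle_AE_lim[OF ae u, where c = 0]) (rule that)
  have "(\<lambda>t. if t \<in> N then 0 else h t) \<in> borel_measurable circle"
    by (rule borel_measurable_LIMSEQ_order[OF N(3,4)])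
  then show ?thesis by (rule circle_AE_measurable) (use N(2) in auto)
qed

lemma circle_AE_lim_complex:
  fixes u :: "nat \<Rightarrow> real \<Rightarrow> complex"
  assumes ae: "AE t in circle. (\<lambda>i. u i t) \<longlonglongrightarrow> h t" and u: "\<And>i. u i \<in> borel_measurable circle"
  shows "h \<in> borel_measurable circle"
proof -
  obtain N where N: "N \<in> sets circle" "AE t in circle. t \<notin> N"
    "\<And>t. t \<in> space circle \<Longrightarrow> (\<lambda>i. if t \<in> N then 0 else u i t) \<longlonglongrightarrow> (if t \<in> N then 0 else h t)"
    "\<And>i. (\<lambda>t. if t \<in> N then 0 else u i t) \<in> borel_measurable circle"
    by (rule circle_AE_lim[OF ae u, where c = 0]) (rule that)
  have "(\<lambda>t. if t \<in> N then 0 else h t) \<in> borel_measurable circle"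
    by (rule borel_measurable_LIMSEQ_metric[OF N(4,3)])
  then show ?thesis by (rule circle_AE_measurable) (use N(2) in auto)
qed

section \<open>Simple functions, approximation in mean and existence of the integral\<close>

lemma S1_simple_S1: "S1_simple s \<Longrightarrow> t \<in> space circle \<Longrightarrow> s t \<in> S1"
  by (auto simp: S1_simple_def)

lemma L1_S1_S1: "f \<in> L1_S1 \<Longrightarrow> t \<in> space circle \<Longrightarrow> f t \<in> S1"
  by (auto simp: L1_S1_def)

lemma S1_simple_integrable: "S1_simple s \<Longrightarrow> Bochner_Integration.simple_bochner_integrable circle s"
  unfolding S1_simple_def
  by (intro simple_bochner_integrable.intros) (auto simp: circle.emeasure_finite)

lemma S1_simple_nuc_measurable: "S1_simple s \<Longrightarrow> (\<lambda>t. nuc (g (s t))) \<in> borel_measurable circle"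
  unfolding S1_simple_def
  by (intro borel_measurable_simple_function simple_function_compose1[of _ s "\<lambda>A. nuc (g A)"]) auto

lemma S1_simple_nuc_measurable2:
  "S1_simple s \<Longrightarrow> S1_simple r \<Longrightarrow> (\<lambda>t. nuc (s t - r t)) \<in> borel_measurable circle"
  unfolding S1_simple_def
  by (intro borel_measurable_simple_function simple_function_compose2[of _ s r "\<lambda>A B. nuc (A - B)"]) auto

lemma S1_simple_diff: "S1_simple s \<Longrightarrow> S1_simple r \<Longrightarrow> S1_simple (\<lambda>t. s t - r t)"
  unfolding S1_simple_def
  by (auto intro!: simple_function_compose2[of _ s r "\<lambda>A B. A - B"] S1_diff)

abbreviation sbi :: "(real \<Rightarrow> ('h::chilbert_space \<Rightarrow>\<^sub>L 'h)) \<Rightarrow> ('h \<Rightarrow>\<^sub>L 'h)" where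
  "sbi \<equiv> Bochner_Integration.simple_bochner_integral circle"

lemma sbi_S1: "S1_simple s \<Longrightarrow> sbi s \<in> S1"
  unfolding simple_bochner_integral_def by (auto simp: S1_simple_def intro!: S1_sum S1_scaleR)

lemma nuc_sbi_le:
  assumes s: "S1_simple s"
  shows "nuc (sbi s) \<le> (\<integral>\<^sup>+t. nuc (s t) \<partial>circle)"
proof -
  have sf: "simple_function circle s" using s by (simp add: S1_simple_def)
  have fin: "finite (s ` space circle)" using sf by (rule simple_functionD)
  have set: "{t \<in> space circle. s t = y} \<in> sets circle" for y
    using simple_functionD(2)[OF sf, of "{y}"] by (simp add: vimage_def Int_def conj_commute)
  have "nuc (sbi s) \<le> (\<Sum>y\<in>s ` space circle. nuc (measure circle {t \<in> space circle. s t = y} *\<^sub>R y))"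
    unfolding simple_bochner_integral_def by (rule nuc_sum)
  also have "\<dots> \<le> (\<Sum>y\<in>s ` space circle. nuc y * emeasure circle {t \<in> space circle. s t = y})"
  proof (rule sum_mono)
    fix y
    have "nuc (measure circle {t \<in> space circle. s t = y} *\<^sub>R y)
        \<le> ennreal \<bar>measure circle {t \<in> space circle. s t = y}\<bar> * nuc y"
      by (rule nuc_scaleR_le)
    then show "nuc (measure circle {t \<in> space circle. s t = y} *\<^sub>R y)
        \<le> nuc y * emeasure circle {t \<in> space circle. s t = y}"
      by (simp add: circle.emeasure_eq_measure mult.commute)
  qed
  also have "\<dots> = (\<integral>\<^sup>+t. (\<Sum>y\<in>s ` space circle. nuc y * indicator {t \<in> space circle. s t = y} t) \<partial>circle)"
    using set by (subst nn_integral_sum) (auto simp: nn_integral_cmult_indicator)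
  also have "\<dots> = (\<integral>\<^sup>+t. nuc (s t) \<partial>circle)"
  proof (rule nn_integral_cong)
    fix t assume t: "t \<in> space circle"
    have "(\<Sum>y\<in>s ` space circle. nuc y * indicator {t \<in> space circle. s t = y} t)
        = (\<Sum>y\<in>s ` space circle. if s t = y then nuc y else 0)"
      using t by (intro sum.cong) (auto simp: indicator_def)
    also have "\<dots> = nuc (s t)" using t fin by (subst sum.delta') auto
    finally show "(\<Sum>y\<in>s ` space circle. nuc y * indicator {t \<in> space circle. s t = y} t) = nuc (s t)" .
  qed
  finally show ?thesis .
qed

lemma nuc_sbi_diff_le:
  assumes "S1_simple s" "S1_simple r"
  shows "nuc (sbi s - sbi r) \<le> (\<integral>\<^sup>+t. nuc (s t - r t) \<partial>circle)"
  using nuc_sbi_le[OF S1_simple_diff[OF assms]]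
  by (simp add: simple_bochner_integral_diff S1_simple_integrable assms)

lemma L1_S1_iff:
  "f \<in> L1_S1 \<longleftrightarrow> (\<forall>t\<in>space circle. f t \<in> S1) \<and>
     (\<exists>s. (\<forall>i. S1_simple (s i)) \<and> (AE t in circle. (\<lambda>i. nuc (f t - s i t)) \<longlonglongrightarrow> 0)) \<and>
     (\<integral>\<^sup>+t. nuc (f t) \<partial>circle) < \<infinity>"
proof (cases "\<forall>t\<in>space circle. f t \<in> S1")
  case True
  have "(AE t in circle. (\<lambda>i. S1_norm (f t - s i t)) \<longlonglongrightarrow> 0) \<longleftrightarrow>
      (AE t in circle. (\<lambda>i. nuc (f t - s i t)) \<longlonglongrightarrow> 0)" if "\<forall>i. S1_simple (s i)" for s
    using True that by (intro AE_cong) (simp add: S1_norm_diff S1_simple_S1)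
  moreover have "(\<integral>\<^sup>+t. S1_norm (f t) \<partial>circle) = (\<integral>\<^sup>+t. nuc (f t) \<partial>circle)"
    using True by (intro nn_integral_cong S1_norm_eq_nuc) (simp add: S1_clin)
  moreover have "f ` space circle \<subseteq> S1" using True by auto
  ultimately show ?thesis using True unfolding L1_S1_def by auto
qed (auto simp: L1_S1_def)

lemma L1_S1_I:
  "(\<And>t. t \<in> space circle \<Longrightarrow> f t \<in> S1) \<Longrightarrow> (\<And>i. S1_simple (s i)) \<Longrightarrow>
    AE t in circle. (\<lambda>i. nuc (f t - s i t)) \<longlonglongrightarrow> 0 \<Longrightarrow> (\<integral>\<^sup>+t. nuc (f t) \<partial>circle) < \<infinity> \<Longrightarrow> f \<in> L1_S1"
  unfolding L1_S1_iff by blast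

lemma has_S1_integral_iff:
  assumes "\<And>t. t \<in> space circle \<Longrightarrow> f t \<in> S1"
  shows "has_S1_integral f I \<longleftrightarrow> I \<in> S1 \<and>
     (\<exists>s. (\<forall>i. S1_simple (s i)) \<and>
          (\<lambda>i. \<integral>\<^sup>+t. nuc (f t - s i t) \<partial>circle) \<longlonglongrightarrow> 0 \<and>
          (\<lambda>i. nuc (sbi (s i) - I)) \<longlonglongrightarrow> 0)"
proof (cases "I \<in> S1")
  case True
  have "((\<forall>i. S1_simple (s i)) \<and>
      (\<lambda>i. \<integral>\<^sup>+t. S1_norm (f t - s i t) \<partial>circle) \<longlonglongrightarrow> 0 \<and>
      (\<lambda>i. S1_norm (sbi (s i) - I)) \<longlonglongrightarrow> 0) \<longleftrightarrow> ((\<forall>i. S1_simple (s i)) \<and>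
      (\<lambda>i. \<integral>\<^sup>+t. nuc (f t - s i t) \<partial>circle) \<longlonglongrightarrow> 0 \<and>
      (\<lambda>i. nuc (sbi (s i) - I)) \<longlonglongrightarrow> 0)" for s
  proof (cases "\<forall>i. S1_simple (s i)")
    case S: True
    have "(\<integral>\<^sup>+t. S1_norm (f t - s i t) \<partial>circle) = (\<integral>\<^sup>+t. nuc (f t - s i t) \<partial>circle)" for i
      using assms S by (intro nn_integral_cong S1_norm_diff) (auto intro: S1_simple_S1)
    moreover have "S1_norm (sbi (s i) - I) = nuc (sbi (s i) - I)" for i
      using S True by (intro S1_norm_diff sbi_S1) auto
    ultimately show ?thesis by simp
  qed blast
  then show ?thesis unfolding has_S1_integral_def by simp
qed (simp add: has_S1_integral_def)

lemma ennreal_squeeze_0_eventually: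
  "e \<longlonglongrightarrow> 0 \<Longrightarrow> \<forall>\<^sub>F i in sequentially. b i \<le> e i \<Longrightarrow> b \<longlonglongrightarrow> (0 :: ennreal)"
  by (rule tendsto_sandwich[where f = "\<lambda>_. 0" and h = e]) auto

lemma ennreal_squeeze_0: "e \<longlonglongrightarrow> 0 \<Longrightarrow> (\<And>i. b i \<le> e i) \<Longrightarrow> b \<longlonglongrightarrow> (0 :: ennreal)"
  by (rule tendsto_sandwich[where f = "\<lambda>_. 0" and h = e]) auto

text \<open>Two one-sided triangle inequalities replace a bound on the distance of
  \<open>b k\<close> and \<open>a\<close>, because subtraction in \<open>ennreal\<close> is
  truncated.\<close>

lemma ennreal_tendsto_between:
  fixes a :: ennreal
  assumes e: "e \<longlonglongrightarrow> 0" and a: "a \<noteq> top" and 1: "\<And>k. b k \<le> e k + a" and 2: "\<And>k. a \<le> e k + b k"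
  shows "b \<longlonglongrightarrow> a"
proof (rule tendsto_sandwich[where f = "\<lambda>k. a - e k" and h = "\<lambda>k. e k + a"])
  show "(\<lambda>k. e k + a) \<longlonglongrightarrow> a" using tendsto_add[OF e tendsto_const[of a]] by simp
  show "(\<lambda>k. a - e k) \<longlonglongrightarrow> a" using tendsto_diff_ennreal[OF tendsto_const[of a] e] a by simp
  show "\<forall>\<^sub>F k in sequentially. a - e k \<le> b k"
    using 2 a by (intro always_eventually) (auto simp: ennreal_minus_le_iff)
qed (use 1 in auto)

lemma L1_S1_measurable:
  assumes f: "f \<in> L1_S1" and s: "S1_simple s"
  shows "(\<lambda>t. nuc (f t - s t)) \<in> borel_measurable circle"
proof -
  obtain r where r: "\<And>i. S1_simple (r i)" "AE t in circle. (\<lambda>i. nuc (f t - r i t)) \<longlonglongrightarrow> 0"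
    using f by (auto simp: L1_S1_iff)
  have "AE t in circle. (\<lambda>i. nuc (r i t - s t)) \<longlonglongrightarrow> nuc (f t - s t)"
    using r(2) AE_space
  proof eventually_elim
    case (elim t)
    have fin: "nuc (f t - s t) \<noteq> top"
      using S1_nuc[OF S1_diff[OF L1_S1_S1[OF f elim(2)] S1_simple_S1[OF s elim(2)]]] by simp
    show ?case
    proof (rule ennreal_tendsto_between[OF elim(1) fin])
      show "nuc (r i t - s t) \<le> nuc (f t - r i t) + nuc (f t - s t)" for i
        using nuc_triangle[of "r i t" "s t" "f t"] by (simp only: nuc_minus_commute[of "f t" "r i t"])
      show "nuc (f t - s t) \<le> nuc (f t - r i t) + nuc (r i t - s t)" for i
        by (rule nuc_triangle)
    qed
  qed
  then show ?thesis by (rule circle_AE_lim_ennreal) (intro S1_simple_nuc_measurable2 r s)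
qed

lemma S1_simple_zero: "S1_simple (\<lambda>_. 0)"
  by (auto simp: S1_simple_def)

lemma L1_S1_measurable': "f \<in> L1_S1 \<Longrightarrow> (\<lambda>t. nuc (f t)) \<in> borel_measurable circle"
  using L1_S1_measurable[OF _ S1_simple_zero, of f] by simp

text \<open>Dominated convergence upgrades convergence almost everywhere to convergence in mean,
  once the approximants are cut off so as to have a majorant.\<close>

lemma L1_S1_approx:
  assumes f: "f \<in> L1_S1"
  obtains s where "\<And>i. S1_simple (s i)" "(\<lambda>i. \<integral>\<^sup>+t. nuc (f t - s i t) \<partial>circle) \<longlonglongrightarrow> 0"
proof -
  obtain r where r: "\<And>i. S1_simple (r i)" "AE t in circle. (\<lambda>i. nuc (f t - r i t)) \<longlonglongrightarrow> 0"
    and fin: "(\<integral>\<^sup>+t. nuc (f t) \<partial>circle) < \<infinity>"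
    using f by (auto simp: L1_S1_iff)
  \<comment> \<open>Where \<open>nuc (r i t)\<close> exceeds \<open>2 * nuc (f t)\<close>, the value
    0 approximates \<open>f t\<close> at least as well as \<open>r i t\<close> does; so the cut-off
    loses nothing and makes \<open>3 * nuc (f t)\<close> a majorant.\<close>
  define s where "s i t = (if nuc (r i t) \<le> 2 * nuc (f t) then r i t else 0)" for i t
  have mf: "(\<lambda>t. nuc (f t)) \<in> borel_measurable circle" by (rule L1_S1_measurable'[OF f])
  have s: "S1_simple (s i)" for i
  proof -
    have "{t \<in> space circle. nuc (r i t) \<le> 2 * nuc (f t)} \<in> sets circle"
      using mf S1_simple_nuc_measurable[OF r(1)[of i], of "\<lambda>A. A"] by measurable
    then have "simple_function circle (s i)"
      unfolding s_def using r(1)[of i] by (intro simple_function_If) (auto simp: S1_simple_def)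
    then show ?thesis using r(1)[of i] by (auto simp: S1_simple_def s_def)
  qed
  have le: "nuc (f t - s i t) \<le> nuc (f t - r i t)" if t: "t \<in> space circle" for i t
  proof (cases "nuc (r i t) \<le> 2 * nuc (f t)")
    case False
    have ff: "nuc (f t) < top" using S1_nuc[OF L1_S1_S1[OF f t]] by simp
    have "nuc (f t) + nuc (f t) \<le> nuc (r i t)" using False by (simp add: mult_2)
    also have "\<dots> \<le> nuc (r i t - f t) + nuc (f t)" using nuc_add[of "r i t - f t" "f t"] by simp
    finally have "nuc (f t) \<le> nuc (r i t - f t)"
      using ff by (auto simp: ennreal_add_left_cancel_le add.commute[of "nuc (r i t - f t)"])
    then show ?thesis using False by (simp add: s_def nuc_minus_commute)
  qed (simp add: s_def)
  have dom: "nuc (f t - s i t) \<le> 3 * nuc (f t)" for i t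
  proof -
    have "nuc (f t - s i t) \<le> nuc (f t) + nuc (s i t)" by (rule nuc_diff)
    also have "\<dots> \<le> nuc (f t) + 2 * nuc (f t)" by (intro add_left_mono) (simp add: s_def)
    also have "\<dots> = 3 * nuc (f t)"
      using distrib_right[of 1 2 "nuc (f t)"] by simp
    finally show ?thesis .
  qed
  have "(\<lambda>i. \<integral>\<^sup>+t. nuc (f t - s i t) \<partial>circle) \<longlonglongrightarrow> (\<integral>\<^sup>+t. 0 \<partial>circle)"
  proof (rule nn_integral_dominated_convergence)
    show "(\<lambda>t. nuc (f t - s i t)) \<in> borel_measurable circle" for i by (rule L1_S1_measurable[OF f s])
    show "(\<lambda>t. 3 * nuc (f t)) \<in> borel_measurable circle" using mf by measurable
    show "(\<integral>\<^sup>+t. 3 * nuc (f t) \<partial>circle) < \<infinity>"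
      using fin mf by (simp add: nn_integral_cmult ennreal_mult_less_top)
    show "AE t in circle. (\<lambda>i. nuc (f t - s i t)) \<longlonglongrightarrow> 0"
      using r(2) AE_space
    proof eventually_elim
      case (elim t)
      show ?case by (rule ennreal_squeeze_0[OF elim(1) le[OF elim(2)]])
    qed
  qed (use dom in auto)
  then show ?thesis using that[of s] s by simp
qed

lemma nn_integral_triangle:
  assumes f: "f \<in> L1_S1" and s: "S1_simple s" and r: "S1_simple r"
  shows "(\<integral>\<^sup>+t. nuc (s t - r t) \<partial>circle)
    \<le> (\<integral>\<^sup>+t. nuc (f t - s t) \<partial>circle) + (\<integral>\<^sup>+t. nuc (f t - r t) \<partial>circle)"
proof -
  have "(\<integral>\<^sup>+t. nuc (s t - r t) \<partial>circle) \<le> (\<integral>\<^sup>+t. nuc (f t - s t) + nuc (f t - r t) \<partial>circle)"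
  proof (rule nn_integral_mono)
    show "nuc (s t - r t) \<le> nuc (f t - s t) + nuc (f t - r t)" for t
      using nuc_triangle[of "s t" "r t" "f t"] by (simp only: nuc_minus_commute[of "s t" "f t"])
  qed
  also have "\<dots> = (\<integral>\<^sup>+t. nuc (f t - s t) \<partial>circle) + (\<integral>\<^sup>+t. nuc (f t - r t) \<partial>circle)"
    by (intro nn_integral_add L1_S1_measurable f s r)
  finally show ?thesis .
qed

text \<open>The integrals of the approximants are Cauchy in \<open>nuc\<close>, hence in operator
  norm, where a limit \<open>I\<close> exists; lower semicontinuity of \<open>nuc\<close> then gives
  convergence in \<open>nuc\<close> as well and puts \<open>I\<close> into
  \<open>S1\<close>.\<close>

lemma has_S1_integral_exists:
  assumes f: "f \<in> L1_S1"
  shows "\<exists>I. has_S1_integral f I"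
proof -
  obtain s where s: "\<And>i. S1_simple (s i)" and lim: "(\<lambda>i. \<integral>\<^sup>+t. nuc (f t - s i t) \<partial>circle) \<longlonglongrightarrow> 0"
    using L1_S1_approx[OF f] by blast
  define d where "d i = (\<integral>\<^sup>+t. nuc (f t - s i t) \<partial>circle)" for i
  have close: "nuc (sbi (s i) - sbi (s j)) \<le> d i + d j" for i j
    unfolding d_def using nuc_sbi_diff_le[OF s s] nn_integral_triangle[OF f s s] order_trans by blast
  have ev: "\<exists>M. \<forall>i\<ge>M. d i < ennreal e" if "e > 0" for e
    using order_tendstoD(2)[OF lim[folded d_def], of "ennreal e"] that by (simp add: eventually_sequentially)
  have nclose: "\<exists>M. \<forall>i\<ge>M. \<forall>j\<ge>M. nuc (sbi (s i) - sbi (s j)) \<le> ennreal e" if e: "e > 0" for e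
  proof -
    obtain M where M: "\<And>i. i \<ge> M \<Longrightarrow> d i < ennreal (e / 2)" using ev[of "e/2"] e by auto
    have "nuc (sbi (s i) - sbi (s j)) \<le> ennreal e" if "i \<ge> M" "j \<ge> M" for i j
    proof -
      have "nuc (sbi (s i) - sbi (s j)) \<le> ennreal (e / 2) + ennreal (e / 2)"
        by (rule order_trans[OF close]) (intro add_mono less_imp_le M that)
      also have "\<dots> = ennreal e" using e by (simp flip: ennreal_plus)
      finally show ?thesis .
    qed
    then show ?thesis by blast
  qed
  have "Cauchy (\<lambda>i. sbi (s i))"
  proof (rule metric_CauchyI)
    fix e :: real assume e: "e > 0"
    obtain M where M: "\<And>i j. i \<ge> M \<Longrightarrow> j \<ge> M \<Longrightarrow> nuc (sbi (s i) - sbi (s j)) \<le> ennreal (e / 2)"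
      using nclose[of "e/2"] e by auto
    have "dist (sbi (s i)) (sbi (s j)) < e" if "i \<ge> M" "j \<ge> M" for i j
    proof -
      have "ennreal (norm (sbi (s i) - sbi (s j))) \<le> ennreal (e / 2)"
        using norm_le_nuc M[OF that] order_trans by blast
      then show ?thesis using e by (simp add: dist_norm)
    qed
    then show "\<exists>M. \<forall>m\<ge>M. \<forall>n\<ge>M. dist (sbi (s m)) (sbi (s n)) < e" by blast
  qed
  then obtain I where I: "(\<lambda>i. sbi (s i)) \<longlonglongrightarrow> I" by (auto simp: Cauchy_convergent_iff convergent_def)
  have cl: "\<exists>M. \<forall>i\<ge>M. nuc (sbi (s i) - I) \<le> ennreal e" if e: "e > 0" for e
  proof -
    obtain M where M: "\<And>i j. i \<ge> M \<Longrightarrow> j \<ge> M \<Longrightarrow> nuc (sbi (s i) - sbi (s j)) \<le> ennreal e"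
      using nclose[OF e] by auto
    have "nuc (sbi (s i) - I) \<le> ennreal e" if "i \<ge> M" for i
    proof (rule nuc_lsc)
      show "(\<lambda>j. sbi (s i) - sbi (s j)) \<longlonglongrightarrow> sbi (s i) - I" by (intro tendsto_intros I)
      show "\<forall>\<^sub>F j in sequentially. nuc (sbi (s i) - sbi (s j)) \<le> ennreal e"
        using M[OF that] by (auto simp: eventually_sequentially)
    qed
    then show ?thesis by blast
  qed
  have limI: "(\<lambda>i. nuc (sbi (s i) - I)) \<longlonglongrightarrow> 0"
  proof (rule tendsto_zero_ennreal)
    fix e :: real assume e: "0 < e"
    obtain M where M: "\<forall>i\<ge>M. nuc (sbi (s i) - I) \<le> ennreal (e / 2)" using cl[of "e/2"] e by auto
    have "ennreal (e / 2) < ennreal e" using e by (simp add: ennreal_lessI)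
    then show "\<forall>\<^sub>F i in sequentially. nuc (sbi (s i) - I) < ennreal e"
      unfolding eventually_sequentially using M le_less_trans by blast
  qed
  obtain M where M: "nuc (sbi (s M) - I) \<le> ennreal 1" using cl[of 1] by auto
  have "nuc I \<le> nuc (sbi (s M)) + nuc (sbi (s M) - I)" using nuc_diff[of "sbi (s M)" "sbi (s M) - I"] by simp
  also have "\<dots> < \<infinity>"
    using le_less_trans[OF M] S1_nuc[OF sbi_S1[OF s[of M]]] by (simp add: ennreal_add_less_top)
  finally have "I \<in> S1" using S1_lim[OF I sbi_S1[OF s]] by simp
  then show ?thesis
    using s lim limI by (auto simp: has_S1_integral_iff[OF L1_S1_S1[OF f]])
qed

lemma has_S1_integral_unique:
  assumes f: "f \<in> L1_S1" and I: "has_S1_integral f I" and J: "has_S1_integral f J"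
  shows "I = J"
proof -
  note iff = has_S1_integral_iff[OF L1_S1_S1[OF f]]
  obtain s where s: "\<And>i. S1_simple (s i)" "(\<lambda>i. \<integral>\<^sup>+t. nuc (f t - s i t) \<partial>circle) \<longlonglongrightarrow> 0"
    "(\<lambda>i. nuc (sbi (s i) - I)) \<longlonglongrightarrow> 0"
    using I by (auto simp: iff)
  obtain r where r: "\<And>i. S1_simple (r i)" "(\<lambda>i. \<integral>\<^sup>+t. nuc (f t - r i t) \<partial>circle) \<longlonglongrightarrow> 0"
    "(\<lambda>i. nuc (sbi (r i) - J)) \<longlonglongrightarrow> 0"
    using J by (auto simp: iff)
  have "(\<lambda>i. nuc (sbi (s i) - I) + ((\<integral>\<^sup>+t. nuc (f t - s i t) \<partial>circle) + (\<integral>\<^sup>+t. nuc (f t - r i t) \<partial>circle))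
      + nuc (sbi (r i) - J)) \<longlonglongrightarrow> 0 + (0 + 0) + 0"
    by (intro tendsto_add s r)
  moreover have "nuc (I - J) \<le> nuc (sbi (s i) - I) + ((\<integral>\<^sup>+t. nuc (f t - s i t) \<partial>circle) + (\<integral>\<^sup>+t. nuc (f t - r i t) \<partial>circle))
      + nuc (sbi (r i) - J)" for i
  proof -
    have "nuc (I - J) \<le> nuc (I - sbi (s i)) + (nuc (sbi (s i) - sbi (r i)) + nuc (sbi (r i) - J))"
      using nuc_triangle[of I J "sbi (s i)"] nuc_triangle[of "sbi (s i)" J "sbi (r i)"]
      by (meson add_left_mono order_trans)
    also have "nuc (sbi (s i) - sbi (r i)) \<le> (\<integral>\<^sup>+t. nuc (f t - s i t) \<partial>circle) + (\<integral>\<^sup>+t. nuc (f t - r i t) \<partial>circle)"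
      using nuc_sbi_diff_le[OF s(1) r(1)] nn_integral_triangle[OF f s(1) r(1)] order_trans by blast
    finally show ?thesis by (simp add: nuc_minus_commute[of I] add.assoc add_left_mono add_right_mono)
  qed
  ultimately have "nuc (I - J) \<le> 0"
    using tendsto_lowerbound[of _ 0 sequentially "nuc (I - J)"] by fastforce
  then show ?thesis using nuc_eq_0[of "I - J"] by simp
qed

lemma S1_integral_eq: "f \<in> L1_S1 \<Longrightarrow> has_S1_integral f I \<Longrightarrow> S1_integral f = I"
  unfolding S1_integral_def using has_S1_integral_unique by blast

lemma has_S1_integral_S1_integral: "f \<in> L1_S1 \<Longrightarrow> has_S1_integral f (S1_integral f)"
  using has_S1_integral_exists S1_integral_eq by metis

section \<open>Interchange of the integral with functionals and contractions\<close>

lemma cmod_cinner_le_nuc: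
  "ennreal (cmod (cinner y (blinfun_apply A x))) \<le> ennreal (norm x * norm y) * nuc A"
proof -
  have "cmod (cinner y (A x)) \<le> norm y * (norm A * norm x)"
    by (rule order_trans[OF cauchy_schwarz]) (intro mult_left_mono norm_blinfun norm_ge_zero)
  then have "ennreal (cmod (cinner y (A x))) \<le> ennreal (norm x * norm y) * ennreal (norm A)"
    by (simp add: mult_ac flip: ennreal_mult)
  also have "\<dots> \<le> ennreal (norm x * norm y) * nuc A" by (intro mult_left_mono norm_le_nuc) simp
  finally show ?thesis .
qed

text \<open>Scalarization: identities between operator integrals can be checked on matrix
  coefficients, where ordinary Bochner integration of complex functions applies.\<close>

lemma has_S1_integral_cinner:
  assumes f: "f \<in> L1_S1" and I: "has_S1_integral f I"
  shows "has_bochner_integral circle (\<lambda>t. cinner y (blinfun_apply (f t) x)) (cinner y (blinfun_apply I x))"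
proof -
  obtain s where s: "\<And>i. S1_simple (s i)" "(\<lambda>i. \<integral>\<^sup>+t. nuc (f t - s i t) \<partial>circle) \<longlonglongrightarrow> 0"
    "(\<lambda>i. nuc (sbi (s i) - I)) \<longlonglongrightarrow> 0"
    using I by (auto simp: has_S1_integral_iff[OF L1_S1_S1[OF f]])
  define c where "c = ennreal (norm x * norm y)"
  have c: "c < top" by (simp add: c_def)
  define L where "L A = cinner y (blinfun_apply A x)" for A
  have L: "linear L"
    by (rule linearI) (auto simp: L_def blinfun.bilinear_simps cinner_simps scaleR_conv_of_real)
  have Ldiff: "L A - L B = L (A - B)" for A B
    by (simp add: L_def blinfun.bilinear_simps cinner_simps)
  have Lle: "ennreal (cmod (L A)) \<le> c * nuc A" for A
    unfolding L_def c_def by (rule cmod_cinner_le_nuc)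
  have sL: "simple_function circle (\<lambda>t. L (s i t))" for i
    using s(1)[of i] by (auto simp: S1_simple_def intro: simple_function_compose1)
  have "has_bochner_integral circle (\<lambda>t. L (f t)) (L I)"
  proof (rule has_bochner_integral.intros)
    show "Bochner_Integration.simple_bochner_integrable circle (\<lambda>t. L (s i t))" for i
      using sL[of i] by (intro simple_bochner_integrable.intros) (auto simp: circle.emeasure_finite)
    \<comment> \<open>Two approximating sequences are at work: \<open>r\<close>, convergent almost
      everywhere, gives measurability, and \<open>s\<close>, convergent in mean, gives the
      value.\<close>
    obtain r where r: "\<And>i. S1_simple (r i)" "AE t in circle. (\<lambda>i. nuc (f t - r i t)) \<longlonglongrightarrow> 0"
      using f by (auto simp: L1_S1_iff)
    have "AE t in circle. (\<lambda>i. L (r i t)) \<longlonglongrightarrow> L (f t)"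
      using r(2)
    proof eventually_elim
      case (elim t)
      have "(\<lambda>i. c * nuc (f t - r i t)) \<longlonglongrightarrow> c * 0" by (intro ennreal_tendsto_cmult c elim)
      then have "(\<lambda>i. c * nuc (f t - r i t)) \<longlonglongrightarrow> 0" by simp
      then have "(\<lambda>i. ennreal (cmod (L (f t) - L (r i t)))) \<longlonglongrightarrow> 0"
        unfolding Ldiff by (rule ennreal_squeeze_0) (rule Lle)
      then have "(\<lambda>i. cmod (L (f t) - L (r i t))) \<longlonglongrightarrow> 0" by (simp add: ennreal_tendsto_0_iff)
      then have "(\<lambda>i. L (f t) - L (r i t)) \<longlonglongrightarrow> 0" by (simp add: tendsto_norm_zero_iff)
      from tendsto_diff[OF tendsto_const[of "L (f t)"] this] show ?case by simp
    qed
    then show "(\<lambda>t. L (f t)) \<in> borel_measurable circle"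
    proof (rule circle_AE_lim_complex)
      have "simple_function circle (r i)" for i using r(1)[of i] by (simp add: S1_simple_def)
      then show "(\<lambda>t. L (r i t)) \<in> borel_measurable circle" for i
        by (intro borel_measurable_simple_function simple_function_compose1[where g = L])
    qed
    have "(\<lambda>i. c * (\<integral>\<^sup>+t. nuc (f t - s i t) \<partial>circle)) \<longlonglongrightarrow> c * 0" by (intro ennreal_tendsto_cmult c s)
    then have "(\<lambda>i. c * (\<integral>\<^sup>+t. nuc (f t - s i t) \<partial>circle)) \<longlonglongrightarrow> 0" by simp
    moreover have "(\<integral>\<^sup>+t. ennreal (cmod (L (f t) - L (s i t))) \<partial>circle) \<le> c * (\<integral>\<^sup>+t. nuc (f t - s i t) \<partial>circle)" for i
      unfolding Ldiff nn_integral_cmult[OF L1_S1_measurable[OF f s(1)], symmetric]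
      by (intro nn_integral_mono Lle)
    ultimately show "(\<lambda>i. \<integral>\<^sup>+t. ennreal (cmod (L (f t) - L (s i t))) \<partial>circle) \<longlonglongrightarrow> 0"
      by (rule ennreal_squeeze_0)
    have "(\<lambda>i. c * nuc (sbi (s i) - I)) \<longlonglongrightarrow> c * 0" by (intro ennreal_tendsto_cmult c s)
    then have "(\<lambda>i. c * nuc (sbi (s i) - I)) \<longlonglongrightarrow> 0" by simp
    then have "(\<lambda>i. ennreal (cmod (L (sbi (s i)) - L I))) \<longlonglongrightarrow> 0"
      unfolding Ldiff by (rule ennreal_squeeze_0) (rule Lle)
    then have "(\<lambda>i. L (sbi (s i))) \<longlonglongrightarrow> L I"
      by (simp add: ennreal_tendsto_0_iff tendsto_norm_zero_iff LIM_zero_iff)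
    then show "(\<lambda>i. Bochner_Integration.simple_bochner_integral circle (\<lambda>t. L (s i t))) \<longlonglongrightarrow> L I"
      by (simp add: simple_bochner_integral_linear[OF L S1_simple_integrable[OF s(1)]])
  qed
  then show ?thesis by (simp add: L_def)
qed

text \<open>The case in mind is a compression \<open>\<Phi> A = V o A o W\<close> by contractions
  \<open>V\<close> and \<open>W\<close>. Being linear and contractive, it may be applied to the
  approximants.\<close>

lemma
  fixes \<Phi> :: "('a::chilbert_space \<Rightarrow>\<^sub>L 'a) \<Rightarrow> ('b::chilbert_space \<Rightarrow>\<^sub>L 'b)"
  assumes lin: "linear \<Phi>" and S1: "\<And>A. A \<in> S1 \<Longrightarrow> \<Phi> A \<in> S1" and le: "\<And>A. nuc (\<Phi> A) \<le> nuc A"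
    and f: "f \<in> L1_S1"
  shows L1_S1_contraction: "(\<lambda>t. \<Phi> (f t)) \<in> L1_S1"
    and has_S1_integral_contraction: "has_S1_integral f I \<Longrightarrow> has_S1_integral (\<lambda>t. \<Phi> (f t)) (\<Phi> I)"
proof -
  have diff: "\<Phi> A - \<Phi> B = \<Phi> (A - B)" for A B using lin by (simp add: linear_diff)
  have simple: "S1_simple (\<lambda>t. \<Phi> (s t))" if "S1_simple s" for s
    using that S1 by (auto simp: S1_simple_def intro: simple_function_compose1)
  obtain r where r: "\<And>i. S1_simple (r i)" "AE t in circle. (\<lambda>i. nuc (f t - r i t)) \<longlonglongrightarrow> 0"
    and fin: "(\<integral>\<^sup>+t. nuc (f t) \<partial>circle) < \<infinity>"
    using f by (auto simp: L1_S1_iff)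
  have ae': "AE t in circle. (\<lambda>i. nuc (\<Phi> (f t) - \<Phi> (r i t))) \<longlonglongrightarrow> 0"
    using r(2)
  proof eventually_elim
    case (elim t)
    show ?case unfolding diff by (rule ennreal_squeeze_0[OF elim le])
  qed
  have fin': "(\<integral>\<^sup>+t. nuc (\<Phi> (f t)) \<partial>circle) < \<infinity>"
    using fin by (rule le_less_trans[rotated]) (intro nn_integral_mono le)
  show L1: "(\<lambda>t. \<Phi> (f t)) \<in> L1_S1"
    by (rule L1_S1_I[where s = "\<lambda>i t. \<Phi> (r i t)", OF _ simple[OF r(1)] ae' fin']) (rule S1[OF L1_S1_S1[OF f]])
  assume I: "has_S1_integral f I"
  obtain s where s: "\<And>i. S1_simple (s i)" "(\<lambda>i. \<integral>\<^sup>+t. nuc (f t - s i t) \<partial>circle) \<longlonglongrightarrow> 0"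
    "(\<lambda>i. nuc (sbi (s i) - I)) \<longlonglongrightarrow> 0" and "I \<in> S1"
    using I by (auto simp: has_S1_integral_iff[OF L1_S1_S1[OF f]])
  have sb: "sbi (\<lambda>t. \<Phi> (s i t)) = \<Phi> (sbi (s i))" for i
    by (rule simple_bochner_integral_linear[OF lin S1_simple_integrable[OF s(1)]])
  have l1: "(\<lambda>i. nuc (sbi (\<lambda>t. \<Phi> (s i t)) - \<Phi> I)) \<longlonglongrightarrow> 0"
    unfolding sb diff by (rule ennreal_squeeze_0[OF s(3) le])
  have l2: "(\<lambda>i. \<integral>\<^sup>+t. nuc (\<Phi> (f t) - \<Phi> (s i t)) \<partial>circle) \<longlonglongrightarrow> 0"
    unfolding diff by (rule ennreal_squeeze_0[OF s(2)]) (intro nn_integral_mono le)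
  show "has_S1_integral (\<lambda>t. \<Phi> (f t)) (\<Phi> I)"
  proof (rule has_S1_integral_iff[THEN iffD2], rule L1_S1_S1[OF L1], assumption, rule conjI[OF S1[OF \<open>I \<in> S1\<close>]], rule exI[of _ "\<lambda>i t. \<Phi> (s i t)"])
    show "(\<forall>i. S1_simple (\<lambda>t. \<Phi> (s i t))) \<and>
      (\<lambda>i. \<integral>\<^sup>+t. nuc (\<Phi> (f t) - \<Phi> (s i t)) \<partial>circle) \<longlonglongrightarrow> 0 \<and>
      (\<lambda>i. nuc (sbi (\<lambda>t. \<Phi> (s i t)) - \<Phi> I)) \<longlonglongrightarrow> 0"
      using l1 l2 simple[OF s(1)] by simp
  qed
qed

lemma L1_S1_op_scaleC:
  assumes f: "f \<in> L1_S1" and w: "w \<in> borel_measurable circle" and w1: "\<And>t. cmod (w t) \<le> 1"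
  shows "(\<lambda>t. op_scaleC (w t) (f t)) \<in> L1_S1"
proof -
  obtain r where r: "\<And>i. S1_simple (r i)" "AE t in circle. (\<lambda>i. nuc (f t - r i t)) \<longlonglongrightarrow> 0"
    and fin: "(\<integral>\<^sup>+t. nuc (f t) \<partial>circle) < \<infinity>"
    using f by (auto simp: L1_S1_iff)
  obtain v where v: "\<And>i. simple_function circle (v i)" "\<And>t. t \<in> space circle \<Longrightarrow> (\<lambda>i. v i t) \<longlonglongrightarrow> w t"
    using borel_measurable_implies_sequence_metric[OF w] by metis
  have le1: "nuc (op_scaleC (w t) A) \<le> nuc A" for t A
  proof -
    have "nuc (op_scaleC (w t) A) \<le> ennreal (cmod (w t)) * nuc A" by (rule nuc_op_scaleC_le)
    also have "\<dots> \<le> 1 * nuc A" by (intro mult_right_mono) (use w1 in auto)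
    finally show ?thesis by simp
  qed
  have simple: "S1_simple (\<lambda>t. op_scaleC (v i t) (r i t))" for i
    using v(1)[of i] r(1)[of i] unfolding S1_simple_def
    by (auto intro!: simple_function_compose2[of _ "v i" "r i" op_scaleC])
  have ae': "AE t in circle. (\<lambda>i. nuc (op_scaleC (w t) (f t) - op_scaleC (v i t) (r i t))) \<longlonglongrightarrow> 0"
    using r(2) AE_space
  proof eventually_elim
    case (elim t)
    \<comment> \<open>Eventually \<open>nuc (r i t)\<close> is at most \<open>nuc (f t) + 1\<close>,
      so this finite factor can stand in front of \<open>cmod (w t - v i t)\<close>.\<close>
    have ft: "nuc (f t) + 1 < top"
      using S1_nuc[OF L1_S1_S1[OF f elim(2)]] by (simp add: ennreal_add_less_top)
    have "(\<lambda>i. cmod (w t - v i t)) \<longlonglongrightarrow> cmod (w t - w t)" by (intro tendsto_intros v(2) elim)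
    then have "(\<lambda>i. ennreal (cmod (w t - v i t))) \<longlonglongrightarrow> 0" by (simp add: ennreal_tendsto_0_iff)
    then have "(\<lambda>i. nuc (f t - r i t) + (nuc (f t) + 1) * ennreal (cmod (w t - v i t))) \<longlonglongrightarrow> 0 + (nuc (f t) + 1) * 0"
      by (intro tendsto_add elim(1) ennreal_tendsto_cmult ft)
    then have "(\<lambda>i. nuc (f t - r i t) + (nuc (f t) + 1) * ennreal (cmod (w t - v i t))) \<longlonglongrightarrow> 0" by simp
    moreover have "\<forall>\<^sub>F i in sequentially. nuc (op_scaleC (w t) (f t) - op_scaleC (v i t) (r i t))
        \<le> nuc (f t - r i t) + (nuc (f t) + 1) * ennreal (cmod (w t - v i t))"
      using order_tendstoD(2)[OF elim(1), of 1, OF zero_less_one]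
    proof eventually_elim
      case (elim i)
      have "op_scaleC (w t) (f t) - op_scaleC (v i t) (r i t)
          = op_scaleC (w t) (f t - r i t) + op_scaleC (w t - v i t) (r i t)"
        by (simp add: op_scaleC_simps)
      then have "nuc (op_scaleC (w t) (f t) - op_scaleC (v i t) (r i t))
          \<le> nuc (op_scaleC (w t) (f t - r i t)) + nuc (op_scaleC (w t - v i t) (r i t))"
        by (simp only: nuc_add)
      also have "\<dots> \<le> nuc (f t - r i t) + ennreal (cmod (w t - v i t)) * nuc (r i t)"
        by (intro add_mono le1 nuc_op_scaleC_le)
      also have "\<dots> \<le> nuc (f t - r i t) + ennreal (cmod (w t - v i t)) * (nuc (f t) + 1)"
      proof -
        have "nuc (r i t) \<le> nuc (f t) + nuc (f t - r i t)"
          using nuc_diff[of "f t" "f t - r i t"] by simp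
        also have "\<dots> \<le> nuc (f t) + 1" using elim by (intro add_left_mono) simp
        finally show ?thesis by (intro add_left_mono mult_left_mono) simp_all
      qed
      finally show ?case by (simp only: mult.commute)
    qed
    ultimately show ?case by (rule ennreal_squeeze_0_eventually)
  qed
  have fin': "(\<integral>\<^sup>+t. nuc (op_scaleC (w t) (f t)) \<partial>circle) < \<infinity>"
    using fin by (rule le_less_trans[rotated]) (intro nn_integral_mono le1)
  show ?thesis
    by (rule L1_S1_I[where s = "\<lambda>i t. op_scaleC (v i t) (r i t)", OF _ simple ae' fin'])
       (rule S1_op_scaleC[OF L1_S1_S1[OF f]])
qed

section \<open>Fourier coefficients of trace class valued functions\<close>

lemma L1_S1_exp: "f \<in> L1_S1 \<Longrightarrow> (\<lambda>t. op_scaleC (exp (- \<i> * of_int n * of_real t)) (f t)) \<in> L1_S1"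
proof (rule L1_S1_op_scaleC)
  have "(\<lambda>t::real. exp (- \<i> * of_int n * of_real t)) \<in> borel_measurable lebesgue"
  proof -
    have "(\<lambda>t::real. exp (- \<i> * of_int n * of_real t)) \<in> borel_measurable borel"
      by (intro borel_measurable_continuous_onI continuous_intros)
    then show ?thesis by (simp add: measurable_completion)
  qed
  then show "(\<lambda>t. exp (- \<i> * of_int n * of_real t)) \<in> borel_measurable circle"
    unfolding circle_def by (rule measurable_restrict_space1)
qed (simp_all add: norm_exp_eq_Re)

lemma fourier_coeff_S1: "f \<in> L1_S1 \<Longrightarrow> fourier_coeff f n \<in> S1"
  using has_S1_integral_S1_integral[OF L1_S1_exp[of f n]]
  unfolding fourier_coeff_def has_S1_integral_def by blast

lemma fourier_coeff_cinner:
  assumes f: "f \<in> L1_S1"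
  shows "has_bochner_integral circle
    (\<lambda>t. exp (- \<i> * of_int n * of_real t) * cinner y (blinfun_apply (f t) x))
    (of_real (2 * pi) * cinner y (blinfun_apply (fourier_coeff f n) x))"
  using has_S1_integral_cinner[OF L1_S1_exp[OF f, of n] has_S1_integral_S1_integral[OF L1_S1_exp[OF f, of n]], of y x]
  unfolding fourier_coeff_def
  by (simp add: apply_op_scaleC cinner_simps blinfun.bilinear_simps)

lemma fourier_coeff_contraction:
  assumes lin: "linear \<Phi>" and S1: "\<And>A. A \<in> S1 \<Longrightarrow> \<Phi> A \<in> S1" and le: "\<And>A. nuc (\<Phi> A) \<le> nuc A"
    and C: "\<And>c A. \<Phi> (op_scaleC c A) = op_scaleC c (\<Phi> A)" and f: "f \<in> L1_S1"
  shows "fourier_coeff (\<lambda>t. \<Phi> (f t)) n = \<Phi> (fourier_coeff f n)"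
proof -
  note f' = L1_S1_exp[OF f, of n]
  have "has_S1_integral (\<lambda>t. \<Phi> (op_scaleC (exp (- \<i> * of_int n * of_real t)) (f t)))
      (\<Phi> (S1_integral (\<lambda>t. op_scaleC (exp (- \<i> * of_int n * of_real t)) (f t))))"
    by (rule has_S1_integral_contraction[OF lin S1 le f' has_S1_integral_S1_integral[OF f']])
  then show ?thesis
    unfolding fourier_coeff_def
    using S1_integral_eq[OF L1_S1_exp[OF L1_S1_contraction[OF lin S1 le f], of n]]
    by (simp add: C linear_scale[OF lin])
qed

lemma L1_norm_eq: "f \<in> L1_S1 \<Longrightarrow> L1_norm f = ennreal (1 / (2 * pi)) * (\<integral>\<^sup>+t. nuc (f t) \<partial>circle)"
  unfolding L1_norm_def
  by (intro arg_cong2[where f = times] refl nn_integral_cong S1_norm_eq_nuc S1_clin L1_S1_S1)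

section \<open>Column norms\<close>

text \<open>Two applications of the Cauchy-Schwarz inequality: the sum is the Gram operator of the
  column \<open>(T j)\<close>, whose norm is the square of the norm of the column.\<close>

lemma gram_norm_le:
  assumes T: "\<And>j. j \<in> I \<Longrightarrow> clin (T j)" and c: "0 \<le> c"
    and le: "\<And>x. (\<Sum>j\<in>I. (norm (blinfun_apply (T j) x))\<^sup>2) \<le> c * (norm x)\<^sup>2"
  shows "norm (\<Sum>j\<in>I. adj (T j) o\<^sub>L T j) \<le> c"
proof (rule norm_blinfun_bound[OF c], rule norm_le_cinnerI)
  fix x y
  have L2: "L2_set (\<lambda>j. norm (T j z)) I \<le> sqrt c * norm z" for z
  proof -
    have "L2_set (\<lambda>j. norm (T j z)) I \<le> sqrt (c * (norm z)\<^sup>2)"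
      unfolding L2_set_def by (rule real_sqrt_le_mono[OF le])
    then show ?thesis by (simp add: real_sqrt_mult)
  qed
  have "Re (cinner y ((\<Sum>j\<in>I. adj (T j) o\<^sub>L T j) x)) = (\<Sum>j\<in>I. Re (cinner (T j y) (T j x)))"
    using T by (simp add: blinfun.sum_left cinner_sum_right cinner_adj_right)
  also have "\<dots> \<le> (\<Sum>j\<in>I. \<bar>norm (T j y)\<bar> * \<bar>norm (T j x)\<bar>)"
    by (intro sum_mono) (simp add: Re_cinner_le)
  also have "\<dots> \<le> L2_set (\<lambda>j. norm (T j y)) I * L2_set (\<lambda>j. norm (T j x)) I" by (rule L2_set_mult_ineq)
  also have "\<dots> \<le> (sqrt c * norm y) * (sqrt c * norm x)"
    by (intro mult_mono L2) (auto simp: c L2_set_nonneg)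
  also have "\<dots> = c * norm x * norm y" using c by simp
  finally show "Re (cinner y ((\<Sum>j\<in>I. adj (T j) o\<^sub>L T j) x)) \<le> c * norm x * norm y" .
qed (use c in simp)

lemma
  assumes T: "\<And>j. clin (T j)" and s: "summable (\<lambda>j. adj (T j) o\<^sub>L T j)"
  shows positive_gram_suminf: "positive_op (\<Sum>j. adj (T j) o\<^sub>L T j)"
    and gram_suminf_sums: "(\<lambda>j. (norm (blinfun_apply (T j) x))\<^sup>2) sums Re (cinner x (blinfun_apply (\<Sum>j. adj (T j) o\<^sub>L T j) x))"
proof -
  define S where "S = (\<Sum>j. adj (T j) o\<^sub>L T j)"
  have S: "(\<lambda>j. adj (T j) o\<^sub>L T j) sums S" using s by (simp add: S_def summable_sums)
  have bl: "bounded_linear (\<lambda>A. cinner x (blinfun_apply A y))" for x y :: 'a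
    by (intro bounded_linear_compose[OF bounded_bilinear.bounded_linear_right[OF bounded_bilinear_cinner]]
        blinfun.bounded_linear_left)
  have sm: "(\<lambda>j. cinner (T j x) (T j y)) sums cinner x (S y)" for x y
    using bounded_linear.sums[OF bl S, of x y] by (simp add: cinner_adj_right T)
  show sums: "(\<lambda>j. (norm (T j x))\<^sup>2) sums Re (cinner x (S x))" for x
    using sums_Re[OF sm[of x x]] by (simp add: Re_cinner_self)
  show "positive_op S"
  proof (rule positive_opI)
    show "clin S"
      using S unfolding sums_def by (rule clin_lim) (auto intro!: clin_sum clin_compose clin_adj T)
    show "cinner (S x) y = cinner x (S y)" for x y
    proof -
      have "(\<lambda>j. cnj (cinner (T j y) (T j x))) sums cnj (cinner y (S x))"
        by (intro sums_cnj[THEN iffD2] sm)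
      moreover have "cnj (cinner (T j y) (T j x)) = cinner (T j x) (T j y)" for j
        by (simp add: cinner_commute[of "T j x"])
      ultimately have "(\<lambda>j. cinner (T j x) (T j y)) sums cinner (S x) y"
        by (simp add: cinner_commute[of "S x"])
      then show ?thesis using sm sums_unique2 by blast
    qed
    show "0 \<le> Re (cinner x (S x))" for x
      using sums_le[OF _ sums_zero sums[of x]] by simp
  qed
qed

lemma CE_norm_summable:
  assumes T: "\<And>j. clin (T j)" and s: "summable (\<lambda>j. adj (T j) o\<^sub>L T j)"
  shows "CE_norm T = nuc (op_sqrt (\<Sum>j. adj (T j) o\<^sub>L T j))"
  unfolding CE_norm_def op_adj_eq[OF T]
  using s by (simp add: op_trace_eq_nuc op_sqrt positive_gram_suminf T)

text \<open>Pointwise \<open>norm (T j x) <= norm (a j (V x))\<close> for the compressed column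
  \<open>T\<close>, so its modulus is dominated by \<open>Ra o V\<close>, and
  \<open>nuc_mono\<close> and \<open>nuc_compose\<close> finish. Convergence of the Gram series has
  to be transferred as well, as \<open>CE_norm\<close> is infinite without it.\<close>

lemma CE_norm_compress:
  fixes V :: "'a::chilbert_space \<Rightarrow>\<^sub>L 'b::chilbert_space"
  assumes V: "clin V" "\<And>h. norm (blinfun_apply V h) \<le> norm h" and a: "\<And>j. clin (a j)"
  shows "CE_norm (\<lambda>j. adj V o\<^sub>L a j o\<^sub>L V) \<le> CE_norm a"
proof (cases "summable (\<lambda>j. adj (a j) o\<^sub>L a j)")
  case True
  define T where "T j = adj V o\<^sub>L a j o\<^sub>L V" for j
  have T: "clin (T j)" for j unfolding T_def by (intro clin_compose clin_adj V a)
  have le: "norm (T j x) \<le> norm (a j (V x))" for j x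
    unfolding T_def by (simp add: norm_adj_contraction[OF V])
  have "summable (\<lambda>j. adj (T j) o\<^sub>L T j)"
    unfolding summable_Cauchy
  proof (intro allI impI)
    fix e :: real assume "e > 0"
    then obtain N where N: "\<And>m n. m \<ge> N \<Longrightarrow> norm (\<Sum>j=m..<n. adj (a j) o\<^sub>L a j) < e"
      using True unfolding summable_Cauchy by blast
    have "norm (\<Sum>j=m..<n. adj (T j) o\<^sub>L T j) < e" if "m \<ge> N" for m n
    proof (rule le_less_trans[OF gram_norm_le N[OF that, of n]])
      fix x
      let ?c = "norm (\<Sum>j=m..<n. adj (a j) o\<^sub>L a j)"
      have "(\<Sum>j=m..<n. (norm (T j x))\<^sup>2) \<le> (\<Sum>j=m..<n. (norm (a j (V x)))\<^sup>2)"
        by (intro sum_mono power_mono le) auto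
      also have "\<dots> = Re (cinner (V x) ((\<Sum>j=m..<n. adj (a j) o\<^sub>L a j) (V x)))"
        by (simp add: blinfun.sum_left cinner_sum_right cinner_adj_right a Re_cinner_self)
      also have "\<dots> \<le> norm (V x) * (?c * norm (V x))"
        by (rule order_trans[OF Re_cinner_le]) (intro mult_left_mono norm_blinfun norm_ge_zero)
      also have "\<dots> \<le> norm x * (?c * norm x)" by (intro mult_mono V) auto
      finally show "(\<Sum>j=m..<n. (norm (T j x))\<^sup>2) \<le> ?c * (norm x)\<^sup>2" by (simp add: power2_eq_square mult_ac)
    qed (use T in auto)
    then show "\<exists>N. \<forall>m\<ge>N. \<forall>n. norm (\<Sum>j=m..<n. adj (T j) o\<^sub>L T j) < e" by blast
  qed
  note sT = this
  define Ra where "Ra = op_sqrt (\<Sum>j. adj (a j) o\<^sub>L a j)"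
  define RT where "RT = op_sqrt (\<Sum>j. adj (T j) o\<^sub>L T j)"
  have clRa: "clin Ra" and clRT: "clin RT"
    unfolding Ra_def RT_def
    by (intro positive_op_clin op_sqrt positive_gram_suminf a True T sT)+
  have "norm (RT x) \<le> norm ((Ra o\<^sub>L V) x)" for x
  proof -
    have "(norm (RT x))\<^sup>2 = Re (cinner x ((\<Sum>j. adj (T j) o\<^sub>L T j) x))"
      unfolding RT_def by (intro norm_sq_op_sqrt positive_gram_suminf T sT)
    also have "\<dots> \<le> Re (cinner (V x) ((\<Sum>j. adj (a j) o\<^sub>L a j) (V x)))"
      by (rule sums_le[OF _ gram_suminf_sums[OF T sT, of x] gram_suminf_sums[OF a True, of "V x"]])
         (intro power_mono le norm_ge_zero)
    also have "\<dots> = (norm (Ra (V x)))\<^sup>2"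
      unfolding Ra_def by (intro norm_sq_op_sqrt[symmetric] positive_gram_suminf a True)
    finally have "(norm (RT x))\<^sup>2 \<le> (norm ((Ra o\<^sub>L V) x))\<^sup>2" by simp
    then show ?thesis by (rule power2_le_imp_le) simp
  qed
  then have "nuc RT \<le> nuc (Ra o\<^sub>L V)" by (intro nuc_mono clRT clin_compose clRa V)
  also have "\<dots> = nuc (id_blinfun o\<^sub>L Ra o\<^sub>L V)" by simp
  also have "\<dots> \<le> nuc Ra" by (intro nuc_compose V) auto
  finally show ?thesis
    unfolding T_def[symmetric] by (simp add: CE_norm_summable a True T sT Ra_def RT_def)
qed (simp add: CE_norm_def op_adj_eq a)

text \<open>Every splitting of \<open>c\<close> is compressed termwise, so the infimum cannot
  increase. This brings the estimate on \<open>ell2\<close> back to the original space without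
  loss.\<close>

lemma triple_norm_compress:
  fixes V :: "'a::chilbert_space \<Rightarrow>\<^sub>L 'b::chilbert_space"
  assumes V: "clin V" "\<And>h. norm (blinfun_apply V h) \<le> norm h"
  shows "triple_norm (\<lambda>j. adj V o\<^sub>L c j o\<^sub>L V) \<le> triple_norm c"
proof -
  define \<Psi> where "\<Psi> A = adj V o\<^sub>L A o\<^sub>L V" for A
  have add: "\<Psi> (A + B) = \<Psi> A + \<Psi> B" for A B
    unfolding \<Psi>_def by (intro blinfun_eqI) (simp add: blinfun.bilinear_simps)
  show ?thesis
    unfolding \<Psi>_def[symmetric] triple_norm_def
  proof (rule INF_greatest, clarify)
    fix a b assume ab: "\<forall>j. compact_op (a j)" "\<forall>j. compact_op (b j)" "\<forall>j. c j = a j + b j"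
    have cl: "clin (a j)" "clin (b j)" for j using ab by (auto simp: compact_op_iff)
    have adj: "op_adj (\<Psi> (b j)) = \<Psi> (op_adj (b j))" for j
    proof -
      have "op_adj (\<Psi> (b j)) = adj (\<Psi> (b j))"
        unfolding \<Psi>_def by (intro op_adj_eq clin_compose clin_adj V cl)
      also have "\<dots> = \<Psi> (adj (b j))"
        unfolding \<Psi>_def by (rule adj_eqI)
          (auto intro!: clin_compose clin_adj V cl simp: cinner_adj_left cinner_adj_right V cl)
      finally show ?thesis by (simp add: op_adj_eq cl)
    qed
    have cpt: "compact_op (\<Psi> A)" if "compact_op A" for A
      using that unfolding compact_op_iff \<Psi>_def
      by (auto intro!: clin_compose clin_adj V totbdd_compose)
    have "(INF (a, b)\<in>{(a, b). (\<forall>j. compact_op (a j)) \<and> (\<forall>j. compact_op (b j)) \<and> (\<forall>j. \<Psi> (c j) = a j + b j)}.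
        CE_norm a + CE_norm (\<lambda>j. op_adj (b j))) \<le> CE_norm (\<lambda>j. \<Psi> (a j)) + CE_norm (\<lambda>j. op_adj (\<Psi> (b j)))"
      by (rule INF_lower2[of "(\<lambda>j. \<Psi> (a j), \<lambda>j. \<Psi> (b j))"]) (use ab cpt in \<open>auto simp: add\<close>)
    also have "\<dots> \<le> CE_norm a + CE_norm (\<lambda>j. op_adj (b j))"
      unfolding adj unfolding \<Psi>_def
      by (intro add_mono CE_norm_compress V cl) (simp add: op_adj_eq cl clin_adj)
    finally show "(INF (a, b)\<in>{(a, b). (\<forall>j. compact_op (a j)) \<and> (\<forall>j. compact_op (b j)) \<and> (\<forall>j. \<Psi> (c j) = a j + b j)}.
        CE_norm a + CE_norm (\<lambda>j. op_adj (b j))) \<le> CE_norm a + CE_norm (\<lambda>j. op_adj (b j))" .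
  qed
qed


section \<open>Reduction to \<open>\<ell>\<^sup>2\<close>\<close>

definition ket :: "nat \<Rightarrow> ell2" where
  "ket n = Abs_ell2 (\<lambda>m. if m = n then 1 else 0)"

lemma Rep_ket: "Rep_ell2 (ket n) = (\<lambda>m. if m = n then 1 else 0)"
  unfolding ket_def
proof (rule Abs_ell2_inverse)
  have "summable (\<lambda>m. (cmod (if m = n then 1 else 0))\<^sup>2)"
    by (rule summable_finite[of "{n}"]) auto
  then show "(\<lambda>m. if m = n then 1 else 0) \<in> {x. sq_summable x}" by (simp add: sq_summable_def)
qed

lemma cinner_ket_left: "cinner (ket n) x = Rep_ell2 x n"
proof -
  have "cinner (ket n) x = (\<Sum>m. if m = n then Rep_ell2 x m else 0)"
    unfolding cinner_ell2_def Rep_ket by (intro suminf_cong) simp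
  also have "\<dots> = Rep_ell2 x n" by (subst suminf_finite[of "{n}"]) auto
  finally show ?thesis .
qed

lemma cinner_ket_right: "cinner x (ket n) = cnj (Rep_ell2 x n)"
  by (subst cinner_commute) (simp add: cinner_ket_left)

lemma norm_ket [simp]: "norm (ket n) = 1"
proof -
  have "(norm (ket n))\<^sup>2 = 1"
    using Re_cinner_self[of "ket n"] by (simp add: cinner_ket_left Rep_ket)
  then show ?thesis using power2_eq_imp_eq[of "norm (ket n)" 1] by simp
qed

text \<open>Up to a scalar, \<open>adj A o A\<close> is a contraction times \<open>A\<close>, so its
  trace is finite; hence only countably many of its diagonal entries, the
  \<open>(norm (A e))^2\<close>, differ from 0.\<close>

lemma countable_nonzero_basis:
  assumes E: "orthonormal_basis E" and A: "clin A" "nuc A < \<infinity>"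
  shows "countable {e\<in>E. blinfun_apply A e \<noteq> 0}"
proof -
  have on: "orthonormal E" using E by (simp add: orthonormal_basis_iff)
  define c where "c = norm A + 1"
  have c: "c > 0" by (simp add: c_def add_nonneg_pos)
  define V where "V = (1/c) *\<^sub>R adj A"
  have clV: "clin V" unfolding V_def using A(1) by auto
  have V: "norm (V h) \<le> norm h" for h
  proof -
    have "norm (adj A h) \<le> c * norm h"
    proof (rule order_trans[OF norm_blinfun])
      show "norm (adj A) * norm h \<le> c * norm h"
        using norm_adj_le[OF A(1)] by (intro mult_right_mono) (auto simp: c_def)
    qed
    then show ?thesis using c by (simp add: V_def blinfun.bilinear_simps divide_le_eq mult.commute)
  qed
  have "nuc (V o\<^sub>L A) \<le> nuc A" using nuc_compose[OF clV V, of id_blinfun A] by simp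
  then have fin: "nuc (V o\<^sub>L A) < \<infinity>" using A(2) by (rule le_less_trans)
  then obtain B where B: "nuc (V o\<^sub>L A) = ennreal B" "0 \<le> B" by (cases "nuc (V o\<^sub>L A)") auto
  define g where "g e = (norm (A e))\<^sup>2 / c" for e
  have geq: "Re (cinner e ((V o\<^sub>L A) e)) = g e" for e
    by (simp add: V_def blinfun.bilinear_simps cinner_simps cinner_adj_right A(1) Re_cinner_self g_def cinner_self)
  have "sum g F \<le> B" if F: "finite F" "F \<subseteq> E" for F
  proof -
    obtain x where x: "bij_betw x {0..<card F} F" using ex_bij_betw_nat_finite F(1) by blast
    have b: "bessel (card F) x"
      using x F by (intro bessel_orthonormal[OF on]) (auto simp: bij_betw_def atLeast0LessThan)
    have "sum g F = Re (\<Sum>i<card F. cinner (x i) ((V o\<^sub>L A) (x i)))"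
      unfolding Re_sum geq using sum.reindex_bij_betw[OF x, of g] by (simp add: atLeast0LessThan)
    then have "ennreal (sum g F) \<le> ennreal B" using nuc_ge[OF b b, of "V o\<^sub>L A"] B by simp
    then show ?thesis using B by simp
  qed
  then have "g summable_on E"
    using c by (intro nonneg_bdd_above_summable_on) (auto simp: g_def intro!: bdd_aboveI[of _ B])
  then have "countable {e\<in>E. g e \<noteq> 0}" by (rule summable_countable_real)
  moreover have "{e\<in>E. A e \<noteq> 0} \<subseteq> {e\<in>E. g e \<noteq> 0}" using c by (auto simp: g_def)
  ultimately show ?thesis by (rule countable_subset[rotated])
qed

text \<open>A partial isometry: \<open>adj J o J\<close> is the orthogonal projection onto the
  closed span of \<open>E0\<close>. The set may be finite, so only the coordinates in
  \<open>D\<close> are filled and all others are 0.\<close>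

lemma coordinate_operator:
  assumes on: "orthonormal E0" and cnt: "countable E0"
  obtains J :: "'h::chilbert_space \<Rightarrow>\<^sub>L ell2" where
    "clin J" "\<And>x. norm (J x) \<le> norm x" "\<And>e. e \<in> E0 \<Longrightarrow> adj J (J e) = e"
    "\<And>x. (\<And>e. e \<in> E0 \<Longrightarrow> cinner e x = 0) \<Longrightarrow> J x = 0"
proof -
  define ix where "ix = to_nat_on E0"
  define b where "b = from_nat_into E0"
  define D where "D = ix ` E0"
  have b: "b (ix e) = e" if "e \<in> E0" for e unfolding b_def ix_def using cnt that by (rule from_nat_into_to_nat_on)
  define c where "c x n = (if n \<in> D then cinner (b n) x else 0)" for x n
  have bnd: "L2_set (\<lambda>n. cmod (c x n)) {..<N} \<le> norm x" for x N
  proof -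
    let ?F = "b ` (D \<inter> {..<N})"
    have inj: "inj_on b (D \<inter> {..<N})" unfolding D_def by (rule inj_onI) (auto simp: b)
    have F: "?F \<subseteq> E0" by (auto simp: D_def b)
    have "(\<Sum>n<N. (cmod (c x n))\<^sup>2) = (\<Sum>n\<in>D \<inter> {..<N}. (cmod (cinner (b n) x))\<^sup>2)"
      by (intro sum.mono_neutral_cong_right) (auto simp: c_def)
    also have "\<dots> = (\<Sum>e\<in>?F. (cmod (cinner e x))\<^sup>2)" using inj by (simp add: sum.reindex)
    also have "\<dots> \<le> (norm x)\<^sup>2" using orthonormal_subset[OF on F] by (intro bessel_inequality) auto
    finally show ?thesis unfolding L2_set_def by (intro real_le_lsqrt) (auto intro: sum_nonneg)
  qed
  define Jf where "Jf x = Abs_ell2 (c x)" for x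
  have Rep: "Rep_ell2 (Jf x) = c x" for x
    unfolding Jf_def using l2norm_bound(1)[OF bnd] by (intro Abs_ell2_inverse) simp
  have nJ: "norm (Jf x) \<le> norm x" for x
    unfolding norm_ell2_def Rep by (rule l2norm_bound(2)[OF bnd])
  have bl: "bounded_linear Jf"
    by (rule bounded_linear_intro[where K = 1])
       (auto simp: nJ Rep Rep_ell2_simps c_def cinner_simps intro!: ell2_eqI)
  define J where "J = Blinfun Jf"
  have J: "J x = Jf x" for x unfolding J_def using bl by (rule bounded_linear_Blinfun_apply[THEN fun_cong])
  have cl: "clin J"
    unfolding clin_def J by (auto simp: Rep Rep_ell2_scaleC c_def cinner_simps intro!: ell2_eqI)
  show ?thesis
  proof (rule that[OF cl])
    show "norm (J x) \<le> norm x" for x by (simp add: J nJ)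
    show "J x = 0" if "\<And>e. e \<in> E0 \<Longrightarrow> cinner e x = 0" for x
      by (rule ell2_eqI) (use that in \<open>auto simp: J Rep Rep_ell2_zero c_def D_def b\<close>)
    fix e assume e: "e \<in> E0"
    then have ne: "norm e = 1" using on by (simp add: orthonormal_def)
    have "J e = ket (ix e)"
    proof (rule ell2_eqI)
      fix n
      show "Rep_ell2 (J e) n = Rep_ell2 (ket (ix e)) n"
        using e ne by (auto simp: J Rep c_def Rep_ket D_def b orthonormal_cinner[OF on] cinner_self)
    qed
    then show "adj J (J e) = e"
      by (intro cinner_eqI) (use e in \<open>simp add: cinner_adj_right cl cinner_ket_right J Rep c_def D_def b cinner_commute[of _ e]\<close>)
  qed
qed

lemma fourier_coeff_cong_AE:
  assumes f: "f \<in> L1_S1" and g: "g \<in> L1_S1" and eq: "AE t in circle. f t = g t"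
  shows "fourier_coeff f n = fourier_coeff g n"
proof (intro blinfun_eqI cinner_eqI)
  fix x y
  note F = fourier_coeff_cinner[OF f, of n y x] and G = fourier_coeff_cinner[OF g, of n y x]
  have "of_real (2 * pi) * cinner y (fourier_coeff f n x) = of_real (2 * pi) * cinner y (fourier_coeff g n x)"
    unfolding has_bochner_integral_integral_eq[OF F, symmetric] has_bochner_integral_integral_eq[OF G, symmetric]
  proof (rule integral_cong_AE)
    show "AE t in circle. exp (- \<i> * of_int n * of_real t) * cinner y (f t x)
        = exp (- \<i> * of_int n * of_real t) * cinner y (g t x)"
      using eq by eventually_elim simp
  qed (use F G in \<open>auto simp: has_bochner_integral_iff intro: borel_measurable_integrable\<close>)
  then show "cinner y (fourier_coeff f n x) = cinner y (fourier_coeff g n x)" by simp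
qed

text \<open>The approximating simple functions take countably many values, each of which, together
  with its adjoint, is nonzero on countably many basis vectors only. With \<open>P\<close> the
  projection onto the closed span of these vectors, \<open>P o f t o P = f t\<close> almost
  everywhere; so the coefficients of \<open>f\<close> survive the passage to \<open>ell2\<close> and
  back.\<close>

lemma compress_to_ell2:
  fixes f :: "real \<Rightarrow> ('h::chilbert_space \<Rightarrow>\<^sub>L 'h)"
  assumes f: "f \<in> L1_S1"
  obtains J :: "'h \<Rightarrow>\<^sub>L ell2" where "clin J" "\<And>x. norm (J x) \<le> norm x"
    "(\<lambda>t. J o\<^sub>L f t o\<^sub>L adj J) \<in> L1_S1" "L1_norm (\<lambda>t. J o\<^sub>L f t o\<^sub>L adj J) \<le> L1_norm f"
    "\<And>n. fourier_coeff (\<lambda>t. J o\<^sub>L f t o\<^sub>L adj J) n = J o\<^sub>L fourier_coeff f n o\<^sub>L adj J"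
    "\<And>n. adj J o\<^sub>L (J o\<^sub>L fourier_coeff f n o\<^sub>L adj J) o\<^sub>L J = fourier_coeff f n"
proof -
  obtain s where s: "\<And>i. S1_simple (s i)" "AE t in circle. (\<lambda>i. nuc (f t - s i t)) \<longlonglongrightarrow> 0"
    using f by (auto simp: L1_S1_iff)
  obtain E :: "'h set" where E: "orthonormal_basis E" using orthonormal_basis_exists by blast
  have on: "orthonormal E" and tot: "\<And>x. (\<And>e. e \<in> E \<Longrightarrow> cinner e x = 0) \<Longrightarrow> x = 0"
    using E by (auto simp: orthonormal_basis_iff)
  define \<V> where "\<V> = (\<Union>i. s i ` space circle)"
  have cV: "countable \<V>"
    unfolding \<V>_def
  proof (rule countable_UN)
    show "countable (s i ` space circle)" for i
      using s(1)[of i] unfolding S1_simple_def by (auto dest: simple_functionD(1) intro: countable_finite)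
  qed simp
  have VS1: "A \<in> S1" if "A \<in> \<V>" for A using that s(1) by (auto simp: \<V>_def S1_simple_S1)
  \<comment> \<open>The basis vectors on which \<open>adj A\<close> does not vanish capture the
    range of \<open>A\<close>, those on which \<open>A\<close> does not vanish capture the range of
    \<open>adj A\<close>.\<close>
  define E0 where "E0 = (\<Union>A\<in>\<V>. {e\<in>E. blinfun_apply A e \<noteq> 0} \<union> {e\<in>E. blinfun_apply (adj A) e \<noteq> 0})"
  have "countable E0"
    unfolding E0_def using VS1
    by (intro countable_UN cV countable_Un countable_nonzero_basis E)
       (auto simp: S1_iff nuc_adj)
  moreover have E0E: "E0 \<subseteq> E" by (auto simp: E0_def)
  ultimately obtain J :: "'h \<Rightarrow>\<^sub>L ell2" where J: "clin J" "\<And>x. norm (J x) \<le> norm x"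
    "\<And>e. e \<in> E0 \<Longrightarrow> adj J (J e) = e" "\<And>x. (\<And>e. e \<in> E0 \<Longrightarrow> cinner e x = 0) \<Longrightarrow> J x = 0"
    using coordinate_operator[OF orthonormal_subset[OF on E0E]] by metis
  define P where "P = adj J o\<^sub>L J"
  have Psa: "cinner (P x) y = cinner x (P y)" for x y by (simp add: P_def cinner_adj_left cinner_adj_right J)
  have clP: "clin P" unfolding P_def by (intro clin_compose clin_adj J)
  have Pn: "norm (P x) \<le> norm x" for x
    unfolding P_def using norm_adj_contraction[OF J(1,2), of "J x"] J(2)[of x] by simp
  have P1: "P e = e" if "e \<in> E0" for e using J(3)[OF that] by (simp add: P_def)
  have P0: "P e = 0" if "e \<in> E - E0" for e
  proof -
    have "J e = 0" by (rule J(4)) (use that E0E on in \<open>auto simp: orthonormal_cinner\<close>)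
    then show ?thesis by (simp add: P_def blinfun.zero_right)
  qed
  have PA: "P (A x) = A x" if A: "clin A" and A0: "\<And>e. e \<in> E - E0 \<Longrightarrow> adj A e = 0" for A x
  proof -
    have "cinner e (P (A x) - A x) = 0" if "e \<in> E" for e
    proof (cases "e \<in> E0")
      case False
      then have e: "e \<in> E - E0" using that by simp
      have "cinner e (A x) = cinner (adj A e) x" by (simp add: cinner_adj_left A)
      then show ?thesis using P0[OF e] A0[OF e] by (simp add: cinner_diff_right Psa[symmetric])
    qed (simp add: cinner_diff_right Psa[symmetric] P1)
    then show ?thesis using tot[of "P (A x) - A x"] by simp
  qed
  have PAP: "P o\<^sub>L A o\<^sub>L P = A" if A: "A \<in> \<V>" for A
  proof -
    have cl: "clin A" using VS1[OF A] by (rule S1_clin)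
    have 1: "P (A x) = A x" for x by (rule PA[OF cl]) (use A in \<open>auto simp: E0_def\<close>)
    have 2: "P (adj A x) = adj A x" for x
      by (rule PA[OF clin_adj[OF cl]]) (use A in \<open>auto simp: E0_def adj_adj cl\<close>)
    have "A (P x) = A x" for x
      by (rule cinner_eqI) (simp add: cinner_adj_left[OF cl, symmetric] Psa[symmetric] 2)
    then show ?thesis using 1 by (intro blinfun_eqI) simp
  qed
  define \<Phi> where "\<Phi> A = J o\<^sub>L A o\<^sub>L adj J" for A
  define \<Theta> where "\<Theta> A = P o\<^sub>L A o\<^sub>L P" for A
  note Jadj = clin_adj[OF J(1)] norm_adj_contraction[OF J(1,2)]
  have lin: "linear \<Phi>" "linear \<Theta>"
    unfolding \<Phi>_def \<Theta>_def by (auto intro!: linearI blinfun_eqI simp: blinfun.bilinear_simps)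
  have S1: "\<Phi> A \<in> S1" "\<Theta> A \<in> S1" if "A \<in> S1" for A
    unfolding \<Phi>_def \<Theta>_def by (intro S1_compose J(1,2) Jadj clP Pn that)+
  have le: "nuc (\<Phi> A) \<le> nuc A" "nuc (\<Theta> A) \<le> nuc A" for A
    unfolding \<Phi>_def \<Theta>_def by (intro nuc_compose J(1,2) Jadj clP Pn)+
  have C: "\<Phi> (op_scaleC c A) = op_scaleC c (\<Phi> A)" "\<Theta> (op_scaleC c A) = op_scaleC c (\<Theta> A)" for c A
    unfolding \<Phi>_def \<Theta>_def by (auto intro!: blinfun_eqI simp: apply_op_scaleC clinD J(1) clP)
  have "AE t in circle. f t = \<Theta> (f t)"
    using s(2) AE_space
  proof eventually_elim
    case (elim t)
    \<comment> \<open>\<open>\<Theta>\<close> fixes \<open>s i t\<close> and does not increase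
      \<open>nuc\<close>, so twice the approximation error bounds the defect.\<close>
    have "nuc (\<Theta> (f t) - f t) \<le> nuc (f t - s i t) + nuc (f t - s i t)" for i
    proof -
      have "\<Theta> (f t) - f t = \<Theta> (f t - s i t) - (f t - s i t)"
      proof -
        have "s i t \<in> \<V>" using elim(2) by (auto simp: \<V>_def)
        then have "\<Theta> (s i t) = s i t" unfolding \<Theta>_def by (rule PAP)
        then show ?thesis by (simp add: linear_diff[OF lin(2)])
      qed
      then show ?thesis using nuc_diff[of "\<Theta> (f t - s i t)" "f t - s i t"] le(2)[of "f t - s i t"]
        by (metis add_right_mono order_trans)
    qed
    moreover have "(\<lambda>i. nuc (f t - s i t) + nuc (f t - s i t)) \<longlonglongrightarrow> 0"
      using tendsto_add[OF elim(1) elim(1)] by simp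
    ultimately have "nuc (\<Theta> (f t) - f t) \<le> 0" by (intro LIMSEQ_le_const) auto
    then show "f t = \<Theta> (f t)" using nuc_eq_0[of "\<Theta> (f t) - f t"] by simp
  qed
  then have "fourier_coeff f n = fourier_coeff (\<lambda>t. \<Theta> (f t)) n" for n
    by (intro fourier_coeff_cong_AE f L1_S1_contraction[OF lin(2) S1(2) le(2) f]) 
  then have PfP: "fourier_coeff f n = \<Theta> (fourier_coeff f n)" for n
    using fourier_coeff_contraction[OF lin(2) S1(2) le(2) C(2) f] by simp
  note L1 = L1_S1_contraction[OF lin(1) S1(1) le(1) f]
  show ?thesis
  proof (rule that[OF J(1,2)]; unfold \<Phi>_def[symmetric])
    show "(\<lambda>t. \<Phi> (f t)) \<in> L1_S1" by (rule L1)
    show "L1_norm (\<lambda>t. \<Phi> (f t)) \<le> L1_norm f"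
    proof -
      have "L1_norm (\<lambda>t. \<Phi> (f t)) = ennreal (1 / (2 * pi)) * (\<integral>\<^sup>+t. nuc (\<Phi> (f t)) \<partial>circle)"
        by (rule L1_norm_eq[OF L1])
      also have "\<dots> \<le> L1_norm f"
        unfolding L1_norm_eq[OF f] by (intro mult_left_mono nn_integral_mono le) simp
      finally show ?thesis .
    qed
    show "fourier_coeff (\<lambda>t. \<Phi> (f t)) n = \<Phi> (fourier_coeff f n)" for n
      by (rule fourier_coeff_contraction[OF lin(1) S1(1) le(1) C(1) f])
    show "adj J o\<^sub>L \<Phi> (fourier_coeff f n) o\<^sub>L J = fourier_coeff f n" for n
      by (subst (2) PfP) (auto intro!: blinfun_eqI simp: \<Phi>_def \<Theta>_def P_def)
  qed
qed

section \<open>Characters of the cyclic group\<close>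

text \<open>The character with frequency \<open>m\<close> of the cyclic group of order
  \<open>L\<close>, evaluated at \<open>l\<close>. Frequencies are integers, as negative ones occur
  for adjoints and in the Fejer kernel.\<close>

definition chi :: "nat \<Rightarrow> nat \<Rightarrow> int \<Rightarrow> complex" where
  "chi L l m = cis (2 * pi * real l * of_int m / real L)"

lemma chi_add: "chi L l (m + n) = chi L l m * chi L l n"
  by (simp add: chi_def cis_mult ring_distribs add_divide_distrib)

lemma chi_minus: "chi L l (- m) = cnj (chi L l m)"
  by (simp add: chi_def cis_cnj)

lemma cnj_chi_mult: "cnj (chi L l m) * chi L l n = chi L l (n - m)"
  using chi_add[of L l "- m" n] by (simp add: chi_minus)

lemma chi_sum:
  assumes L: "0 < L"
  shows "(\<Sum>l<L. chi L l m) = (if int L dvd m then of_nat L else 0)"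
proof -
  define z where "z = cis (2 * pi * of_int m / real L)"
  have chi: "chi L l m = z ^ l" for l
    unfolding z_def chi_def Complex.DeMoivre by (simp add: mult_ac)
  have zL: "z ^ L = 1"
    unfolding z_def Complex.DeMoivre using L cis_multiple_2pi[of "of_int m"] by simp
  have z1: "z = 1 \<longleftrightarrow> int L dvd m"
  proof
    assume "z = 1"
    then have "exp (\<i> * of_real (2 * pi * of_int m / real L)) = 1" by (simp add: z_def cis_conv_exp)
    then obtain n :: int where n: "2 * pi * of_int m / real L = of_int (2 * n) * pi"
      unfolding exp_eq_1 by auto
    then have "of_int m = (of_int (n * int L) :: real)" using L by (simp add: field_simps)
    then have "m = n * int L" by (simp only: of_int_eq_iff)
    then show "int L dvd m" by simp
  next
    assume "int L dvd m"
    then obtain q where "m = int L * q" by (rule dvdE)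
    then show "z = 1" using L cis_multiple_2pi[of "of_int q"] by (simp add: z_def mult_ac)
  qed
  show ?thesis
  proof (cases "int L dvd m")
    case True
    then show ?thesis using z1 by (simp add: chi)
  next
    case False
    then show ?thesis using z1 geometric_sum[of z L] by (simp add: chi zL)
  qed
qed

text \<open>Orthogonality of characters whose frequencies are incongruent modulo \<open>L\<close>;
  the coefficients are vectors.\<close>

lemma chi_parseval:
  fixes w :: "'i \<Rightarrow> 'a::chilbert_space"
  assumes L: "0 < L" and I: "finite I"
    and m: "\<And>i j. i \<in> I \<Longrightarrow> j \<in> I \<Longrightarrow> int L dvd m i - m j \<Longrightarrow> i = j"
  shows "(\<Sum>l<L. (norm (\<Sum>i\<in>I. chi L l (m i) *\<^sub>C w i))\<^sup>2) = real L * (\<Sum>i\<in>I. (norm (w i))\<^sup>2)"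
proof -
  have "of_real (\<Sum>l<L. (norm (\<Sum>i\<in>I. chi L l (m i) *\<^sub>C w i))\<^sup>2)
      = (\<Sum>l<L. cinner (\<Sum>i\<in>I. chi L l (m i) *\<^sub>C w i) (\<Sum>i\<in>I. chi L l (m i) *\<^sub>C w i))"
    by (simp add: cinner_self)
  also have "\<dots> = (\<Sum>l<L. \<Sum>i\<in>I. \<Sum>j\<in>I. chi L l (m j - m i) * cinner (w i) (w j))"
    unfolding cinner_sum_left unfolding cinner_sum_right cinner_scaleC_left cinner_scaleC_right
    by (simp add: cnj_chi_mult[symmetric] mult_ac)
  also have "\<dots> = (\<Sum>i\<in>I. \<Sum>j\<in>I. (\<Sum>l<L. chi L l (m j - m i)) * cinner (w i) (w j))"
    by (subst sum.swap, rule sum.cong[OF refl], subst sum.swap) (simp add: sum_distrib_right)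
  also have "\<dots> = (\<Sum>i\<in>I. \<Sum>j\<in>I. if i = j then of_nat L * cinner (w i) (w i) else 0)"
    using m by (intro sum.cong refl) (auto simp: chi_sum[OF L])
  also have "\<dots> = (\<Sum>i\<in>I. of_nat L * cinner (w i) (w i))"
    using I by (intro sum.cong refl) (simp add: sum.delta')
  also have "\<dots> = of_real (real L * (\<Sum>i\<in>I. (norm (w i))\<^sup>2))"
    by (simp add: cinner_self sum_distrib_left)
  finally show ?thesis by (simp only: of_real_eq_iff)
qed

text \<open>The Fourier coefficient at \<open>m\<close> for normalised counting measure: the
  counterpart of \<open>fourier_coeff\<close> on the cyclic group.\<close>

definition dft :: "nat \<Rightarrow> (nat \<Rightarrow> ('a::chilbert_space \<Rightarrow>\<^sub>L 'a)) \<Rightarrow> int \<Rightarrow> ('a \<Rightarrow>\<^sub>L 'a)" where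
  "dft L Z m = (1 / real L) *\<^sub>R (\<Sum>l<L. op_scaleC (chi L l (- m)) (Z l))"

lemma clin_dft: "(\<And>l. clin (Z l)) \<Longrightarrow> clin (dft L Z m)"
  unfolding dft_def by (intro clin_scaleR clin_sum clin_op_scaleC)

lemma dft_apply: "blinfun_apply (dft L Z m) x = (1 / real L) *\<^sub>R (\<Sum>l<L. chi L l (- m) *\<^sub>C blinfun_apply (Z l) x)"
  by (simp add: dft_def blinfun.bilinear_simps blinfun.sum_left apply_op_scaleC)

lemma adj_dft: "(\<And>l. clin (Z l)) \<Longrightarrow> adj (dft L Z m) = dft L (\<lambda>l. adj (Z l)) (- m)"
  unfolding dft_def
  by (subst adj_scaleR) (auto simp: adj_sum adj_op_scaleC clin_op_scaleC chi_minus intro!: clin_sum)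

text \<open>Bessel's inequality for the vector-valued function \<open>l \<mapsto> Z l x\<close>:
  this function minus its partial Fourier sum \<open>S\<close> has nonnegative mean square.\<close>

lemma dft_bessel:
  assumes L: "0 < L" and I: "finite I"
    and m: "\<And>i j. i \<in> I \<Longrightarrow> j \<in> I \<Longrightarrow> int L dvd m i - m j \<Longrightarrow> i = j"
  shows "real L * (\<Sum>i\<in>I. (norm (blinfun_apply (dft L Z (m i)) x))\<^sup>2) \<le> (\<Sum>l<L. (norm (blinfun_apply (Z l) x))\<^sup>2)"
proof -
  define z where "z i = dft L Z (m i) x" for i
  define S where "S l = (\<Sum>i\<in>I. chi L l (m i) *\<^sub>C z i)" for l
  have z: "(\<Sum>l<L. chi L l (- m i) *\<^sub>C Z l x) = real L *\<^sub>R z i" for i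
    using L by (simp add: z_def dft_apply)
  have cross: "(\<Sum>l<L. Re (cinner (S l) (Z l x))) = real L * (\<Sum>i\<in>I. (norm (z i))\<^sup>2)"
  proof -
    have "(\<Sum>l<L. cinner (S l) (Z l x)) = (\<Sum>l<L. \<Sum>i\<in>I. cinner (z i) (chi L l (- m i) *\<^sub>C Z l x))"
      by (simp add: S_def cinner_sum_left cinner_simps chi_minus)
    also have "\<dots> = (\<Sum>i\<in>I. cinner (z i) (real L *\<^sub>R z i))"
      by (subst sum.swap) (simp only: cinner_sum_right[symmetric] z)
    also have "\<dots> = of_real (real L * (\<Sum>i\<in>I. (norm (z i))\<^sup>2))"
      by (simp add: cinner_simps cinner_self sum_distrib_left)
    finally show ?thesis
      by (simp only: Re_sum[symmetric] Re_complex_of_real)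
  qed
  have "0 \<le> (\<Sum>l<L. (norm (Z l x - S l))\<^sup>2)" by (intro sum_nonneg) simp
  also have "\<dots> = (\<Sum>l<L. (norm (Z l x))\<^sup>2) + (\<Sum>l<L. (norm (S l))\<^sup>2) - 2 * (\<Sum>l<L. Re (cinner (S l) (Z l x)))"
    by (simp add: norm_diff_sq Re_cinner_commute[of "Z _ x"] sum.distrib sum_subtractf sum_distrib_left)
  also have "(\<Sum>l<L. (norm (S l))\<^sup>2) = real L * (\<Sum>i\<in>I. (norm (z i))\<^sup>2)"
    unfolding S_def by (rule chi_parseval[OF L I m])
  finally show ?thesis using cross by (simp add: z_def)
qed


section \<open>Truncation\<close>

text \<open>With \<open>t\<close> half of \<open>adj Y (Y u)\<close>, the difference of
  \<open>(norm (u + t))^2\<close> and \<open>(norm (u - t))^2\<close> is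
  \<open>2 * (norm (Y u))^2\<close>. For a singular value \<sigma> this is
  \<open>2 * \<sigma>^2 <= (1 + \<sigma>^2 / 2)^2\<close>.\<close>

lemma truncation_bound:
  assumes Y: "clin Y" and x: "x = u + (1/2) *\<^sub>R adj Y (blinfun_apply Y u)"
  shows "2 * (norm (blinfun_apply Y u))\<^sup>2 \<le> (norm x)\<^sup>2"
proof -
  define t where "t = (1/2) *\<^sub>R adj Y (Y u)"
  have "2 * Re (cinner u t) = (norm (Y u))\<^sup>2"
    by (simp add: t_def cinner_simps cinner_adj_right Y Re_cinner_self cinner_self)
  then show ?thesis
    unfolding x t_def[symmetric] using norm_add_sq[of u t] norm_diff_sq[of u t] zero_le_power2[of "norm (u - t)"]
    by linarith
qed

text \<open>In terms of singular values, \<open>s\<close> is split into \<open>s / (1 + s\<^sup>2 / 2)\<close>, which is bounded, and a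
  remainder that is dominated by \<open>s\<^sup>2\<close>.\<close>

lemma truncation:
  fixes Y :: "'a::chilbert_space \<Rightarrow>\<^sub>L 'a"
  assumes Y: "clin Y"
  obtains B D where "clin B" "clin D" "Y = B + D" "\<And>x. norm (B x) \<le> norm x"
    "\<And>x. 8 * (norm (D x))\<^sup>2 \<le> (norm (adj Y (Y x)))\<^sup>2"
    "\<And>x. 8 * (norm (adj D x))\<^sup>2 \<le> (norm (Y (adj Y x)))\<^sup>2"
proof -
  have ex: "\<exists>U. clin U \<and> (\<forall>x. x = U x + (1/2) *\<^sub>R adj T (T (U x)))" if T: "clin T" for T :: "'a \<Rightarrow>\<^sub>L 'a"
  proof -
    have cl: "clin (adj T o\<^sub>L T)" by (intro clin_compose clin_adj T)
    have pos: "0 \<le> Re (cinner x ((adj T o\<^sub>L T) x))" for x by (simp add: norm_sq_adj T)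
    obtain R where R: "clin R" "\<And>z. (adj T o\<^sub>L T) (R z) + 2 *\<^sub>R R z = z"
      by (rule resolvent[OF cl pos, of 2]) (simp, rule that)
    \<comment> \<open>The resolvent at 2, doubled, is the inverse of
      \<open>1 + adj T o T / 2\<close>.\<close>
    have "x = (2 *\<^sub>R R) x + (1/2) *\<^sub>R adj T (T ((2 *\<^sub>R R) x))" for x
      using R(2)[of x] by (simp add: blinfun.bilinear_simps add.commute)
    then show ?thesis using R(1) by blast
  qed
  obtain U where U: "clin U" "\<And>x. x = U x + (1/2) *\<^sub>R adj Y (Y (U x))" using ex[OF Y] by blast
  obtain W where W: "clin W" "\<And>x. x = W x + (1/2) *\<^sub>R Y (adj Y (W x))"
    using ex[OF clin_adj[OF Y]] by (auto simp: adj_adj Y)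
  define B where "B = Y o\<^sub>L U"
  define D where "D = Y - B"
  have clB: "clin B" and clD: "clin D" unfolding B_def D_def by (auto intro!: Y U)
  \<comment> \<open>\<open>adj Y\<close> intertwines the inverses of
    \<open>1 + adj Y o Y / 2\<close> and \<open>1 + Y o adj Y / 2\<close>. Thus \<open>adj B\<close>
    arises from \<open>adj Y\<close> as \<open>B\<close> does from \<open>Y\<close>, and one
    estimate of the remainder serves both.\<close>
  have adjB: "adj B = adj Y o\<^sub>L W"
  proof (rule adj_eqI[OF clB])
    fix x y
    have "cinner (B x) y = cinner (Y (U x)) (W y + (1/2) *\<^sub>R Y (adj Y (W y)))"
      using W(2)[of y] by (simp add: B_def)
    also have "\<dots> = cinner (U x + (1/2) *\<^sub>R adj Y (Y (U x))) (adj Y (W y))"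
    proof -
      have "cinner (U x) (adj Y (W y)) = cinner (Y (U x)) (W y)" by (rule cinner_adj_right[OF Y])
      moreover have "cinner (adj Y (Y (U x))) (adj Y (W y)) = cinner (Y (U x)) (Y (adj Y (W y)))"
        by (rule cinner_adj_left[OF Y])
      ultimately show ?thesis by (simp add: cinner_simps)
    qed
    also have "\<dots> = cinner x ((adj Y o\<^sub>L W) y)" using U(2)[of x] by simp
    finally show "cinner (B x) y = cinner x ((adj Y o\<^sub>L W) y)" .
  qed
  \<comment> \<open>\<open>t\<close> solves the equation for \<open>u\<close> with
    \<open>adj T (T x)\<close> in place of \<open>x\<close>, so \<open>truncation_bound\<close>
    applies to it; as the remainder is half of \<open>T t\<close>, the factor 2 there becomes
    8.\<close>
  have rem: "8 * (norm (T x - T u))\<^sup>2 \<le> (norm (adj T (T x)))\<^sup>2"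
    if T: "clin T" and x: "x = u + (1/2) *\<^sub>R adj T (T u)" for T :: "'a \<Rightarrow>\<^sub>L 'a" and x u
  proof -
    define t where "t = adj T (T u)"
    have "adj T (T x) = t + (1/2) *\<^sub>R adj T (T t)"
      by (subst x) (simp add: t_def blinfun.bilinear_simps)
    then have "2 * (norm (T t))\<^sup>2 \<le> (norm (adj T (T x)))\<^sup>2" by (rule truncation_bound[OF T])
    moreover have "T x - T u = (1/2) *\<^sub>R T t"
      by (subst x) (simp add: t_def blinfun.bilinear_simps)
    ultimately show ?thesis by (simp add: power_divide)
  qed
  show ?thesis
  proof (rule that[OF clB clD])
    show "Y = B + D" by (simp add: D_def)
    show "norm (B x) \<le> norm x" for x
    proof -
      have "(norm (B x))\<^sup>2 \<le> 2 * (norm (Y (U x)))\<^sup>2" by (simp add: B_def)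
      also have "\<dots> \<le> (norm x)\<^sup>2" by (rule truncation_bound[OF Y U(2)])
      finally show ?thesis by (rule power2_le_imp_le) simp
    qed
    show "8 * (norm (D x))\<^sup>2 \<le> (norm (adj Y (Y x)))\<^sup>2" for x
      using rem[OF Y U(2)[of x]] by (simp add: D_def B_def blinfun.bilinear_simps)
    show "8 * (norm (adj D x))\<^sup>2 \<le> (norm (Y (adj Y x)))\<^sup>2" for x
    proof -
      have "x = W x + (1/2) *\<^sub>R adj (adj Y) (adj Y (W x))" using W(2)[of x] by (simp add: adj_adj Y)
      from rem[OF clin_adj[OF Y] this] show ?thesis
        by (simp add: D_def adj_diff Y clB adjB blinfun.bilinear_simps adj_adj)
    qed
  qed
qed


section \<open>The fourth moment\<close>

text \<open>The unit ball for the larger of the operator norms of the column \<open>(v j)\<close>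
  and of the column of adjoints. In the trace pairing it is the natural dual of the splittings in
  \<open>triple_norm\<close>.\<close>

definition admissible :: "nat set \<Rightarrow> (nat \<Rightarrow> ('a::chilbert_space \<Rightarrow>\<^sub>L 'a)) \<Rightarrow> bool" where
  "admissible J v \<longleftrightarrow> (\<forall>j. clin (v j)) \<and> (\<forall>x. (\<Sum>j\<in>J. (norm (blinfun_apply (v j) x))\<^sup>2) \<le> (norm x)\<^sup>2) \<and>
     (\<forall>x. (\<Sum>j\<in>J. (norm (blinfun_apply (adj (v j)) x))\<^sup>2) \<le> (norm x)\<^sup>2)"

lemma admissible_adj: "admissible J v \<Longrightarrow> admissible J (\<lambda>j. adj (v j))"
  by (auto simp: admissible_def adj_adj clin_adj)

text \<open>In \<open>adj (Y l) o Y l\<close> all diagonal terms share the frequency 0, while the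
  frequency of an off-diagonal pair belongs to that pair alone. By Parseval the mean square splits
  into the squared norm of the diagonal sum and those of the off-diagonal terms; each of the two
  parts is at most \<open>(norm x)^2\<close>, whence the 2.\<close>

lemma fourth_moment:
  fixes v :: "nat \<Rightarrow> ('a::chilbert_space \<Rightarrow>\<^sub>L 'a)"
  assumes L: "0 < L" and J: "finite J" and v: "admissible J v"
    and \<kappa>: "\<And>i j i' j'. i \<in> J \<Longrightarrow> j \<in> J \<Longrightarrow> i' \<in> J \<Longrightarrow> j' \<in> J \<Longrightarrow> i \<noteq> j \<Longrightarrow>
      int L dvd (\<kappa> j - \<kappa> i) - (\<kappa> j' - \<kappa> i') \<Longrightarrow> i = i' \<and> j = j'"
    and Y: "\<And>l. Y l = (\<Sum>j\<in>J. op_scaleC (chi L l (\<kappa> j)) (v j))"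
  shows "(\<Sum>l<L. (norm (adj (Y l) (blinfun_apply (Y l) x)))\<^sup>2) \<le> 2 * real L * (norm x)\<^sup>2"
proof (cases "J = {}")
  case True
  then show ?thesis by (simp add: Y blinfun.zero_right)
next
  case False
  then obtain a where a: "a \<in> J" by blast
  have cl: "clin (v j)" for j using v by (simp add: admissible_def)
  have v1: "(\<Sum>j\<in>J. (norm (v j x))\<^sup>2) \<le> (norm x)\<^sup>2" for x using v by (simp add: admissible_def)
  have v2: "(\<Sum>j\<in>J. (norm (adj (v j) x))\<^sup>2) \<le> (norm x)\<^sup>2" for x using v by (simp add: admissible_def)
  define N where "N = {p \<in> J \<times> J. fst p \<noteq> snd p}"
  \<comment> \<open>The pair \<open>(a, a)\<close> stands for all diagonal pairs and carries their
    sum \<open>d\<close>.\<close>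
  define I where "I = insert (a, a) N"
  define d where "d = (\<Sum>i\<in>J. adj (v i) (v i x))"
  define w where "w p = (if fst p = snd p then d else adj (v (fst p)) (v (snd p) x))" for p
  define m where "m p = \<kappa> (snd p) - \<kappa> (fst p)" for p
  have finN: "finite N" and aN: "(a, a) \<notin> N" unfolding N_def using J by auto
  have Yx: "adj (Y l) (Y l x) = (\<Sum>p\<in>I. chi L l (m p) *\<^sub>C w p)" for l
  proof -
    define t where "t p = chi L l (m p) *\<^sub>C adj (v (fst p)) (v (snd p) x)" for p
    have adjY: "adj (Y l) z = (\<Sum>i\<in>J. cnj (chi L l (\<kappa> i)) *\<^sub>C adj (v i) z)" for z
      unfolding Y by (simp add: adj_sum cl clin_op_scaleC adj_op_scaleC blinfun.sum_left apply_op_scaleC)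
    have Yx: "Y l x = (\<Sum>j\<in>J. chi L l (\<kappa> j) *\<^sub>C v j x)"
      unfolding Y by (simp add: blinfun.sum_left apply_op_scaleC)
    have "adj (Y l) (Y l x) = (\<Sum>i\<in>J. \<Sum>j\<in>J. t (i, j))"
      unfolding adjY unfolding Yx t_def m_def
      by (simp add: blinfun.sum_right clinD[OF clin_adj[OF cl]] scaleC_sum_right scaleC_scaleC cnj_chi_mult)
    also have "\<dots> = (\<Sum>p\<in>J \<times> J. t p)" by (simp add: sum.cartesian_product)
    also have "\<dots> = (\<Sum>p\<in>N. t p) + (\<Sum>p\<in>(J \<times> J) - N. t p)"
      using J by (subst sum.subset_diff[of N]) (auto simp: N_def)
    also have "(\<Sum>p\<in>(J \<times> J) - N. t p) = (\<Sum>i\<in>J. t (i, i))"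
      by (rule sum.reindex_bij_witness[of _ "\<lambda>i. (i, i)" fst]) (auto simp: N_def)
    also have "\<dots> = chi L l (m (a, a)) *\<^sub>C w (a, a)"
      by (simp add: t_def m_def w_def d_def chi_def)
    also have "(\<Sum>p\<in>N. t p) = (\<Sum>p\<in>N. chi L l (m p) *\<^sub>C w p)"
      by (intro sum.cong refl) (auto simp: N_def t_def w_def)
    finally show ?thesis unfolding I_def using finN aN by (simp add: add.commute)
  qed
  have "(\<Sum>l<L. (norm (adj (Y l) (Y l x)))\<^sup>2) = real L * (\<Sum>p\<in>I. (norm (w p))\<^sup>2)"
    unfolding Yx
  proof (rule chi_parseval[OF L])
    show "finite I" using finN by (simp add: I_def)
    fix p q assume pq: "p \<in> I" "q \<in> I" and dvd: "int L dvd m p - m q"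
    \<comment> \<open>The hypothesis \<open>\<kappa>\<close> wants its first pair off the diagonal;
      with the roles exchanged it also covers the case that \<open>q\<close> is off the
      diagonal.\<close>
    have dvd': "int L dvd m q - m p" using dvd by (metis dvd_minus_iff minus_diff_eq)
    have in_J: "fst p \<in> J" "snd p \<in> J" "fst q \<in> J" "snd q \<in> J"
      using pq a by (auto simp: I_def N_def)
    consider "fst p \<noteq> snd p" | "fst q \<noteq> snd q" | "p = (a, a)" "q = (a, a)"
      using pq by (auto simp: I_def N_def)
    then show "p = q"
    proof cases
      case 1
      then show ?thesis using \<kappa>[OF in_J] dvd by (auto simp: m_def prod_eq_iff)
    next
      case 2
      then show ?thesis using \<kappa>[OF in_J(3,4,1,2)] dvd' by (auto simp: m_def prod_eq_iff)
    qed simp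
  qed
  also have "(\<Sum>p\<in>I. (norm (w p))\<^sup>2) = (norm d)\<^sup>2 + (\<Sum>p\<in>N. (norm (adj (v (fst p)) (v (snd p) x)))\<^sup>2)"
    unfolding I_def using finN aN by (auto simp: w_def N_def intro!: sum.cong)
  also have "\<dots> \<le> (norm x)\<^sup>2 + (norm x)\<^sup>2"
  proof (rule add_mono)
    have "norm (\<Sum>i\<in>J. adj (v i) o\<^sub>L v i) \<le> 1" by (rule gram_norm_le) (use cl v1 in auto)
    then have "norm ((\<Sum>i\<in>J. adj (v i) o\<^sub>L v i) x) \<le> 1 * norm x"
      by (intro order_trans[OF norm_blinfun] mult_right_mono) auto
    then show "(norm d)\<^sup>2 \<le> (norm x)\<^sup>2"
      by (intro power_mono) (simp_all add: d_def blinfun.sum_left)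
    have "(\<Sum>p\<in>N. (norm (adj (v (fst p)) (v (snd p) x)))\<^sup>2)
        \<le> (\<Sum>p\<in>J \<times> J. (norm (adj (v (fst p)) (v (snd p) x)))\<^sup>2)"
      using J by (intro sum_mono2) (auto simp: N_def)
    also have "\<dots> = (\<Sum>j\<in>J. \<Sum>i\<in>J. (norm (adj (v i) (v j x)))\<^sup>2)"
      by (subst sum.swap) (simp add: sum.cartesian_product case_prod_beta)
    also have "\<dots> \<le> (\<Sum>j\<in>J. (norm (v j x))\<^sup>2)" by (intro sum_mono v2)
    also have "\<dots> \<le> (norm x)\<^sup>2" by (rule v1)
    finally show "(\<Sum>p\<in>N. (norm (adj (v (fst p)) (v (snd p) x)))\<^sup>2) \<le> (norm x)\<^sup>2" .
  qed
  finally show ?thesis using L by (simp add: mult_left_mono)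
qed


section \<open>Strongly lacunary sequences\<close>

lemma lacunary_strict_mono: "strongly_lacunary_seq k \<Longrightarrow> strict_mono k"
proof (rule strict_mono_Suc_iff[THEN iffD2], intro allI)
  fix n assume "strongly_lacunary_seq k"
  then have "2 * k n < k (Suc n)" by (simp add: strongly_lacunary_seq_def)
  then show "k n < k (Suc n)" by simp
qed

text \<open>The larger indices of the two sides must agree: if \<open>b <= a < c\<close>, then
  \<open>k a + k b <= 2 * k a < k c\<close>. Cancelling them leaves equality of the smaller
  ones.\<close>

lemma lacunary_sum_unique:
  assumes k: "strongly_lacunary_seq k" and eq: "k a + k b = k c + k d"
  shows "(a = c \<and> b = d) \<or> (a = d \<and> b = c)"
proof -
  note sm = lacunary_strict_mono[OF k]
  have inj: "k i = k j \<longleftrightarrow> i = j" for i j using strict_mono_eq[OF sm] .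
  have mono: "k i \<le> k j" if "i \<le> j" for i j using sm that by (simp add: strict_mono_less_eq)
  have gap: "2 * k i < k j" if "i < j" for i j
    using k mono[of "Suc i" j] that unfolding strongly_lacunary_seq_def by (meson Suc_leI less_le_trans)
  have *: "a = c" if "k a + k b = k c + k d" "b \<le> a" "d \<le> c" for a b c d
  proof (rule ccontr)
    assume "a \<noteq> c"
    then consider "a < c" | "c < a" by linarith
    then show False
    proof cases
      case 1 then show False using gap[OF 1] mono[OF that(2)] that(1) by linarith
    next
      case 2 then show False using gap[OF 2] mono[OF that(3)] that(1) by linarith
    qed
  qed
  consider "b \<le> a" "d \<le> c" | "b \<le> a" "c \<le> d" | "a \<le> b" "d \<le> c" | "a \<le> b" "c \<le> d" by linarith
  then show ?thesis
  proof cases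
    case 1 then show ?thesis using *[of a b c d] eq inj by auto
  next
    case 2 then show ?thesis using *[of a b d c] eq inj by auto
  next
    case 3 then show ?thesis using *[of b a c d] eq inj by auto
  next
    case 4 then show ?thesis using *[of b a d c] eq inj by auto
  qed
qed

section \<open>The dual inequality\<close>

text \<open>The left side is the mean of the trace pairing of \<open>f\<close> with a trigonometric
  polynomial \<open>Q\<close> whose values are contractions, seen on the family \<open>e\<close>.
  Since \<open>e\<close> and its image under \<open>Q\<close> are Bessel families,
  \<open>nuc (f t)\<close> bounds the integrand.\<close>

lemma fourier_pairing:
  fixes f :: "real \<Rightarrow> ('a::chilbert_space \<Rightarrow>\<^sub>L 'a)" and q :: "'i \<Rightarrow> ('a \<Rightarrow>\<^sub>L 'a)" and n :: "'i \<Rightarrow> int"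
  assumes f: "f \<in> L1_S1" and F: "L1_norm f = ennreal F" "0 \<le> F"
    and q: "\<And>i. i \<in> I \<Longrightarrow> clin (q i)" and e: "bessel d e"
    and bound: "\<And>t x. norm (\<Sum>i\<in>I. exp (\<i> * of_int (n i) * of_real t) *\<^sub>C blinfun_apply (q i) x) \<le> norm x"
  shows "(\<Sum>i\<in>I. Re (\<Sum>l<d. cinner (q i (e l)) (fourier_coeff f (n i) (e l)))) \<le> F"
proof -
  define h where "h t = (\<Sum>i\<in>I. \<Sum>l<d. exp (- \<i> * of_int (n i) * of_real t) * cinner (q i (e l)) (f t (e l)))" for t
  define S where "S = (\<Sum>i\<in>I. \<Sum>l<d. cinner (q i (e l)) (fourier_coeff f (n i) (e l)))"
  have "has_bochner_integral circle h
      (\<Sum>i\<in>I. \<Sum>l<d. of_real (2 * pi) * cinner (q i (e l)) (fourier_coeff f (n i) (e l)))"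
    unfolding h_def by (intro has_bochner_integral_sum fourier_coeff_cinner f)
  then have "has_bochner_integral circle h (of_real (2 * pi) * S)"
    by (simp add: S_def sum_distrib_left)
  then have "has_bochner_integral circle (\<lambda>t. Re (h t)) (Re (of_real (2 * pi) * S))"
    by (rule has_bochner_integral_bounded_linear[OF bounded_linear_Re])
  then have int: "integral\<^sup>L circle (\<lambda>t. Re (h t)) = 2 * pi * Re S"
    by (simp add: has_bochner_integral_integral_eq)
  have "ennreal (Re (h t)) \<le> nuc (f t)" for t
  proof -
    define Q where "Q = (\<Sum>i\<in>I. op_scaleC (exp (\<i> * of_int (n i) * of_real t)) (q i))"
    have Q: "Q x = (\<Sum>i\<in>I. exp (\<i> * of_int (n i) * of_real t) *\<^sub>C q i x)" for x
      by (simp add: Q_def blinfun.sum_left apply_op_scaleC)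
    have clQ: "clin Q" unfolding Q_def using q by (intro clin_sum clin_op_scaleC)
    have Qn: "norm (Q x) \<le> norm x" for x unfolding Q by (rule bound)
    have "cinner (Q x) y = (\<Sum>i\<in>I. exp (- \<i> * of_int (n i) * of_real t) * cinner (q i x) y)" for x y
      unfolding Q cinner_sum_left cinner_scaleC_left by (simp add: exp_cnj)
    then have "h t = (\<Sum>l<d. cinner (Q (e l)) (f t (e l)))"
      unfolding h_def by (simp add: sum.swap[of _ "{..<d}"])
    then show ?thesis using nuc_ge[OF e bessel_map'[OF clQ Qn e]] by simp
  qed
  then have "(\<integral>\<^sup>+t. ennreal (Re (h t)) \<partial>circle) \<le> (\<integral>\<^sup>+t. nuc (f t) \<partial>circle)"
    by (intro nn_integral_mono)
  also have "\<dots> = ennreal (2 * pi) * (ennreal (1 / (2 * pi)) * (\<integral>\<^sup>+t. nuc (f t) \<partial>circle))"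
    by (simp add: mult.assoc[symmetric] ennreal_mult[symmetric])
  also have "\<dots> = ennreal (2 * pi * F)"
    using F L1_norm_eq[OF f] by (simp add: ennreal_mult)
  finally have "integral\<^sup>L circle (\<lambda>t. Re (h t)) \<le> 2 * pi * F"
    using F(2) by (intro integral_real_bounded) simp_all
  then have "Re S \<le> F" by (simp add: int)
  then show ?thesis by (simp add: S_def)
qed

lemma dvd_small_zero: "int L dvd x \<Longrightarrow> \<bar>x\<bar> < int L \<Longrightarrow> x = 0"
  using dvd_imp_le_int[of x "int L"] by auto

text \<open>Summing over pairs counts a frequency \<open>n\<close> with multiplicity
  \<open>M - \<bar>n\<bar>\<close>, the Fejer weight. The sum is therefore an average of the
  \<open>B l x\<close> with nonnegative weights, and \<open>M <= L\<close> makes these weights add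
  up to 1.\<close>

lemma fejer_contraction:
  fixes B :: "nat \<Rightarrow> ('a::chilbert_space \<Rightarrow>\<^sub>L 'a)"
  assumes M: "0 < M" "M \<le> L" and B: "\<And>l x. norm (blinfun_apply (B l) x) \<le> norm x"
  shows "norm (\<Sum>p\<in>{..<M} \<times> {..<M}. exp (\<i> * of_int (int (fst p) - int (snd p)) * of_real t) *\<^sub>C
      blinfun_apply ((1 / real M) *\<^sub>R dft L B (int (fst p) - int (snd p))) x) \<le> norm x"
proof (cases "x = 0")
  case False
  have L: "0 < L" using M by simp
  define u where "u l a = exp (\<i> * of_nat a * of_real t) * chi L l (- int a)" for l a
  define s where "s l = (\<Sum>a<M. u l a)" for l
  \<comment> \<open>Written over pairs, the kernel is visibly \<open>s l * cnj (s l)\<close>, hence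
    nonnegative.\<close>
  have ker: "(\<Sum>p\<in>{..<M} \<times> {..<M}. exp (\<i> * of_int (int (fst p) - int (snd p)) * of_real t) *
      chi L l (- (int (fst p) - int (snd p)))) = of_real ((cmod (s l))\<^sup>2)" for l
  proof -
    have "exp (\<i> * of_int (int a - int b) * of_real t) * chi L l (- (int a - int b)) = u l a * cnj (u l b)" for a b
    proof -
      have "exp (\<i> * of_int (int a - int b) * of_real t) = exp (\<i> * of_nat a * of_real t) * cnj (exp (\<i> * of_nat b * of_real t))"
        by (simp add: exp_cnj exp_add[symmetric] algebra_simps)
      moreover have "chi L l (- (int a - int b)) = chi L l (- int a) * cnj (chi L l (- int b))"
        using chi_add[of L l "- int a" "int b"] by (simp add: chi_minus)
      ultimately show ?thesis by (simp add: u_def mult_ac)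
    qed
    then have "(\<Sum>p\<in>{..<M} \<times> {..<M}. exp (\<i> * of_int (int (fst p) - int (snd p)) * of_real t) *
        chi L l (- (int (fst p) - int (snd p)))) = (\<Sum>a<M. \<Sum>b<M. u l a * cnj (u l b))"
      by (simp add: sum.cartesian_product case_prod_beta)
    also have "\<dots> = s l * cnj (s l)" by (simp add: s_def sum_product)
    finally show ?thesis by (simp only: complex_norm_square)
  qed
  have par: "(\<Sum>l<L. (cmod (s l))\<^sup>2) = real L * real M"
  proof -
    have "(\<Sum>l<L. (norm (\<Sum>a\<in>{..<M}. chi L l (- int a) *\<^sub>C (exp (\<i> * of_nat a * of_real t) *\<^sub>C x)))\<^sup>2)
        = real L * (\<Sum>a\<in>{..<M}. (norm (exp (\<i> * of_nat a * of_real t) *\<^sub>C x))\<^sup>2)"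
    proof (rule chi_parseval[OF L])
      fix a b assume "a \<in> {..<M}" "b \<in> {..<M}" "int L dvd - int a - - int b"
      then show "a = b" using M(2) dvd_small_zero[of L "- int a - - int b"] by fastforce
    qed simp
    moreover have "(\<Sum>a\<in>{..<M}. chi L l (- int a) *\<^sub>C (exp (\<i> * of_nat a * of_real t) *\<^sub>C x)) = s l *\<^sub>C x" for l
      by (simp add: s_def u_def scaleC_sum_left scaleC_scaleC mult.commute)
    ultimately have "(\<Sum>l<L. (cmod (s l))\<^sup>2) * (norm x)\<^sup>2 = real L * real M * (norm x)\<^sup>2"
      by (simp add: norm_scaleC norm_exp_eq_Re power_mult_distrib sum_distrib_right)
    then show ?thesis using False by simp
  qed
  have "(\<Sum>p\<in>{..<M} \<times> {..<M}. exp (\<i> * of_int (int (fst p) - int (snd p)) * of_real t) *\<^sub>C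
      blinfun_apply ((1 / real M) *\<^sub>R dft L B (int (fst p) - int (snd p))) x)
      = (1 / (real M * real L)) *\<^sub>R (\<Sum>p\<in>{..<M} \<times> {..<M}. \<Sum>l<L.
        (exp (\<i> * of_int (int (fst p) - int (snd p)) * of_real t) * chi L l (- (int (fst p) - int (snd p)))) *\<^sub>C B l x)"
    by (simp add: blinfun.bilinear_simps dft_apply scaleC_scaleR scaleC_sum_right scaleC_scaleC scaleR_sum_right
        del: of_int_diff)
  also have "\<dots> = (1 / (real M * real L)) *\<^sub>R (\<Sum>l<L. of_real ((cmod (s l))\<^sup>2) *\<^sub>C B l x)"
    by (subst sum.swap) (simp only: scaleC_sum_left[symmetric] ker)
  also have "norm \<dots> \<le> (1 / (real M * real L)) * (\<Sum>l<L. (cmod (s l))\<^sup>2 * norm x)"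
    unfolding norm_scaleR
    by (intro mult_mono order_trans[OF norm_sum] sum_mono)
       (auto simp: norm_scaleC norm_power intro!: mult_left_mono B sum_nonneg)
  also have "\<dots> = norm x" using M L by (simp add: sum_distrib_right[symmetric] par)
  finally show ?thesis .
qed (simp add: blinfun.zero_right)

text \<open>A frequency \<open>k j\<close> below \<open>M\<close> is a difference of two numbers
  below \<open>M\<close> in exactly \<open>M - k j\<close> ways, and at all other frequencies
  \<open>g\<close> vanishes.\<close>

lemma fejer_count:
  fixes g :: "int \<Rightarrow> real"
  assumes k: "strongly_lacunary_seq k" and g: "\<And>n. n \<notin> range (\<lambda>j. int (k j)) \<Longrightarrow> g n = 0"
    and J: "J = {j. k j < M}"
  shows "(\<Sum>p\<in>{..<M} \<times> {..<M}. g (int (fst p) - int (snd p))) = (\<Sum>j\<in>J. (real M - real (k j)) * g (int (k j)))"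
proof -
  have inj: "k i = k j \<longleftrightarrow> i = j" for i j using strict_mono_eq[OF lacunary_strict_mono[OF k]] .
  have finJ: "finite J"
    unfolding J by (rule finite_subset[of _ "{..<M}"])
      (use strict_mono_imp_increasing[OF lacunary_strict_mono[OF k]] le_less_trans in auto)
  have row: "(\<Sum>a<M. g (int a - int b)) = (\<Sum>j\<in>{j\<in>J. b + k j < M}. g (int (k j)))" for b
  proof -
    let ?A = "(\<lambda>j. b + k j) ` {j\<in>J. b + k j < M}"
    have "(\<Sum>a<M. g (int a - int b)) = (\<Sum>a\<in>?A. g (int a - int b))"
    proof (rule sum.mono_neutral_right)
      show "\<forall>a\<in>{..<M} - ?A. g (int a - int b) = 0"
      proof
        fix a assume a: "a \<in> {..<M} - ?A"
        have "int a - int b \<notin> range (\<lambda>j. int (k j))"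
        proof
          assume "int a - int b \<in> range (\<lambda>j. int (k j))"
          then obtain j where "int a - int b = int (k j)" by auto
          then have "a = b + k j" by linarith
          then show False using a by (auto simp: J)
        qed
        then show "g (int a - int b) = 0" by (rule g)
      qed
    qed auto
    also have "\<dots> = (\<Sum>j\<in>{j\<in>J. b + k j < M}. g (int (k j)))"
      by (subst sum.reindex) (auto simp: inj_on_def inj)
    finally show ?thesis .
  qed
  have "(\<Sum>p\<in>{..<M} \<times> {..<M}. g (int (fst p) - int (snd p))) = (\<Sum>b<M. \<Sum>a<M. g (int a - int b))"
    by (subst sum.swap) (simp add: sum.cartesian_product case_prod_beta)
  also have "\<dots> = (\<Sum>b<M. \<Sum>j\<in>J. if b + k j < M then g (int (k j)) else 0)"
    unfolding row using finJ by (intro sum.cong refl sum.inter_filter) 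
  also have "\<dots> = (\<Sum>j\<in>J. \<Sum>b<M. if b + k j < M then g (int (k j)) else 0)" by (rule sum.swap)
  also have "\<dots> = (\<Sum>j\<in>J. (real M - real (k j)) * g (int (k j)))"
  proof (rule sum.cong[OF refl])
    fix j assume "j \<in> J"
    then have j: "k j < M" by (simp add: J)
    have "(\<Sum>b<M. if b + k j < M then g (int (k j)) else 0) = (\<Sum>b\<in>{..<M - k j}. g (int (k j)))"
      by (rule sum.mono_neutral_cong_right) auto
    then show "(\<Sum>b<M. if b + k j < M then g (int (k j)) else 0) = (real M - real (k j)) * g (int (k j))"
      using j by (simp add: of_nat_diff)
  qed
  finally show ?thesis .
qed

text \<open>The weights come from extending the bounded part from the cyclic group to the circle as
  a contraction. Absorption compares one and the same functional \<open>\<psi>\<close> on both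
  sides, so the weights are kept for the remainder too and removed only in
  \<open>dual_inequality\<close>.\<close>

lemma dual_inequality_fejer:
  fixes f :: "real \<Rightarrow> ('a::chilbert_space \<Rightarrow>\<^sub>L 'a)"
  assumes k: "strongly_lacunary_seq k" and f: "f \<in> L1_S1" and F: "L1_norm f = ennreal F" "0 \<le> F"
    and van: "\<And>n. n \<notin> range (\<lambda>j. int (k j)) \<Longrightarrow> fourier_coeff f n = 0"
    and e: "bessel d e" and M: "0 < M" and J: "J = {j. k j < M}" and v: "admissible J v"
  shows "(\<Sum>j\<in>J. (real M - real (k j)) / real M *
      Re (\<Sum>l<d. cinner (v j (e l)) (fourier_coeff f (int (k j)) (e l)))) \<le> 2 * F"
proof -
  define \<beta> where "\<beta> A n = Re (\<Sum>l<d. cinner (blinfun_apply A (e l)) (fourier_coeff f n (e l)))" for A n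
  define \<mu> where "\<mu> j = (real M - real (k j)) / real M" for j
  define \<psi> where "\<psi> v = (\<Sum>j\<in>J. \<mu> j * \<beta> (v j) (int (k j)))" for v
  have \<mu>: "0 \<le> \<mu> j" "\<mu> j \<le> 1" if "j \<in> J" for j
    using that M by (auto simp: \<mu>_def J divide_le_eq)
  have inj: "k i = k j \<longleftrightarrow> i = j" for i j using strict_mono_eq[OF lacunary_strict_mono[OF k]] .
  have finJ: "finite J"
    unfolding J by (rule finite_subset[of _ "{..<M}"])
      (use strict_mono_imp_increasing[OF lacunary_strict_mono[OF k]] le_less_trans in auto)
  \<comment> \<open>All \<open>k j\<close> with \<open>j \<in> J\<close> lie between 0 and
    \<open>M - 1\<close>, so a difference of two differences is smaller than \<open>2 * M\<close> in
    absolute value: congruence modulo \<open>L\<close> is equality.\<close>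
  define L where "L = 2 * M"
  have L: "0 < L" "M \<le> L" using M by (auto simp: L_def)
  have kM: "k j < M" if "j \<in> J" for j using that by (simp add: J)
  have inc: "i = j" if "i \<in> J" "j \<in> J" "int L dvd int (k i) - int (k j)" for i j
    using dvd_small_zero[OF that(3)] kM[OF that(1)] kM[OF that(2)] inj by (auto simp: L_def)
  have inc': "i = j" if "i \<in> J" "j \<in> J" "int L dvd - int (k i) - - int (k j)" for i j
    using inc[OF that(2,1)] that(3) by simp
  have quad: "i = i' \<and> j = j'"
    if "i \<in> J" "j \<in> J" "i' \<in> J" "j' \<in> J" "i \<noteq> j" "int (k j) - int (k i) - (int (k j') - int (k i')) = 0"
    for i j i' j'
  proof -
    have "k j + k i' = k i + k j'" using that(6) by linarith
    from lacunary_sum_unique[OF k this] show ?thesis using that(5) by auto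
  qed
  have quad1: "i = i' \<and> j = j'"
    if "i \<in> J" "j \<in> J" "i' \<in> J" "j' \<in> J" "i \<noteq> j" "int L dvd int (k j) - int (k i) - (int (k j') - int (k i'))"
    for i j i' j'
    using quad[OF that(1-5) dvd_small_zero[OF that(6)]] kM[OF that(1)] kM[OF that(2)] kM[OF that(3)] kM[OF that(4)]
    by (simp add: L_def)
  \<comment> \<open>The negated frequencies are those of \<open>adj (Y l)\<close>.\<close>
  have quad2: "i = i' \<and> j = j'"
    if "i \<in> J" "j \<in> J" "i' \<in> J" "j' \<in> J" "i \<noteq> j" "int L dvd - int (k j) - - int (k i) - (- int (k j') - - int (k i'))"
    for i j i' j'
  proof -
    have "int L dvd - (int (k j) - int (k i) - (int (k j') - int (k i')))" using that(6) by (simp add: algebra_simps)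
    then show ?thesis using quad1[OF that(1-5)] by (simp only: dvd_minus_iff)
  qed
  have \<beta>_add: "\<beta> (A + B) n = \<beta> A n + \<beta> B n" for A B n
    by (simp add: \<beta>_def blinfun.bilinear_simps cinner_simps sum.distrib)
  have \<beta>_scale: "\<beta> (r *\<^sub>R A) n = r * \<beta> A n" for r A n
    by (simp add: \<beta>_def blinfun.bilinear_simps cinner_simps sum_distrib_left[symmetric])
  have fejer: "\<psi> (\<lambda>j. dft L B (int (k j))) \<le> F"
    if clB: "\<And>l. clin (B l)" and B: "\<And>l x. norm (B l x) \<le> norm x" for B :: "nat \<Rightarrow> ('a \<Rightarrow>\<^sub>L 'a)"
  proof -
    define g where "g n = \<beta> (dft L B n) n" for n
    have "(\<Sum>p\<in>{..<M} \<times> {..<M}. Re (\<Sum>l<d. cinner (((1 / real M) *\<^sub>R dft L B (int (fst p) - int (snd p))) (e l))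
        (fourier_coeff f (int (fst p) - int (snd p)) (e l)))) \<le> F"
      by (intro fourier_pairing[OF f F _ e] clin_scaleR clin_dft clB fejer_contraction M L B)
    then have "(\<Sum>p\<in>{..<M} \<times> {..<M}. \<beta> ((1 / real M) *\<^sub>R dft L B (int (fst p) - int (snd p))) (int (fst p) - int (snd p))) \<le> F"
      by (simp only: \<beta>_def)
    then have "(1 / real M) * (\<Sum>p\<in>{..<M} \<times> {..<M}. g (int (fst p) - int (snd p))) \<le> F"
      unfolding \<beta>_scale g_def by (simp add: sum_distrib_left)
    \<comment> \<open>Here the vanishing of \<open>fourier_coeff f\<close> outside the range of
      \<open>k\<close> enters: the coefficients of \<open>B\<close> at all other frequencies, about
      which nothing is known, drop out.\<close>
    also have "(\<Sum>p\<in>{..<M} \<times> {..<M}. g (int (fst p) - int (snd p))) = (\<Sum>j\<in>J. (real M - real (k j)) * g (int (k j)))"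
      by (rule fejer_count[OF k _ J]) (simp add: g_def \<beta>_def van)
    finally show ?thesis by (simp add: \<psi>_def \<mu>_def g_def sum_distrib_left)
  qed
  \<comment> \<open>A crude bound that makes the supremum \<open>s\<close> finite; otherwise
    \<open>s / 2\<close> could not be absorbed.\<close>
  have bdd: "\<psi> v \<le> (\<Sum>j\<in>J. \<Sum>l<d. norm (e l) * norm (fourier_coeff f (int (k j)) (e l)))"
    if v: "admissible J v" for v
    unfolding \<psi>_def
  proof (rule sum_mono)
    fix j assume j: "j \<in> J"
    have vn: "norm (v j x) \<le> norm x" for x
    proof -
      have "(norm (v j x))\<^sup>2 \<le> (\<Sum>j\<in>J. (norm (v j x))\<^sup>2)" using finJ j by (intro member_le_sum) auto
      also have "\<dots> \<le> (norm x)\<^sup>2" using v by (simp add: admissible_def)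
      finally show ?thesis by (rule power2_le_imp_le) simp
    qed
    have "\<beta> (v j) (int (k j)) \<le> (\<Sum>l<d. norm (e l) * norm (fourier_coeff f (int (k j)) (e l)))"
      unfolding \<beta>_def Re_sum
      by (intro sum_mono order_trans[OF Re_cinner_le] mult_right_mono vn norm_ge_zero)
    moreover have "0 \<le> (\<Sum>l<d. norm (e l) * norm (fourier_coeff f (int (k j)) (e l)))" by (intro sum_nonneg) simp
    ultimately show "\<mu> j * \<beta> (v j) (int (k j)) \<le> (\<Sum>l<d. norm (e l) * norm (fourier_coeff f (int (k j)) (e l)))"
      using \<mu>[OF j] by (meson mult_left_le_one_le mult_left_mono order_trans)
  qed
  define s where "s = (SUP v\<in>Collect (admissible J). \<psi> v)"
  have upper: "\<psi> v \<le> s" if "admissible J v" for v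
    unfolding s_def using that bdd by (intro cSUP_upper bdd_aboveI2) auto
  have step: "\<psi> v \<le> F + s / 2" if v: "admissible J v" for v
  proof -
    have clv: "clin (v j)" for j using v by (simp add: admissible_def)
    define Y where "Y l = (\<Sum>j\<in>J. op_scaleC (chi L l (int (k j))) (v j))" for l
    have clY: "clin (Y l)" for l unfolding Y_def by (intro clin_sum clin_op_scaleC clv)
    have adjY: "adj (Y l) = (\<Sum>j\<in>J. op_scaleC (chi L l (- int (k j))) (adj (v j)))" for l
      unfolding Y_def by (simp add: adj_sum adj_op_scaleC clv clin_op_scaleC chi_minus)
    have "\<exists>B D. clin B \<and> clin D \<and> Y l = B + D \<and> (\<forall>x. norm (B x) \<le> norm x) \<and>
        (\<forall>x. 8 * (norm (D x))\<^sup>2 \<le> (norm (adj (Y l) (Y l x)))\<^sup>2) \<and>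
        (\<forall>x. 8 * (norm (adj D x))\<^sup>2 \<le> (norm (Y l (adj (Y l) x)))\<^sup>2)" for l
      using truncation[OF clY[of l]] by metis
    then obtain B D where BD: "\<And>l. clin (B l)" "\<And>l. clin (D l)" "\<And>l. Y l = B l + D l"
      "\<And>l x. norm (B l x) \<le> norm x"
      "\<And>l x. 8 * (norm (D l x))\<^sup>2 \<le> (norm (adj (Y l) (Y l x)))\<^sup>2"
      "\<And>l x. 8 * (norm (adj (D l) x))\<^sup>2 \<le> (norm (Y l (adj (Y l) x)))\<^sup>2"
      by metis
    \<comment> \<open>\<open>v j\<close> is the coefficient of \<open>Y\<close> at
      \<open>k j\<close>, as distinct frequencies stay distinct modulo \<open>L\<close>.\<close>
    have v_eq: "v j = dft L B (int (k j)) + dft L D (int (k j))" if j: "j \<in> J" for j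
    proof -
      have "dft L B (int (k j)) x + dft L D (int (k j)) x = v j x" for x
      proof -
        have "dft L B (int (k j)) x + dft L D (int (k j)) x = (1 / real L) *\<^sub>R (\<Sum>l<L. chi L l (- int (k j)) *\<^sub>C Y l x)"
          by (simp add: dft_apply BD(3) blinfun.bilinear_simps scaleC_add_right sum.distrib scaleR_add_right)
        also have "(\<Sum>l<L. chi L l (- int (k j)) *\<^sub>C Y l x)
            = (\<Sum>i\<in>J. (\<Sum>l<L. chi L l (int (k i) - int (k j))) *\<^sub>C v i x)"
          unfolding Y_def scaleC_sum_left
          by (subst sum.swap) (simp add: blinfun.sum_left apply_op_scaleC scaleC_sum_right scaleC_scaleC
              chi_add[symmetric] add.commute)
        also have "\<dots> = (\<Sum>i\<in>J. if i = j then of_nat L *\<^sub>C v j x else 0)"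
          using inc j by (intro sum.cong refl) (auto simp: chi_sum[OF L(1)])
        also have "\<dots> = of_nat L *\<^sub>C v j x" using finJ j by (simp add: sum.delta)
        also have "(1 / real L) *\<^sub>R (of_nat L *\<^sub>C v j x) = v j x"
          using L(1) scaleC_of_real[of "real L" "v j x"] by simp
        finally show ?thesis .
      qed
      then show ?thesis by (intro blinfun_eqI) (simp add: blinfun.bilinear_simps)
    qed
    \<comment> \<open>By \<open>dft_bessel\<close> and \<open>fourth_moment\<close> the coefficients
      of \<open>D\<close> have column and row norms at most \<open>sqrt (2 / 8) = 1 / 2\<close>, so
      doubled they are admissible again.\<close>
    define w where "w j = 2 *\<^sub>R dft L D (int (k j))" for j
    have arith: "(\<Sum>j\<in>J. (2 * a j)\<^sup>2) \<le> X" if "real L * (\<Sum>j\<in>J. (a j)\<^sup>2) \<le> b" "8 * b \<le> 2 * real L * X"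
      for a :: "nat \<Rightarrow> real" and b X
    proof -
      have "8 * (real L * (\<Sum>j\<in>J. (a j)\<^sup>2)) \<le> 2 * real L * X" using that by linarith
      then have "real L * (8 * (\<Sum>j\<in>J. (a j)\<^sup>2)) \<le> real L * (2 * X)" by (simp add: mult_ac)
      then have "8 * (\<Sum>j\<in>J. (a j)\<^sup>2) \<le> 2 * X" using L(1) by simp
      then show ?thesis
        by (simp add: power_mult_distrib sum_distrib_left[symmetric] zero_le_power2 sum_nonneg)
    qed
    have w: "admissible J w"
      unfolding admissible_def
    proof (intro conjI allI)
      show "clin (w j)" for j unfolding w_def by (intro clin_scaleR clin_dft BD)
      fix x
      have "8 * (\<Sum>l<L. (norm (D l x))\<^sup>2) \<le> (\<Sum>l<L. (norm (adj (Y l) (Y l x)))\<^sup>2)"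
        unfolding sum_distrib_left by (intro sum_mono BD)
      also have "\<dots> \<le> 2 * real L * (norm x)\<^sup>2"
        by (rule fourth_moment[OF L(1) finJ v, where \<kappa> = "\<lambda>j. int (k j)"]) (use quad1 Y_def in blast)+
      finally have "8 * (\<Sum>l<L. (norm (D l x))\<^sup>2) \<le> 2 * real L * (norm x)\<^sup>2" .
      from arith[OF dft_bessel[OF L(1) finJ, where m = "\<lambda>j. int (k j)", OF inc] this]
      show "(\<Sum>j\<in>J. (norm (w j x))\<^sup>2) \<le> (norm x)\<^sup>2"
        by (simp add: w_def blinfun.bilinear_simps)
      have "8 * (\<Sum>l<L. (norm (adj (D l) x))\<^sup>2) \<le> (\<Sum>l<L. (norm (adj (adj (Y l)) (adj (Y l) x)))\<^sup>2)"
        unfolding sum_distrib_left adj_adj[OF clY] by (intro sum_mono BD)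
      also have "\<dots> \<le> 2 * real L * (norm x)\<^sup>2"
        by (rule fourth_moment[OF L(1) finJ admissible_adj[OF v], where \<kappa> = "\<lambda>j. - int (k j)"])
           (use quad2 adjY in blast)+
      finally have "8 * (\<Sum>l<L. (norm (adj (D l) x))\<^sup>2) \<le> 2 * real L * (norm x)\<^sup>2" .
      from arith[OF dft_bessel[OF L(1) finJ, where m = "\<lambda>j. - int (k j)", OF inc'] this]
      show "(\<Sum>j\<in>J. (norm (adj (w j) x))\<^sup>2) \<le> (norm x)\<^sup>2"
        by (simp add: w_def adj_scaleR clin_dft BD(2) adj_dft blinfun.bilinear_simps)
    qed
    have "\<psi> v = \<psi> (\<lambda>j. dft L B (int (k j))) + \<psi> w / 2"
      unfolding \<psi>_def w_def \<beta>_scale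
      by (simp add: sum_divide_distrib sum.distrib[symmetric] \<beta>_add ring_distribs cong: sum.cong_simp flip: v_eq)
         (simp add: v_eq \<beta>_add ring_distribs cong: sum.cong_simp)
    moreover have "\<psi> (\<lambda>j. dft L B (int (k j))) \<le> F" by (intro fejer BD)
    ultimately show ?thesis using upper[OF w] by linarith
  qed
  have "s \<le> F + s / 2"
    unfolding s_def by (rule cSUP_least) (use v step in \<open>auto simp: s_def\<close>)
  then have "\<psi> v \<le> 2 * F" using upper[OF v] by linarith
  then show ?thesis by (simp add: \<psi>_def \<mu>_def \<beta>_def)
qed

text \<open>For fixed \<open>j\<close> the weights \<open>(M - k j) / M\<close> tend to 1 as
  \<open>M\<close> grows. The family is extended by 0 from \<open>{..<N}\<close> to all
  \<open>j\<close> with \<open>k j < M\<close>.\<close>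

lemma dual_inequality:
  fixes f :: "real \<Rightarrow> ('a::chilbert_space \<Rightarrow>\<^sub>L 'a)"
  assumes k: "strongly_lacunary_seq k" and f: "f \<in> L1_S1" and F: "L1_norm f = ennreal F" "0 \<le> F"
    and van: "\<And>n. n \<notin> range (\<lambda>j. int (k j)) \<Longrightarrow> fourier_coeff f n = 0"
    and e: "bessel d e" and v: "admissible {..<N} v"
  shows "(\<Sum>j<N. Re (\<Sum>l<d. cinner (v j (e l)) (fourier_coeff f (int (k j)) (e l)))) \<le> 2 * F"
proof -
  define \<gamma> where "\<gamma> j = Re (\<Sum>l<d. cinner (v j (e l)) (fourier_coeff f (int (k j)) (e l)))" for j
  define u where "u j = (if j < N then v j else 0)" for j
  have lim1: "(\<lambda>M. (real M - c) / real M) \<longlonglongrightarrow> 1" for c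
  proof -
    have "(\<lambda>M. 1 - c / real M) \<longlonglongrightarrow> 1 - 0"
      by (intro tendsto_diff tendsto_const lim_const_over_n)
    moreover have "\<forall>\<^sub>F M in sequentially. 1 - c / real M = (real M - c) / real M"
      using eventually_gt_at_top[of "0::nat"] by eventually_elim (simp add: diff_divide_distrib)
    ultimately show ?thesis using tendsto_cong by fastforce
  qed
  have "(\<lambda>M. \<Sum>j<N. (real M - real (k j)) / real M * \<gamma> j) \<longlonglongrightarrow> (\<Sum>j<N. 1 * \<gamma> j)"
    by (intro tendsto_sum tendsto_mult lim1 tendsto_const)
  moreover have "\<forall>\<^sub>F M in sequentially. (\<Sum>j<N. (real M - real (k j)) / real M * \<gamma> j) \<le> 2 * F"
    unfolding eventually_sequentially
  proof (intro exI[of _ "Suc (k N)"] allI impI)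
    fix M assume M: "Suc (k N) \<le> M"
    define J where "J = {j. k j < M}"
    have inc: "j \<le> k j" for j using strict_mono_imp_increasing[OF lacunary_strict_mono[OF k]] .
    have finJ: "finite J"
      unfolding J_def by (rule finite_subset[of _ "{..<M}"]) (use inc le_less_trans in auto)
    have NJ: "{..<N} \<subseteq> J"
    proof
      fix j assume "j \<in> {..<N}"
      then have "k j \<le> k N" using lacunary_strict_mono[OF k] by (simp add: strict_mono_less_eq)
      then show "j \<in> J" using M by (simp add: J_def)
    qed
    have restrict: "(\<Sum>j\<in>J. if j < N then h j else 0) = (\<Sum>j<N. h j)" for h :: "nat \<Rightarrow> real"
      using finJ NJ by (intro sum.mono_neutral_cong_right) auto
    have adj0: "adj (0 :: 'a \<Rightarrow>\<^sub>L 'a) = 0" by (rule adj_eqI) auto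
    have "admissible J u"
      unfolding admissible_def
    proof (intro conjI allI)
      show "clin (u j)" for j using v by (simp add: u_def admissible_def)
      fix x
      have "(\<Sum>j\<in>J. (norm (u j x))\<^sup>2) = (\<Sum>j\<in>J. if j < N then (norm (v j x))\<^sup>2 else 0)"
        by (intro sum.cong) (auto simp: u_def)
      then show "(\<Sum>j\<in>J. (norm (u j x))\<^sup>2) \<le> (norm x)\<^sup>2" using v by (simp add: restrict admissible_def)
      have "(\<Sum>j\<in>J. (norm (adj (u j) x))\<^sup>2) = (\<Sum>j\<in>J. if j < N then (norm (adj (v j) x))\<^sup>2 else 0)"
        by (intro sum.cong) (auto simp: u_def adj0)
      then show "(\<Sum>j\<in>J. (norm (adj (u j) x))\<^sup>2) \<le> (norm x)\<^sup>2" using v by (simp add: restrict admissible_def)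
    qed
    from dual_inequality_fejer[OF k f F van e _ J_def this] M
    have "(\<Sum>j\<in>J. (real M - real (k j)) / real M *
        Re (\<Sum>l<d. cinner (u j (e l)) (fourier_coeff f (int (k j)) (e l)))) \<le> 2 * F" by simp
    also have "(\<Sum>j\<in>J. (real M - real (k j)) / real M *
        Re (\<Sum>l<d. cinner (u j (e l)) (fourier_coeff f (int (k j)) (e l))))
        = (\<Sum>j\<in>J. if j < N then (real M - real (k j)) / real M * \<gamma> j else 0)"
      by (intro sum.cong) (auto simp: u_def \<gamma>_def)
    finally show "(\<Sum>j<N. (real M - real (k j)) / real M * \<gamma> j) \<le> 2 * F" by (simp only: restrict)
  qed
  ultimately have "(\<Sum>j<N. 1 * \<gamma> j) \<le> 2 * F" by (rule tendsto_upperbound) simp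
  then show ?thesis by (simp add: \<gamma>_def)
qed

section \<open>The Hahn--Banach theorem\<close>

text \<open>Homogeneity is demanded as an inequality, which is easier to check; equality for
  \<open>c >= 0\<close> follows by rescaling.\<close>

definition sublin :: "('a::real_vector \<Rightarrow> real) \<Rightarrow> bool" where
  "sublin q \<longleftrightarrow> (\<forall>x y. q (x + y) \<le> q x + q y) \<and> (\<forall>c\<ge>0. \<forall>x. q (c *\<^sub>R x) \<le> c * q x)"

lemma sublin_add: "sublin q \<Longrightarrow> q (x + y) \<le> q x + q y"
  by (simp add: sublin_def)

lemma sublin_scale_le: "sublin q \<Longrightarrow> 0 \<le> c \<Longrightarrow> q (c *\<^sub>R x) \<le> c * q x"
  by (simp add: sublin_def)

lemma sublin_zero: "sublin q \<Longrightarrow> q 0 = 0"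
  using sublin_scale_le[of q 0 0] sublin_add[of q 0 0] by simp

lemma sublin_scale:
  assumes q: "sublin q" and c: "0 \<le> c"
  shows "q (c *\<^sub>R x) = c * q x"
proof (cases "c = 0")
  case False
  then have "q x \<le> (1 / c) * q (c *\<^sub>R x)"
    using sublin_scale_le[OF q, of "1 / c" "c *\<^sub>R x"] c by simp
  then have "c * q x \<le> q (c *\<^sub>R x)" using c False by (simp add: field_simps)
  then show ?thesis using sublin_scale_le[OF q c, of x] by simp
qed (simp add: sublin_zero q)

lemma sublin_minus: "sublin q \<Longrightarrow> - q (- x) \<le> q x"
  using sublin_add[of q x "- x"] sublin_zero[of q] by simp

text \<open>Used twice: with a ray, to show that a minimal sublinear functional is additive, and
  with a subspace, to bring in the functional to be extended. Closure of the pairs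
  \<open>(a i, b i)\<close> under sums and nonnegative multiples is what makes the infimum
  \<open>r\<close> sublinear.\<close>

lemma sublin_inf:
  fixes p :: "'a::real_vector \<Rightarrow> real" and a :: "'i \<Rightarrow> 'a" and b :: "'i \<Rightarrow> real"
  assumes p: "sublin p" and T: "T \<noteq> {}" and le: "\<And>i. i \<in> T \<Longrightarrow> b i \<le> p (a i)"
    and add: "\<And>i j. i \<in> T \<Longrightarrow> j \<in> T \<Longrightarrow> \<exists>k\<in>T. a k = a i + a j \<and> b k = b i + b j"
    and scale: "\<And>i c. i \<in> T \<Longrightarrow> 0 \<le> c \<Longrightarrow> \<exists>k\<in>T. a k = c *\<^sub>R a i \<and> b k = c * b i"
  defines "r \<equiv> \<lambda>x. (INF i\<in>T. p (x + a i) - b i)"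
  shows "sublin r" "\<And>x. r x \<le> p x" "\<And>x i. i \<in> T \<Longrightarrow> r x \<le> p (x + a i) - b i"
proof -
  have bdd: "bdd_below ((\<lambda>i. p (x + a i) - b i) ` T)" for x
  proof (rule bdd_belowI2)
    fix i assume "i \<in> T"
    then have "b i \<le> p (a i)" by (rule le)
    also have "\<dots> \<le> p (x + a i) + p (- x)" using sublin_add[OF p, of "x + a i" "- x"] by simp
    finally show "- p (- x) \<le> p (x + a i) - b i" by simp
  qed
  show low: "r x \<le> p (x + a i) - b i" if "i \<in> T" for x i
    unfolding r_def by (rule cINF_lower[OF bdd that])
  have greatest: "c \<le> r x" if "\<And>i. i \<in> T \<Longrightarrow> c \<le> p (x + a i) - b i" for c x
    unfolding r_def using T that by (rule cINF_greatest)
  obtain i0 where i0: "i0 \<in> T" using T by blast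
  obtain z where z: "z \<in> T" "a z = 0" "b z = 0" using scale[OF i0, of 0] by auto
  show "r x \<le> p x" for x using low[OF z(1), of x] z by simp
  show "sublin r"
    unfolding sublin_def
  proof (intro conjI allI impI)
    fix x y
    have "r (x + y) \<le> (p (x + a i) - b i) + (p (y + a j) - b j)" if ij: "i \<in> T" "j \<in> T" for i j
    proof -
      obtain k where k: "k \<in> T" "a k = a i + a j" "b k = b i + b j" using add[OF ij] by blast
      have "r (x + y) \<le> p ((x + a i) + (y + a j)) - b k"
        using low[OF k(1), of "x + y"] k(2) by (simp add: algebra_simps)
      then show ?thesis using sublin_add[OF p, of "x + a i" "y + a j"] k(3) by simp
    qed
    note two = this
    have "r (x + y) - (p (x + a i) - b i) \<le> r y" if i: "i \<in> T" for i
    proof (rule greatest)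
      fix j assume "j \<in> T"
      from two[OF i this] show "r (x + y) - (p (x + a i) - b i) \<le> p (y + a j) - b j" by simp
    qed
    then have "r (x + y) - r y \<le> r x"
      by (intro greatest) (auto simp: algebra_simps)
    then show "r (x + y) \<le> r x + r y" by simp
  next
    fix c :: real and x assume c: "0 \<le> c"
    have *: "r (c *\<^sub>R x) \<le> c * (p (x + a i) - b i)" if i: "i \<in> T" for i
    proof -
      obtain k where k: "k \<in> T" "a k = c *\<^sub>R a i" "b k = c * b i" using scale[OF i c] by blast
      have "r (c *\<^sub>R x) \<le> p (c *\<^sub>R (x + a i)) - b k"
        using low[OF k(1), of "c *\<^sub>R x"] k(2) by (simp add: scaleR_add_right)
      then show ?thesis using sublin_scale[OF p c, of "x + a i"] k(3) by (simp add: algebra_simps)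
    qed
    show "r (c *\<^sub>R x) \<le> c * r x"
    proof (cases "c = 0")
      case True
      then show ?thesis using *[OF i0] by simp
    next
      case False
      then have "r (c *\<^sub>R x) / c \<le> r x"
        using * c by (intro greatest) (auto simp: field_simps)
      then show ?thesis using c False by (simp add: field_simps)
    qed
  qed
qed

text \<open>Minimality forces \<open>r = q\<close> for the infimum \<open>r\<close> along the ray
  through \<open>y\<close>; at \<open>t = 1\<close> this reads
  \<open>q x <= q (x + y) - q y\<close>, the missing half of additivity.\<close>

lemma sublin_minimal_linear:
  assumes q: "sublin q" and min: "\<And>r. sublin r \<Longrightarrow> (\<And>x. r x \<le> q x) \<Longrightarrow> r = q"
  shows "linear q"
proof -
  have "q x + q y \<le> q (x + y)" for x y
  proof -
    define r where "r z = (INF t\<in>{0::real..}. q (z + t *\<^sub>R y) - t * q y)" for z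
    have add: "\<exists>k\<in>{0..}. k *\<^sub>R y = i *\<^sub>R y + j *\<^sub>R y \<and> k * q y = i * q y + j * q y"
      if "i \<in> {0..}" "j \<in> {0..}" for i j :: real
      using that by (intro bexI[of _ "i + j"]) (auto simp: algebra_simps)
    have scale: "\<exists>k\<in>{0..}. k *\<^sub>R y = c *\<^sub>R (i *\<^sub>R y) \<and> k * q y = c * (i * q y)"
      if "i \<in> {0..}" "0 \<le> c" for i c :: real
      using that by (intro bexI[of _ "c * i"]) auto
    note inf = sublin_inf[OF q, of "{0..}" "\<lambda>t. t * q y" "\<lambda>t. t *\<^sub>R y", OF _ _ add scale, folded r_def]
    have "sublin r" "r z \<le> q z" "r x \<le> q (x + 1 *\<^sub>R y) - 1 * q y" for z
      by (rule inf; use sublin_scale[OF q] in force)+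
    moreover from this have "r = q" by (intro min)
    ultimately show ?thesis by simp
  qed
  then have add: "q (x + y) = q x + q y" for x y using sublin_add[OF q, of x y] by (simp add: antisym)
  have neg: "q (- x) = - q x" for x using add[of x "- x"] sublin_zero[OF q] by simp
  show ?thesis
  proof (rule linearI)
    show "q (x + y) = q x + q y" for x y by (rule add)
    show "q (c *\<^sub>R x) = c *\<^sub>R q x" for c x
      using sublin_scale[OF q, of c x] sublin_scale[OF q, of "- c" x] neg[of "c *\<^sub>R x"]
      by (cases "0 \<le> c") auto
  qed
qed

text \<open>Zorn's lemma for the reversed pointwise order. A nonempty chain is bounded by its
  pointwise infimum, which is finite because \<open>q x >= - p (- x)\<close> for all members;
  comparability of the members gives subadditivity.\<close>

lemma sublin_minimal_exists:
  assumes p: "sublin p"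
  shows "\<exists>q. sublin q \<and> (\<forall>x. q x \<le> p x) \<and> (\<forall>r. sublin r \<longrightarrow> (\<forall>x. r x \<le> q x) \<longrightarrow> r = q)"
proof -
  define Q where "Q = {q. sublin q \<and> (\<forall>x. q x \<le> p x)}"
  have "\<exists>m\<in>Q. \<forall>a\<in>Q. (\<lambda>q r. \<forall>x. r x \<le> q x) m a \<longrightarrow> a = m"
  proof (rule predicate_Zorn)
    show "partial_order_on Q (relation_of (\<lambda>q r. \<forall>x. r x \<le> q x) Q)"
      by (rule partial_order_on_relation_ofI) (auto intro: order_trans intro!: ext antisym)
    fix C assume C: "C \<in> Chains (relation_of (\<lambda>q r. \<forall>x. r x \<le> q x) Q)"
    have CQ: "q \<in> Q" if "q \<in> C" for q
      using C that by (auto simp: Chains_def relation_of_def)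
    have Ctot: "(\<forall>x. r x \<le> q x) \<or> (\<forall>x. q x \<le> r x)" if "q \<in> C" "r \<in> C" for q r
      using C that by (auto simp: Chains_def relation_of_def)
    show "\<exists>u\<in>Q. \<forall>a\<in>C. \<forall>x. u x \<le> a x"
    proof (cases "C = {}")
      case True
      then show ?thesis using p by (auto simp: Q_def)
    next
      case False
      then obtain q0 where q0: "q0 \<in> C" by blast
      define u where "u x = (INF q\<in>C. q x)" for x
      have bdd: "bdd_below ((\<lambda>q. q x) ` C)" for x
      proof (rule bdd_belowI2)
        fix q assume "q \<in> C"
        then have "sublin q" "q (- x) \<le> p (- x)" using CQ by (auto simp: Q_def)
        then show "- p (- x) \<le> q x" using sublin_minus[of q x] by linarith
      qed
      have low: "u x \<le> q x" if "q \<in> C" for q x unfolding u_def by (rule cINF_lower[OF bdd that])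
      have greatest: "c \<le> u x" if "\<And>q. q \<in> C \<Longrightarrow> c \<le> q x" for c x
        unfolding u_def using False that by (rule cINF_greatest)
      have "sublin u"
        unfolding sublin_def
      proof (intro conjI allI impI)
        fix x y
        have "u (x + y) \<le> q x + r y" if qr: "q \<in> C" "r \<in> C" for q r
        proof -
          obtain t where t: "t \<in> C" "\<forall>x. t x \<le> q x" "\<forall>x. t x \<le> r x"
            using Ctot[OF qr] qr by (metis order_refl)
          have "u (x + y) \<le> t (x + y)" by (rule low[OF t(1)])
          also have "\<dots> \<le> t x + t y" using CQ[OF t(1)] by (intro sublin_add) (simp add: Q_def)
          also have "\<dots> \<le> q x + r y" using t by (intro add_mono) auto
          finally show ?thesis .
        qed
        note two = this
        have "u (x + y) - q x \<le> u y" if q: "q \<in> C" for q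
        proof (rule greatest)
          fix r assume "r \<in> C"
          from two[OF q this] show "u (x + y) - q x \<le> r y" by simp
        qed
        then have "u (x + y) - u y \<le> u x"
          by (intro greatest) (auto simp: algebra_simps)
        then show "u (x + y) \<le> u x + u y" by simp
      next
        fix c :: real and x assume c: "0 \<le> c"
        have *: "u (c *\<^sub>R x) \<le> c * q x" if "q \<in> C" for q
          using low[OF that, of "c *\<^sub>R x"] sublin_scale_le[OF _ c, of q x] CQ[OF that]
          by (auto simp: Q_def intro: order_trans)
        show "u (c *\<^sub>R x) \<le> c * u x"
        proof (cases "c = 0")
          case True
          then show ?thesis using *[OF q0] by simp
        next
          case 2: False
          then have "u (c *\<^sub>R x) / c \<le> u x"
            using * c by (intro greatest) (auto simp: field_simps)
          then show ?thesis using c 2 by (simp add: field_simps)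
        qed
      qed
      moreover have "u x \<le> p x" for x using low[OF q0, of x] CQ[OF q0] by (auto simp: Q_def intro: order_trans)
      ultimately show ?thesis using low by (intro bexI[of _ u]) (auto simp: Q_def)
    qed
  qed
  then obtain m where m: "m \<in> Q" "\<And>a. a \<in> Q \<Longrightarrow> (\<And>x. a x \<le> m x) \<Longrightarrow> a = m" by blast
  have "r = m" if "sublin r" "\<forall>x. r x \<le> m x" for r
    using m(1) that by (intro m(2)) (auto simp: Q_def intro: order_trans)
  then show ?thesis using m(1) by (auto simp: Q_def)
qed

text \<open>A minimal sublinear functional below \<open>r\<close> is linear, and it lies above
  \<open>\<phi>\<close> on \<open>U\<close> since \<open>r (- u) <= p 0 - \<phi> u\<close>. For
  \<open>u\<close> and \<open>- u\<close> together this is equality.\<close>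

theorem hahn_banach:
  fixes p :: "'a::real_vector \<Rightarrow> real"
  assumes p: "sublin p" and U: "subspace U"
    and add: "\<And>u v. u \<in> U \<Longrightarrow> v \<in> U \<Longrightarrow> \<phi> (u + v) = \<phi> u + \<phi> v"
    and scale: "\<And>c u. u \<in> U \<Longrightarrow> \<phi> (c *\<^sub>R u) = c * \<phi> u"
    and le: "\<And>u. u \<in> U \<Longrightarrow> \<phi> u \<le> p u"
  obtains \<Phi> where "linear \<Phi>" "\<And>x. \<Phi> x \<le> p x" "\<And>u. u \<in> U \<Longrightarrow> \<Phi> u = \<phi> u"
proof -
  define r where "r x = (INF u\<in>U. p (x + u) - \<phi> u)" for x
  have A: "\<exists>k\<in>U. k = i + j \<and> \<phi> k = \<phi> i + \<phi> j" if "i \<in> U" "j \<in> U" for i j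
    using that add subspace_add[OF U] by blast
  have S: "\<exists>k\<in>U. k = c *\<^sub>R i \<and> \<phi> k = c * \<phi> i" if "i \<in> U" "0 \<le> c" for i c
    using that scale subspace_scale[OF U] by blast
  have ne: "U \<noteq> {}" using subspace_0[OF U] by blast
  note inf = sublin_inf[OF p ne, of \<phi> "\<lambda>u. u", OF le A S, folded r_def]
  have r: "sublin r" "\<And>x. r x \<le> p x" "\<And>x u. u \<in> U \<Longrightarrow> r x \<le> p (x + u) - \<phi> u"
    by (rule inf; assumption)+
  obtain q where q: "sublin q" "\<And>x. q x \<le> r x" "\<And>t. sublin t \<Longrightarrow> (\<And>x. t x \<le> q x) \<Longrightarrow> t = q"
    using sublin_minimal_exists[OF r(1)] by blast
  have lin: "linear q" by (rule sublin_minimal_linear[OF q(1,3)])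
  show ?thesis
  proof (rule that[OF lin])
    show "q x \<le> p x" for x using q(2) r(2) order_trans by blast
    have ge: "\<phi> u \<le> q u" if "u \<in> U" for u
      using q(2)[of "- u"] r(3)[OF that, of "- u"] sublin_zero[OF p] linear_neg[OF lin, of u] by simp
    fix u assume u: "u \<in> U"
    have "\<phi> ((- 1) *\<^sub>R u) \<le> q ((- 1) *\<^sub>R u)" using subspace_scale[OF U u] by (rule ge)
    then have "q u \<le> \<phi> u" using scale[OF u, of "- 1"] linear_neg[OF lin, of u] by simp
    then show "q u = \<phi> u" using ge[OF u] by simp
  qed
qed


section \<open>A dual criterion for column norms\<close>

text \<open>The adjoint of the contraction \<open>h \<mapsto> (cinner (y i) h)\<close> is a
  contraction.\<close>

lemma bessel_dual:
  assumes y: "bessel n y"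
  shows "(norm (\<Sum>i<n. t i *\<^sub>C y i))\<^sup>2 \<le> (\<Sum>i<n. (cmod (t i))\<^sup>2)"
proof -
  define z where "z = (\<Sum>i<n. t i *\<^sub>C y i)"
  have "(norm z)\<^sup>2 = Re (\<Sum>i<n. cnj (t i) * cinner (y i) z)"
    unfolding Re_cinner_self[symmetric] by (subst (1) z_def) (simp add: cinner_sum_left cinner_scaleC_left)
  also have "\<dots> \<le> (\<Sum>i<n. \<bar>cmod (t i)\<bar> * \<bar>cmod (cinner (y i) z)\<bar>)"
    unfolding Re_sum by (intro sum_mono order_trans[OF complex_Re_le_cmod]) (simp add: norm_mult)
  also have "\<dots> \<le> L2_set (\<lambda>i. cmod (t i)) {..<n} * L2_set (\<lambda>i. cmod (cinner (y i) z)) {..<n}"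
    by (rule L2_set_mult_ineq)
  also have "L2_set (\<lambda>i. cmod (cinner (y i) z)) {..<n} \<le> norm z"
    using y unfolding L2_set_def bessel_def by (intro real_le_lsqrt) (auto intro: sum_nonneg)
  finally have "(norm z)\<^sup>2 \<le> L2_set (\<lambda>i. cmod (t i)) {..<n} * norm z"
    by (simp add: mult_left_mono L2_set_nonneg)
  then have "norm z \<le> L2_set (\<lambda>i. cmod (t i)) {..<n}"
    by (cases "norm z = 0") (auto simp: power2_eq_square L2_set_nonneg)
  then have "(norm z)\<^sup>2 \<le> (L2_set (\<lambda>i. cmod (t i)) {..<n})\<^sup>2" by (intro power_mono) auto
  then show ?thesis by (simp add: L2_set_def z_def sum_nonneg)
qed

text \<open>\<open>dual\<close> tests the column \<open>(g j)\<close> against finite rank columns of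
  norm at most 1. The optimal test would come from a polar decomposition
  \<open>g j = w j o R\<close>, with \<open>R\<close> the modulus of the column; putting
  \<open>g j o T\<close> for \<open>w j\<close>, with \<open>T\<close> the inverse of
  \<open>R + \<delta>\<close>, stays in the unit ball and costs an error of order \<delta>.\<close>

lemma CE_norm_dual:
  fixes g :: "nat \<Rightarrow> ('a::chilbert_space \<Rightarrow>\<^sub>L 'a)"
  assumes g: "\<And>j. clin (g j)" and sg: "summable (\<lambda>j. (norm (g j))\<^sup>2)" and s: "0 \<le> s"
    and dual: "\<And>N n (p :: nat \<Rightarrow> nat \<Rightarrow> 'a) (x :: nat \<Rightarrow> 'a). (\<And>h. (\<Sum>j<N::nat. (norm (\<Sum>i<n::nat. cinner (x i) h *\<^sub>C p i j))\<^sup>2) \<le> (norm h)\<^sup>2) \<Longrightarrow>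
      (\<Sum>j<N. \<Sum>i<n. Re (cinner (p i j) (blinfun_apply (g j) (x i)))) \<le> s"
  shows "CE_norm g \<le> ennreal s"
proof -
  have sm: "summable (\<lambda>j. adj (g j) o\<^sub>L g j)"
  proof (rule summable_comparison_test'[OF sg])
    fix j
    have "norm (adj (g j) o\<^sub>L g j) \<le> norm (adj (g j)) * norm (g j)" by (rule norm_blinfun_compose)
    also have "\<dots> \<le> norm (g j) * norm (g j)" by (intro mult_right_mono norm_adj_le g norm_ge_zero)
    finally show "norm (adj (g j) o\<^sub>L g j) \<le> (norm (g j))\<^sup>2" by (simp add: power2_eq_square)
  qed
  define S where "S = (\<Sum>j. adj (g j) o\<^sub>L g j)"
  define R where "R = op_sqrt S"
  have posS: "positive_op S" unfolding S_def by (rule positive_gram_suminf[OF g sm])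
  have R: "positive_op R" "R o\<^sub>L R = S" unfolding R_def by (rule op_sqrt[OF posS])+
  have Rsq: "(norm (R x))\<^sup>2 = Re (cinner x (S x))" for x unfolding R_def by (rule norm_sq_op_sqrt[OF posS])
  have sums: "(\<lambda>j. (norm (g j x))\<^sup>2) sums (norm (R x))\<^sup>2" for x
    unfolding Rsq S_def by (rule gram_suminf_sums[OF g sm])
  have part: "(\<Sum>j<N. (norm (g j x))\<^sup>2) \<le> (norm (R x))\<^sup>2" for N x
    using sum_le_suminf[OF sums_summable[OF sums[of x]], of "{..<N}"] sums_unique[OF sums[of x]] by simp
  have polar: "(\<lambda>N. \<Sum>j<N. Re (cinner (g j u) (g j x))) \<longlonglongrightarrow> Re (cinner u (S x))" for u x
  proof -
    have "(\<lambda>j. adj (g j) o\<^sub>L g j) sums S" using sm by (simp add: S_def summable_sums)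
    then have "(\<lambda>N. Re (cinner u ((\<Sum>j<N. adj (g j) o\<^sub>L g j) x))) \<longlonglongrightarrow> Re (cinner u (S x))"
      unfolding sums_def by (intro tendsto_Re tendsto_cinner blinfun.tendsto tendsto_const)
    then show ?thesis by (simp add: blinfun.sum_left cinner_sum_right cinner_adj_right g)
  qed
  have "nuc R \<le> ennreal s"
  proof (rule nuc_leI)
    fix n and x y :: "nat \<Rightarrow> 'a" assume x: "bessel n x" and y: "bessel n y"
    define c where "c = (\<Sum>i<n. norm (y i) * norm (x i))"
    have c: "0 \<le> c" unfolding c_def by (intro sum_nonneg) simp
    have "Re (\<Sum>i<n. cinner (y i) (R (x i))) \<le> s + e" if e: "e > 0" for e
    proof -
      define \<delta> where "\<delta> = e / (c + 1)"
      have \<delta>: "\<delta> > 0" "\<delta> * c \<le> e" using e c by (auto simp: \<delta>_def field_simps)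
      obtain T where T: "clin T" "\<And>z. R (T z) + \<delta> *\<^sub>R T z = z" "\<And>z. T (R z + \<delta> *\<^sub>R z) = z"
        by (rule resolvent[OF positive_op_clin[OF R(1)] positive_op_Re[OF R(1)] \<delta>(1)]) (rule that)
      have RT: "norm (R (T z)) \<le> norm z" for z
      proof -
        have "(norm z)\<^sup>2 = (norm (R (T z) + \<delta> *\<^sub>R T z))\<^sup>2" by (simp only: T(2))
        also have "\<dots> = (norm (R (T z)))\<^sup>2 + (norm (\<delta> *\<^sub>R T z))\<^sup>2 + 2 * (\<delta> * Re (cinner (T z) (R (T z))))"
          unfolding norm_add_sq by (simp add: cinner_simps Re_cinner_commute[of "R (T z)"])
        finally have "(norm (R (T z)))\<^sup>2 \<le> (norm z)\<^sup>2"
          using mult_nonneg_nonneg[OF less_imp_le[OF \<delta>(1)] positive_op_Re[OF R(1), of "T z"]]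
            zero_le_power2[of "norm (\<delta> *\<^sub>R T z)"] by linarith
        then show ?thesis by (rule power2_le_imp_le) simp
      qed
      have TR: "T (R z) = R (T z)" for z
        using T(2)[of z] T(3)[of z] by (simp add: blinfun.bilinear_simps) (metis add_right_cancel)
      have Tsa: "cinner (T a) b = cinner a (T b)" for a b
      proof -
        have "cinner (T a) (R (T b) + \<delta> *\<^sub>R T b) = cinner (R (T a) + \<delta> *\<^sub>R T a) (T b)"
          by (simp add: cinner_simps positive_op_self_adjoint[OF R(1)])
        then show ?thesis by (simp only: T(2))
      qed
      \<comment> \<open>\<open>T (S z)\<close> leads to the part that \<open>dual\<close> controls.
        The other term is an error of norm at most \<open>\<delta> * norm z\<close>, because
        \<open>T\<close> commutes with \<open>R\<close> and \<open>R o T\<close> is a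
        contraction.\<close>
      have split: "R z = T (S z) + \<delta> *\<^sub>R T (R z)" for z
        using T(3)[of "R z"] unfolding R(2)[symmetric] by (simp add: blinfun.bilinear_simps)
      define u where "u i = T (y i)" for i
      have "(\<lambda>N. \<Sum>i<n. \<Sum>j<N. Re (cinner (g j (u i)) (g j (x i)))) \<longlonglongrightarrow> (\<Sum>i<n. Re (cinner (u i) (S (x i))))"
        by (intro tendsto_sum polar)
      moreover have "(\<Sum>j<N. \<Sum>i<n. Re (cinner (g j (u i)) (g j (x i)))) \<le> s" for N
      proof (rule dual[where p = "\<lambda>i j. g j (u i)" and x = x])
        fix h
        define w where "w = (\<Sum>i<n. cinner (x i) h *\<^sub>C y i)"
        have "(\<Sum>i<n. cinner (x i) h *\<^sub>C g j (u i)) = g j (T w)" for j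
          by (simp add: w_def u_def blinfun.sum_right clinD[OF g] clinD[OF T(1)])
        then have "(\<Sum>j<N. (norm (\<Sum>i<n. cinner (x i) h *\<^sub>C g j (u i)))\<^sup>2) \<le> (norm (R (T w)))\<^sup>2"
          using part by simp
        also have "\<dots> \<le> (norm w)\<^sup>2" by (intro power_mono RT) simp
        also have "\<dots> \<le> (\<Sum>i<n. (cmod (cinner (x i) h))\<^sup>2)" unfolding w_def by (rule bessel_dual[OF y])
        also have "\<dots> \<le> (norm h)\<^sup>2" using x by (simp add: bessel_def)
        finally show "(\<Sum>j<N. (norm (\<Sum>i<n. cinner (x i) h *\<^sub>C g j (u i)))\<^sup>2) \<le> (norm h)\<^sup>2" .
      qed
      ultimately have main: "(\<Sum>i<n. Re (cinner (u i) (S (x i)))) \<le> s"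
        unfolding sum.swap[of _ "{..<n}"] by (intro LIMSEQ_le_const2) auto
      have err: "Re (cinner (y i) (\<delta> *\<^sub>R T (R (x i)))) \<le> \<delta> * (norm (y i) * norm (x i))" for i
      proof -
        have "Re (cinner (y i) (\<delta> *\<^sub>R T (R (x i)))) \<le> norm (y i) * (\<delta> * norm (x i))"
          unfolding TR using \<delta>(1)
          by (intro order_trans[OF Re_cinner_le] mult_left_mono) (simp_all add: RT)
        then show ?thesis by (simp only: mult_ac)
      qed
      have "Re (\<Sum>i<n. cinner (y i) (R (x i)))
          = (\<Sum>i<n. Re (cinner (u i) (S (x i)))) + (\<Sum>i<n. Re (cinner (y i) (\<delta> *\<^sub>R T (R (x i)))))"
        by (subst split) (simp add: u_def Tsa cinner_add_right sum.distrib)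
      also have "\<dots> \<le> s + (\<Sum>i<n. \<delta> * (norm (y i) * norm (x i)))"
        by (intro add_mono main sum_mono err)
      also have "\<dots> = s + \<delta> * c" by (simp add: c_def sum_distrib_left)
      finally show ?thesis using \<delta>(2) by linarith
    qed
    then have "Re (\<Sum>i<n. cinner (y i) (R (x i))) \<le> s" by (rule field_le_epsilon)
    then show "ennreal (Re (\<Sum>i<n. cinner (y i) (R (x i)))) \<le> ennreal s" by (rule ennreal_leI)
  qed
  then show ?thesis using CE_norm_summable[OF g sm] by (simp add: R_def S_def)
qed

section \<open>Hilbert--Schmidt operators on \<open>\<ell>\<^sup>2\<close>\<close>

lemma norm_sq_ell2_sums: "(\<lambda>i. (cmod (Rep_ell2 x i))\<^sup>2) sums (norm x)\<^sup>2"
proof -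
  have s: "summable (\<lambda>i. (cmod (Rep_ell2 x i))\<^sup>2)" using Rep_ell2_sq[of x] by (simp add: sq_summable_def)
  then have "(norm x)\<^sup>2 = (\<Sum>i. (cmod (Rep_ell2 x i))\<^sup>2)"
    unfolding norm_ell2_def l2norm_def by (intro real_sqrt_pow2 suminf_nonneg) auto
  then show ?thesis using s by (simp add: summable_sums)
qed

lemma sum_sq_le_norm_ell2: "finite I \<Longrightarrow> (\<Sum>i\<in>I. (cmod (Rep_ell2 x i))\<^sup>2) \<le> (norm x)\<^sup>2"
  using sum_le_suminf[OF sums_summable[OF norm_sq_ell2_sums[of x]], of I] sums_unique[OF norm_sq_ell2_sums[of x]]
  by simp

lemma Abs_ell2_bounded:
  assumes B: "0 \<le> B" and le: "\<And>N. (\<Sum>i<N. (cmod (c i))\<^sup>2) \<le> B\<^sup>2"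
  shows "Rep_ell2 (Abs_ell2 c) = c" "norm (Abs_ell2 c) \<le> B"
proof -
  have b: "L2_set (\<lambda>n. cmod (c n)) {..<N} \<le> B" for N
    unfolding L2_set_def using B le[of N] by (intro real_le_lsqrt) (auto intro: sum_nonneg)
  show R: "Rep_ell2 (Abs_ell2 c) = c" using l2norm_bound(1)[OF b] by (intro Abs_ell2_inverse) simp
  show "norm (Abs_ell2 c) \<le> B" unfolding norm_ell2_def R by (rule l2norm_bound(2)[OF b])
qed

text \<open>The rank-one operator \<open>z \<mapsto> cinner x z *\<^sub>C y\<close>, given by its
  matrix entries in the order of \<open>prod_decode\<close>; hence the conjugate on
  \<open>x\<close>.\<close>

definition tens :: "ell2 \<Rightarrow> ell2 \<Rightarrow> ell2" where
  "tens y x = Abs_ell2 (\<lambda>i. Rep_ell2 y (fst (prod_decode i)) * cnj (Rep_ell2 x (snd (prod_decode i))))"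

lemma prod_decode_le: "fst (prod_decode i) \<le> i" "snd (prod_decode i) \<le> i"
  using le_prod_encode_1[of "fst (prod_decode i)" "snd (prod_decode i)"]
    le_prod_encode_2[of "snd (prod_decode i)" "fst (prod_decode i)"] by simp_all

lemma shows Rep_tens: "Rep_ell2 (tens y x) = (\<lambda>i. Rep_ell2 y (fst (prod_decode i)) * cnj (Rep_ell2 x (snd (prod_decode i))))"
  and norm_tens_le: "norm (tens y x) \<le> norm y * norm x"
proof -
  let ?c = "\<lambda>i. Rep_ell2 y (fst (prod_decode i)) * cnj (Rep_ell2 x (snd (prod_decode i)))"
  have "(\<Sum>i<N. (cmod (?c i))\<^sup>2) \<le> (norm y * norm x)\<^sup>2" for N
  proof -
    let ?h = "\<lambda>p. (cmod (Rep_ell2 y (fst p)))\<^sup>2 * (cmod (Rep_ell2 x (snd p)))\<^sup>2"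
    have "(\<Sum>i<N. (cmod (?c i))\<^sup>2) = (\<Sum>p\<in>prod_decode ` {..<N}. ?h p)"
      by (simp add: sum.reindex inj_prod_decode norm_mult power_mult_distrib)
    also have "\<dots> \<le> (\<Sum>p\<in>{..<N} \<times> {..<N}. ?h p)"
    proof (rule sum_mono2)
      show "prod_decode ` {..<N} \<subseteq> {..<N} \<times> {..<N}"
      proof
        fix p assume "p \<in> prod_decode ` {..<N}"
        then obtain i where "p = prod_decode i" "i < N" by auto
        then show "p \<in> {..<N} \<times> {..<N}" using prod_decode_le[of i] by (simp add: mem_Times_iff)
      qed
    qed auto
    also have "\<dots> = (\<Sum>r<N. (cmod (Rep_ell2 y r))\<^sup>2) * (\<Sum>m<N. (cmod (Rep_ell2 x m))\<^sup>2)"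
      by (simp add: sum_product sum.cartesian_product case_prod_beta)
    also have "\<dots> \<le> (norm y)\<^sup>2 * (norm x)\<^sup>2"
      by (intro mult_mono sum_sq_le_norm_ell2 sum_nonneg) auto
    finally show ?thesis by (simp add: power_mult_distrib)
  qed
  from Abs_ell2_bounded[OF _ this]
  show "Rep_ell2 (tens y x) = ?c" "norm (tens y x) \<le> norm y * norm x" unfolding tens_def by simp_all
qed

lemma tens_simps:
  "tens (y + z) x = tens y x + tens z x" "tens y (x + z) = tens y x + tens y z"
  "tens (c *\<^sub>C y) x = c *\<^sub>C tens y x" "tens y (c *\<^sub>C x) = cnj c *\<^sub>C tens y x"
  by (auto intro!: ell2_eqI simp: Rep_tens Rep_ell2_add Rep_ell2_scaleC algebra_simps)

lemma tens_ket: "tens (ket n) (ket l) = ket (prod_encode (n, l))"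
proof (rule ell2_eqI)
  fix i
  have "i = prod_encode (n, l) \<longleftrightarrow> prod_decode i = (n, l)" by (metis prod_decode_inverse prod_encode_inverse)
  then show "Rep_ell2 (tens (ket n) (ket l)) i = Rep_ell2 (ket (prod_encode (n, l))) i"
    by (auto simp: Rep_tens Rep_ket prod_eq_iff)
qed

text \<open>The operator whose matrix has the entries \<open>A\<^sub>i\<close>, where \<open>i\<close> encodes a pair of indices.\<close>

definition hs :: "ell2 \<Rightarrow> (ell2 \<Rightarrow>\<^sub>L ell2)" where
  "hs A = Blinfun (\<lambda>x. SOME z. \<forall>y. cinner y z = cinner (tens y x) A)"

lemma shows cinner_hs: "cinner y (hs A x) = cinner (tens y x) A"
  and clin_hs [intro, simp]: "clin (hs A)"
  and norm_hs_le: "norm (hs A) \<le> norm A"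
proof -
  define g where "g x = (SOME z. \<forall>y. cinner y z = cinner (tens y x) A)" for x
  have ex: "\<exists>z. \<forall>y. cinner y z = cinner (tens y x) A" for x
  proof -
    have "bounded_linear (\<lambda>y. cinner A (tens y x))"
    proof (rule bounded_linear_intro[where K = "norm A * norm x"])
      show "cinner A (tens (r *\<^sub>R y) x) = r *\<^sub>R cinner A (tens y x)" for r y
        unfolding scaleC_of_real[symmetric] tens_simps by (simp add: cinner_simps scaleR_conv_of_real)
      show "norm (cinner A (tens y x)) \<le> norm y * (norm A * norm x)" for y
        using order_trans[OF cauchy_schwarz mult_left_mono[OF norm_tens_le norm_ge_zero], of A y x]
        by (simp add: mult_ac)
    qed (simp add: tens_simps cinner_simps)
    then obtain z where "\<And>y. cinner A (tens y x) = cinner z y"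
      by (rule riesz) (auto simp: tens_simps cinner_simps)
    then have "\<forall>y. cinner y z = cinner (tens y x) A" by (metis cinner_commute)
    then show ?thesis by blast
  qed
  have g: "cinner y (g x) = cinner (tens y x) A" for x y
    using someI_ex[OF ex[of x]] unfolding g_def by blast
  have gn: "norm (g x) \<le> norm x * norm A" for x
  proof (rule norm_le_cinnerI)
    fix y
    have "Re (cinner y (g x)) \<le> norm (tens y x) * norm A" unfolding g by (rule Re_cinner_le)
    also have "\<dots> \<le> norm y * norm x * norm A" by (intro mult_right_mono norm_tens_le) simp
    finally show "Re (cinner y (g x)) \<le> norm x * norm A * norm y" by (simp add: mult_ac)
  qed simp
  have gC: "g (c *\<^sub>C x) = c *\<^sub>C g x" for c x
    by (rule cinner_eqI) (simp add: g tens_simps cinner_simps)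
  have "bounded_linear g"
  proof (rule bounded_linear_intro[OF _ _ gn])
    show "g (x + y) = g x + g y" for x y
      by (rule cinner_eqI) (simp add: g tens_simps cinner_simps)
    show "g (r *\<^sub>R x) = r *\<^sub>R g x" for r x using gC[of "of_real r" x] by (simp add: scaleC_of_real)
  qed
  then have ap: "hs A x = g x" for x
    unfolding hs_def g_def[symmetric] by (simp add: bounded_linear_Blinfun_apply)
  show "cinner y (hs A x) = cinner (tens y x) A" unfolding ap by (rule g)
  show "clin (hs A)" unfolding clin_def ap using gC by blast
  show "norm (hs A) \<le> norm A" by (rule norm_blinfun_bound) (use gn in \<open>auto simp: ap mult.commute\<close>)
qed

lemma hs_add: "hs (A + B) = hs A + hs B"
  by (intro blinfun_eqI cinner_eqI) (simp add: cinner_hs blinfun.bilinear_simps cinner_simps)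

lemma hs_scaleC: "hs (c *\<^sub>C A) = op_scaleC c (hs A)"
  by (intro blinfun_eqI cinner_eqI) (simp add: cinner_hs apply_op_scaleC cinner_simps)

lemma hs_scaleR: "hs (r *\<^sub>R A) = r *\<^sub>R hs A"
  by (intro blinfun_eqI cinner_eqI) (simp add: cinner_hs blinfun.bilinear_simps cinner_simps)

lemma hs_zero [simp]: "hs 0 = 0"
  by (intro blinfun_eqI cinner_eqI) (simp add: cinner_hs)

lemma hs_sum: "hs (\<Sum>i\<in>I. F i) = (\<Sum>i\<in>I. hs (F i))"
  by (induction I rule: infinite_finite_induct) (auto simp: hs_add)

lemma Rep_hs_ket: "Rep_ell2 (hs A (ket l)) n = Rep_ell2 A (prod_encode (n, l))"
  unfolding cinner_ket_left[symmetric] cinner_hs tens_ket ..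

text \<open>The coordinate of \<open>adj (A - B) y\<close> at \<open>l\<close> is a pairing with
  \<open>(A - B) (ket l)\<close>, so the adjoint vanishes; this takes the place of a density
  argument.\<close>

lemma ell2_op_eqI:
  assumes A: "clin A" and B: "clin B"
    and eq: "\<And>n l. Rep_ell2 (blinfun_apply A (ket l)) n = Rep_ell2 (blinfun_apply B (ket l)) n"
  shows "A = B"
proof -
  have cl: "clin (A - B)" using A B by auto
  have "(A - B) (ket l) = 0" for l
    using ell2_eqI[of "A (ket l)" "B (ket l)"] eq by (simp add: blinfun.bilinear_simps)
  then have "Rep_ell2 (adj (A - B) y) l = 0" for y l
    unfolding cinner_ket_left[symmetric] by (simp add: cinner_adj_right cl)
  then have "adj (A - B) y = 0" for y by (intro ell2_eqI) (simp add: Rep_ell2_zero)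
  then have "adj (A - B) = 0" by (intro blinfun_eqI) simp
  then have "cinner y ((A - B) x) = 0" for x y by (simp add: cinner_adj_left[OF cl, symmetric])
  then have "(A - B) x = 0" for x using cinner_eqI[of "(A - B) x" 0] by simp
  then show ?thesis by (intro blinfun_eqI) (simp add: blinfun.bilinear_simps)
qed

lemma hs_tens: "hs (tens y x) z = cinner x z *\<^sub>C y"
proof -
  have bl: "bounded_linear (\<lambda>z. cinner x z *\<^sub>C y)"
    by (intro bounded_linear_compose[OF bounded_bilinear.bounded_linear_left[OF bounded_bilinear_scaleC]]
        bounded_bilinear.bounded_linear_right[OF bounded_bilinear_cinner])
  note ap = bounded_linear_Blinfun_apply[OF bl]
  have "hs (tens y x) = Blinfun (\<lambda>z. cinner x z *\<^sub>C y)"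
  proof (rule ell2_op_eqI)
    show "clin (Blinfun (\<lambda>z. cinner x z *\<^sub>C y))" by (simp add: clin_def ap cinner_simps scaleC_scaleC)
    show "Rep_ell2 (hs (tens y x) (ket l)) n = Rep_ell2 (Blinfun (\<lambda>z. cinner x z *\<^sub>C y) (ket l)) n" for n l
      by (simp add: ap Rep_hs_ket Rep_tens cinner_ket_right Rep_ell2_scaleC)
  qed simp
  then show ?thesis by (simp add: ap)
qed

lemma adj_hs_tens: "adj (hs (tens y x)) = hs (tens x y)"
  by (rule adj_eqI) (simp_all add: hs_tens cinner_simps cinner_commute[of _ x])

lemma totbdd_sum: "(\<And>i. i \<in> I \<Longrightarrow> totbdd (f i)) \<Longrightarrow> totbdd (\<Sum>i\<in>I. f i)"
  by (induction I rule: infinite_finite_induct) (auto intro: totbdd_zero totbdd_add)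

text \<open>Keeping the first \<open>N\<close> matrix entries gives finite rank operators, and the
  Hilbert-Schmidt norm of the rest tends to 0. This provides the compactness that
  \<open>triple_norm\<close> demands of the summands.\<close>

lemma totbdd_hs: "totbdd (hs A)"
proof (rule totbdd_approx)
  fix e :: real assume e: "e > 0"
  define T where "T N = (\<Sum>i<N. Rep_ell2 A i *\<^sub>C ket i)" for N :: nat
  have RepT: "Rep_ell2 (T N) i = (if i < N then Rep_ell2 A i else 0)" for N i
    unfolding T_def cinner_ket_left[symmetric] cinner_sum_right cinner_scaleC_right
    by (simp add: cinner_ket_left Rep_ket if_distrib[of "\<lambda>c. _ * c"] sum.delta cong: if_cong)
  have nT: "(norm (A - T N))\<^sup>2 = (norm A)\<^sup>2 - (\<Sum>i<N. (cmod (Rep_ell2 A i))\<^sup>2)" for N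
  proof -
    have "(\<lambda>i. (cmod (Rep_ell2 A i))\<^sup>2 - (if i \<in> {..<N} then (cmod (Rep_ell2 A i))\<^sup>2 else 0))
        sums ((norm A)\<^sup>2 - (\<Sum>i<N. (cmod (Rep_ell2 A i))\<^sup>2))"
      by (intro sums_diff norm_sq_ell2_sums sums_If_finite_set) simp
    moreover have "(\<lambda>i. (cmod (Rep_ell2 A i))\<^sup>2 - (if i \<in> {..<N} then (cmod (Rep_ell2 A i))\<^sup>2 else 0))
        = (\<lambda>i. (cmod (Rep_ell2 (A - T N) i))\<^sup>2)" by (auto simp: Rep_ell2_minus RepT)
    ultimately show ?thesis using norm_sq_ell2_sums[of "A - T N"] sums_unique2 by metis
  qed
  have "(\<lambda>N. (norm A)\<^sup>2 - (\<Sum>i<N. (cmod (Rep_ell2 A i))\<^sup>2)) \<longlonglongrightarrow> (norm A)\<^sup>2 - (norm A)\<^sup>2"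
    using norm_sq_ell2_sums[of A] unfolding sums_def by (intro tendsto_diff tendsto_const)
  then have "\<forall>\<^sub>F N in sequentially. (norm (A - T N))\<^sup>2 < e\<^sup>2"
    unfolding nT using e by (intro order_tendstoD(2)) auto
  then obtain N where "(norm (A - T N))\<^sup>2 < e\<^sup>2" by (auto simp: eventually_sequentially)
  then have N: "norm (A - T N) < e" using e by (intro power2_less_imp_less[of _ e]) auto
  have "hs (ket i) = hs (tens (ket (fst (prod_decode i))) (ket (snd (prod_decode i))))" for i
    by (simp add: tens_ket)
  then have "totbdd (hs (ket i))" for i
    by (intro totbdd_rank_one) (simp add: hs_tens)
  then have "totbdd (hs (T N))"
    unfolding T_def hs_sum hs_scaleC by (intro totbdd_sum totbdd_op_scaleC)
  moreover have "norm (hs A - hs (T N)) < e"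
    using norm_hs_le[of "A - T N"] hs_add[of "A - T N" "T N"] N by simp
  ultimately show "\<exists>B. totbdd B \<and> norm (hs A - B) < e" by blast
qed


section \<open>Sequences of Hilbert--Schmidt operators\<close>

text \<open>One vector of \<open>ell2\<close> codes a whole sequence of Hilbert-Schmidt operators,
  with \<open>hs (slice j A)\<close> as its member at \<open>j\<close>. Thus such sequences form a
  Hilbert space to which the Riesz representation applies.\<close>

definition slice :: "nat \<Rightarrow> (ell2 \<Rightarrow>\<^sub>L ell2)" where
  "slice j = Blinfun (\<lambda>A. Abs_ell2 (\<lambda>i. Rep_ell2 A (prod_encode (j, i))))"

lemma shows Rep_slice: "Rep_ell2 (slice j A) = (\<lambda>i. Rep_ell2 A (prod_encode (j, i)))"
  and clin_slice [intro, simp]: "clin (slice j)"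
proof -
  define g where "g A = Abs_ell2 (\<lambda>i. Rep_ell2 A (prod_encode (j, i)))" for A
  have le: "(\<Sum>i<N. (cmod (Rep_ell2 A (prod_encode (j, i))))\<^sup>2) \<le> (norm A)\<^sup>2" for A N
  proof -
    have "(\<Sum>i<N. (cmod (Rep_ell2 A (prod_encode (j, i))))\<^sup>2)
        = (\<Sum>i\<in>(\<lambda>i. prod_encode (j, i)) ` {..<N}. (cmod (Rep_ell2 A i))\<^sup>2)"
      by (subst sum.reindex) (auto simp: inj_on_def)
    also have "\<dots> \<le> (norm A)\<^sup>2" by (intro sum_sq_le_norm_ell2) simp
    finally show ?thesis .
  qed
  note b = Abs_ell2_bounded[OF norm_ge_zero le]
  have R: "Rep_ell2 (g A) = (\<lambda>i. Rep_ell2 A (prod_encode (j, i)))" for A unfolding g_def by (rule b)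
  have "bounded_linear g"
    by (rule bounded_linear_intro[where K = 1])
       (auto simp: R Rep_ell2_simps b(2)[folded g_def] intro!: ell2_eqI)
  then have ap: "slice j A = g A" for A
    unfolding slice_def g_def[symmetric] by (simp add: bounded_linear_Blinfun_apply)
  show "Rep_ell2 (slice j A) = (\<lambda>i. Rep_ell2 A (prod_encode (j, i)))" unfolding ap by (rule R)
  show "clin (slice j)" unfolding clin_def ap by (auto simp: R Rep_ell2_scaleC intro!: ell2_eqI)
qed

lemma sum_norm_slice_le: "(\<Sum>j<N. (norm (slice j A))\<^sup>2) \<le> (norm A)\<^sup>2"
proof -
  have "(\<lambda>n. \<Sum>j<N. \<Sum>i<n. (cmod (Rep_ell2 (slice j A) i))\<^sup>2) \<longlonglongrightarrow> (\<Sum>j<N. (norm (slice j A))\<^sup>2)"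
    using norm_sq_ell2_sums unfolding sums_def by (intro tendsto_sum)
  moreover have "(\<Sum>j<N. \<Sum>i<n. (cmod (Rep_ell2 (slice j A) i))\<^sup>2) \<le> (norm A)\<^sup>2" for n
  proof -
    have "(\<Sum>j<N. \<Sum>i<n. (cmod (Rep_ell2 (slice j A) i))\<^sup>2)
        = (\<Sum>i\<in>prod_encode ` ({..<N} \<times> {..<n}). (cmod (Rep_ell2 A i))\<^sup>2)"
      by (subst sum.reindex) (auto simp: inj_prod_encode Rep_slice sum.cartesian_product case_prod_beta)
    also have "\<dots> \<le> (norm A)\<^sup>2" by (intro sum_sq_le_norm_ell2) simp
    finally show ?thesis .
  qed
  ultimately show ?thesis by (intro LIMSEQ_le_const2) auto
qed

text \<open>\<open>adj (slice j)\<close> is the embedding as block \<open>j\<close>; test sequences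
  will be assembled from blocks with it.\<close>

lemma slice_adj_slice: "slice i (adj (slice j) z) = (if i = j then z else 0)"
proof (rule ell2_eqI)
  fix m
  have *: "slice j (ket (prod_encode (i, m))) = (if i = j then ket m else 0)"
    by (rule ell2_eqI) (auto simp: Rep_slice Rep_ket Rep_ell2_zero)
  have "Rep_ell2 (slice i (adj (slice j) z)) m = cinner (ket (prod_encode (i, m))) (adj (slice j) z)"
    by (simp add: Rep_slice cinner_ket_left)
  also have "\<dots> = cinner (slice j (ket (prod_encode (i, m)))) z"
    by (rule cinner_adj_right[OF clin_slice])
  also have "\<dots> = Rep_ell2 (if i = j then z else 0) m"
    by (simp add: * cinner_ket_left Rep_ell2_zero)
  finally show "Rep_ell2 (slice i (adj (slice j) z)) m = Rep_ell2 (if i = j then z else 0) m" .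
qed

section \<open>Operator norms of columns as sublinear functionals\<close>

definition colbound :: "(nat \<Rightarrow> ('a::chilbert_space \<Rightarrow>\<^sub>L 'a)) \<Rightarrow> real \<Rightarrow> bool" where
  "colbound G c \<longleftrightarrow> 0 \<le> c \<and> (\<forall>N x. L2_set (\<lambda>j. norm (blinfun_apply (G j) x)) {..<N} \<le> c * norm x)"

text \<open>The operator norm of the column \<open>(G j)\<close> as a map into the direct sum of
  copies of the space, expressed through partial sums. It is meaningful once some
  \<open>colbound\<close> exists.\<close>

definition colnorm :: "(nat \<Rightarrow> ('a::chilbert_space \<Rightarrow>\<^sub>L 'a)) \<Rightarrow> real" where
  "colnorm G = Inf {c. colbound G c}"

lemma colnorm_le: "colbound G c \<Longrightarrow> colnorm G \<le> c"
  unfolding colnorm_def by (intro cInf_lower bdd_belowI[of _ 0]) (auto simp: colbound_def)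

lemma colbound_colnorm:
  assumes "colbound G c"
  shows "colbound G (colnorm G)"
proof -
  have ge: "b \<le> colnorm G" if "\<And>c. colbound G c \<Longrightarrow> b \<le> c" for b
    unfolding colnorm_def using assms that by (intro cInf_greatest) auto
  have "L2_set (\<lambda>j. norm (G j x)) {..<N} \<le> colnorm G * norm x" for N x
  proof (cases "norm x = 0")
    case True
    then show ?thesis using assms unfolding colbound_def by (metis mult_zero_right)
  next
    case False
    have "L2_set (\<lambda>j. norm (G j x)) {..<N} / norm x \<le> colnorm G"
      using False by (intro ge) (auto simp: colbound_def divide_le_eq)
    then show ?thesis using False by (simp add: divide_le_eq)
  qed
  moreover have "0 \<le> colnorm G" by (rule ge) (simp add: colbound_def)
  ultimately show ?thesis by (simp add: colbound_def)
qed

lemma sublin_colnorm: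
  assumes add: "\<And>v w j. T (v + w) j = T v j + T w j" and scale: "\<And>r v j. T (r *\<^sub>R v) j = r *\<^sub>R T v j"
    and bd: "\<And>v. \<exists>c. colbound (T v) c"
  shows "sublin (\<lambda>v. colnorm (T v))"
  unfolding sublin_def
proof (intro conjI allI impI)
  have cb: "colbound (T v) (colnorm (T v))" for v using bd[of v] colbound_colnorm by blast
  fix v w
  have "L2_set (\<lambda>j. norm (T (v + w) j x)) {..<N} \<le> (colnorm (T v) + colnorm (T w)) * norm x" for N x
  proof -
    have "L2_set (\<lambda>j. norm (T (v + w) j x)) {..<N} \<le> L2_set (\<lambda>j. norm (T v j x) + norm (T w j x)) {..<N}"
      by (intro L2_set_mono) (auto simp: add blinfun.bilinear_simps norm_triangle_ineq)
    also have "\<dots> \<le> L2_set (\<lambda>j. norm (T v j x)) {..<N} + L2_set (\<lambda>j. norm (T w j x)) {..<N}"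
      by (rule L2_set_triangle_ineq)
    also have "\<dots> \<le> colnorm (T v) * norm x + colnorm (T w) * norm x"
      using cb[of v] cb[of w] unfolding colbound_def by (intro add_mono) auto
    finally show ?thesis by (simp add: ring_distribs)
  qed
  then have "colbound (T (v + w)) (colnorm (T v) + colnorm (T w))"
    using cb[of v] cb[of w] by (simp add: colbound_def)
  then show "colnorm (T (v + w)) \<le> colnorm (T v) + colnorm (T w)" by (rule colnorm_le)
next
  have cb: "colbound (T v) (colnorm (T v))" for v using bd[of v] colbound_colnorm by blast
  fix r :: real and v assume r: "0 \<le> r"
  have "L2_set (\<lambda>j. norm (T (r *\<^sub>R v) j x)) {..<N} \<le> (r * colnorm (T v)) * norm x" for N x
  proof -
    have "L2_set (\<lambda>j. norm (T (r *\<^sub>R v) j x)) {..<N} = r * L2_set (\<lambda>j. norm (T v j x)) {..<N}"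
      using r by (simp add: scale blinfun.bilinear_simps L2_set_right_distrib)
    also have "\<dots> \<le> r * (colnorm (T v) * norm x)"
      using cb[of v] r unfolding colbound_def by (intro mult_left_mono) auto
    finally show ?thesis by (simp add: mult_ac)
  qed
  then have "colbound (T (r *\<^sub>R v)) (r * colnorm (T v))"
    using cb[of v] r by (simp add: colbound_def)
  then show "colnorm (T (r *\<^sub>R v)) \<le> r * colnorm (T v)" by (rule colnorm_le)
qed

text \<open>The operator norm of a column is at most its Hilbert-Schmidt norm. This makes
  \<open>colnorm\<close> meaningful on coded sequences, and it later gives the boundedness that the
  Riesz representation requires.\<close>

lemma colbound_slices:
  assumes "\<And>j. norm (G j) \<le> norm (slice j v)"
  shows "colbound G (norm v)"
  unfolding colbound_def
proof (intro conjI allI norm_ge_zero)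
  fix N x
  have "L2_set (\<lambda>j. norm (G j x)) {..<N} \<le> L2_set (\<lambda>j. norm x * norm (slice j v)) {..<N}"
  proof (rule L2_set_mono)
    fix j
    have "norm (G j x) \<le> norm (G j) * norm x" by (rule norm_blinfun)
    also have "\<dots> \<le> norm (slice j v) * norm x" by (intro mult_right_mono assms norm_ge_zero)
    finally show "norm (G j x) \<le> norm x * norm (slice j v)" by (simp add: mult.commute)
  qed simp
  also have "\<dots> = norm x * L2_set (\<lambda>j. norm (slice j v)) {..<N}" by (simp add: L2_set_right_distrib)
  also have "\<dots> \<le> norm x * norm v"
    unfolding L2_set_def by (intro mult_left_mono real_le_lsqrt sum_norm_slice_le sum_nonneg) auto
  finally show "L2_set (\<lambda>j. norm (G j x)) {..<N} \<le> norm v * norm x" by (simp add: mult.commute)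
qed

section \<open>The inequality on \<open>\<ell>\<^sup>2\<close>\<close>

lemma bessel_ket: "bessel d ket"
proof (rule bessel_orthonormal[of "range ket"])
  have eq: "ket m = ket n \<longleftrightarrow> m = n" for m n
    by (metis Rep_ket zero_neq_one)
  then show "inj_on ket {..<d}" by (simp add: inj_on_def)
  show "orthonormal (range ket)"
    unfolding orthonormal_def using eq by (auto simp: cinner_ket_left Rep_ket)
qed auto

text \<open>The series is the trace pairing of the operators coded by \<open>v\<close> with the
  \<open>c j\<close>, written in coordinates and finite by the support condition. Divided by
  \<open>\<gamma>\<close>, the coded family is admissible.\<close>

lemma dual_form_bound:
  fixes c :: "nat \<Rightarrow> (ell2 \<Rightarrow>\<^sub>L ell2)"
  assumes dual: "\<And>N d v. admissible {..<N} v \<Longrightarrow>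
      (\<Sum>j<N. Re (\<Sum>l<d. cinner (blinfun_apply (v j) (ket l)) (blinfun_apply (c j) (ket l)))) \<le> s"
    and cb: "colbound (\<lambda>j. hs (slice j v)) \<gamma>" "colbound (\<lambda>j. adj (hs (slice j v))) \<gamma>" and \<gamma>: "0 < \<gamma>"
    and fin: "finite {i. Rep_ell2 v i \<noteq> 0}"
    and C: "\<And>j n l. C (prod_encode (j, prod_encode (n, l))) = Rep_ell2 (blinfun_apply (c j) (ket l)) n"
  shows "Re (\<Sum>i. cnj (Rep_ell2 v i) * C i) \<le> s * \<gamma>"
proof -
  define V where "V j = hs (slice j v)" for j
  define enc where "enc = (\<lambda>(j, n, l). prod_encode (j, prod_encode (n, l)))"
  have inj: "inj enc" by (auto simp: enc_def inj_on_def)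
  have surj: "\<exists>j n l. i = enc (j, n, l)" for i
    by (rule exI[of _ "fst (prod_decode i)"], rule exI[of _ "fst (prod_decode (snd (prod_decode i)))"],
        rule exI[of _ "snd (prod_decode (snd (prod_decode i)))"]) (simp add: enc_def)
  obtain B where B: "\<And>i. Rep_ell2 v i \<noteq> 0 \<Longrightarrow> i < B" using finite_nat_set_iff_bounded[THEN iffD1, OF fin] by blast
  have small: "j < B" "n < B" "l < B" if "Rep_ell2 v (enc (j, n, l)) \<noteq> 0" for j n l
  proof -
    have "enc (j, n, l) < B" by (rule B[OF that])
    \<comment> \<open>Pair codes dominate their components, so one bound for the codes bounds all
      three indices.\<close>
    moreover have "j \<le> enc (j, n, l)" "prod_encode (n, l) \<le> enc (j, n, l)"
      by (auto simp: enc_def le_prod_encode_1 le_prod_encode_2)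
    moreover have "n \<le> prod_encode (n, l)" "l \<le> prod_encode (n, l)"
      by (auto simp: le_prod_encode_1 le_prod_encode_2)
    ultimately show "j < B" "n < B" "l < B" by linarith+
  qed
  have RV: "Rep_ell2 (V j (ket l)) n = Rep_ell2 v (enc (j, n, l))" for j n l
    by (simp add: V_def Rep_hs_ket Rep_slice enc_def)
  have "(\<Sum>i. cnj (Rep_ell2 v i) * C i) = (\<Sum>i\<in>enc ` ({..<B} \<times> {..<B} \<times> {..<B}). cnj (Rep_ell2 v i) * C i)"
  proof (rule suminf_finite)
    fix i assume i: "i \<notin> enc ` ({..<B} \<times> {..<B} \<times> {..<B})"
    obtain j n l where "i = enc (j, n, l)" using surj by blast
    then show "cnj (Rep_ell2 v i) * C i = 0" using i small[of j n l] by auto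
  qed simp
  also have "\<dots> = (\<Sum>(j, n, l)\<in>{..<B} \<times> {..<B} \<times> {..<B}.
      cnj (Rep_ell2 (V j (ket l)) n) * Rep_ell2 (c j (ket l)) n)"
    using inj_on_subset[OF inj] by (subst sum.reindex) (auto intro!: sum.cong simp: RV enc_def C)
  also have "\<dots> = (\<Sum>j<B. \<Sum>n<B. \<Sum>l<B. cnj (Rep_ell2 (V j (ket l)) n) * Rep_ell2 (c j (ket l)) n)"
    by (simp add: sum.cartesian_product)
  also have "\<dots> = (\<Sum>j<B. \<Sum>l<B. \<Sum>n<B. cnj (Rep_ell2 (V j (ket l)) n) * Rep_ell2 (c j (ket l)) n)"
    by (intro sum.cong refl sum.swap)
  also have "\<dots> = (\<Sum>j<B. \<Sum>l<B. cinner (V j (ket l)) (c j (ket l)))"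
    unfolding cinner_ell2_def
    by (intro sum.cong refl suminf_finite[symmetric]) (use small(2) in \<open>force simp: RV\<close>)+
  finally have eq: "Re (\<Sum>i. cnj (Rep_ell2 v i) * C i) = (\<Sum>j<B. Re (\<Sum>l<B. cinner (V j (ket l)) (c j (ket l))))"
    by simp
  have L2: "(\<Sum>j<N. (norm (((1 / \<gamma>) *\<^sub>R G j) x))\<^sup>2) \<le> (norm x)\<^sup>2" if "colbound G \<gamma>"
    for N x and G :: "nat \<Rightarrow> (ell2 \<Rightarrow>\<^sub>L ell2)"
  proof -
    have "sqrt (\<Sum>j<N. (norm (G j x))\<^sup>2) \<le> \<gamma> * norm x"
      using that by (simp add: colbound_def L2_set_def)
    then have "(\<Sum>j<N. (norm (G j x))\<^sup>2) \<le> (\<gamma> * norm x)\<^sup>2" using sqrt_le_D by blast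
    then show ?thesis using \<gamma>
      by (simp add: blinfun.bilinear_simps power_divide sum_divide_distrib[symmetric] power_mult_distrib divide_le_eq mult.commute)
  qed
  have "admissible {..<B} (\<lambda>j. (1 / \<gamma>) *\<^sub>R V j)"
    unfolding admissible_def using L2[OF cb(1)] L2[OF cb(2)]
    by (auto simp: V_def adj_scaleR intro!: clin_scaleR)
  from dual[OF this, of B]
  have "(1 / \<gamma>) * (\<Sum>j<B. Re (\<Sum>l<B. cinner (V j (ket l)) (c j (ket l)))) \<le> s"
    by (simp add: blinfun.bilinear_simps cinner_simps sum_distrib_left)
  then show ?thesis unfolding eq using \<gamma> by (simp add: divide_le_eq)
qed

text \<open>Hahn-Banach on \<open>ell2 \<times> ell2\<close>: the pairing with \<open>c\<close>,
  placed on the diagonal, is dominated by a column norm in one factor plus a row norm in the other.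
  The restrictions of the extension to the two factors are represented by \<open>A\<close> and
  \<open>B\<close>.\<close>

lemma decomposition_exists:
  fixes c :: "nat \<Rightarrow> (ell2 \<Rightarrow>\<^sub>L ell2)"
  assumes cl: "\<And>j. clin (c j)" and s: "0 \<le> s"
    and dual: "\<And>N d v. admissible {..<N} v \<Longrightarrow>
      (\<Sum>j<N. Re (\<Sum>l<d. cinner (blinfun_apply (v j) (ket l)) (blinfun_apply (c j) (ket l)))) \<le> s"
  obtains A B where "\<And>j. c j = hs (slice j A) + hs (slice j B)"
    "\<And>v. Re (cinner v A) \<le> s * colnorm (\<lambda>j. hs (slice j v))"
    "\<And>v. Re (cinner v B) \<le> s * colnorm (\<lambda>j. adj (hs (slice j v)))"
proof -
  define C where "C i = (let (j, q) = prod_decode i; (n, l) = prod_decode q in Rep_ell2 (c j (ket l)) n)" for i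
  have C: "C (prod_encode (j, prod_encode (n, l))) = Rep_ell2 (c j (ket l)) n" for j n l
    by (simp add: C_def)
  define \<alpha> where "\<alpha> v = colnorm (\<lambda>j. hs (slice j v))" for v
  define \<beta> where "\<beta> v = colnorm (\<lambda>j. adj (hs (slice j v)))" for v
  have b\<alpha>: "colbound (\<lambda>j. hs (slice j v)) (norm v)" for v
    by (rule colbound_slices) (rule norm_hs_le)
  have b\<beta>: "colbound (\<lambda>j. adj (hs (slice j v))) (norm v)" for v
    by (rule colbound_slices) (rule order_trans[OF norm_adj_le[OF clin_hs] norm_hs_le])
  have sub\<alpha>: "sublin \<alpha>"
    unfolding \<alpha>_def by (rule sublin_colnorm) (use b\<alpha> in \<open>auto simp: blinfun.bilinear_simps hs_add hs_scaleR\<close>)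
  have sub\<beta>: "sublin \<beta>"
    unfolding \<beta>_def by (rule sublin_colnorm)
      (use b\<beta> in \<open>auto simp: blinfun.bilinear_simps hs_add hs_scaleR adj_add adj_scaleR\<close>)
  have nn: "0 \<le> \<alpha> v" "0 \<le> \<beta> v" for v
    using colbound_colnorm[OF b\<alpha>[of v]] colbound_colnorm[OF b\<beta>[of v]] by (auto simp: colbound_def \<alpha>_def \<beta>_def)
  \<comment> \<open>The sum of the two norms, rather than their maximum, yields a separate bound in
    each factor at once; the price is a factor 2 in the end.\<close>
  define p where "p z = s * (\<alpha> (fst z) + \<beta> (snd z))" for z :: "ell2 \<times> ell2"
  have subp: "sublin p"
    unfolding sublin_def
  proof (intro conjI allI impI)
    fix x y :: "ell2 \<times> ell2"
    have "\<alpha> (fst x + fst y) + \<beta> (snd x + snd y) \<le> (\<alpha> (fst x) + \<beta> (snd x)) + (\<alpha> (fst y) + \<beta> (snd y))"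
      using sublin_add[OF sub\<alpha>, of "fst x" "fst y"] sublin_add[OF sub\<beta>, of "snd x" "snd y"] by linarith
    then show "p (x + y) \<le> p x + p y"
      unfolding p_def using mult_left_mono[OF _ s] by (fastforce simp: ring_distribs)
  next
    fix r :: real and x :: "ell2 \<times> ell2" assume "0 \<le> r"
    then show "p (r *\<^sub>R x) \<le> r * p x"
      by (simp add: p_def sublin_scale[OF sub\<alpha>] sublin_scale[OF sub\<beta>] algebra_simps)
  qed
  \<comment> \<open>The entries \<open>C i\<close> need not be square-summable, so the pairing is
    defined for finitely supported \<open>v\<close> only.\<close>
  define U where "U = {(v, w). v = w \<and> finite {i. Rep_ell2 v i \<noteq> 0}}"
  have U: "subspace U"
  proof (rule subspaceI)
    show "0 \<in> U" by (simp add: U_def zero_prod_def Rep_ell2_zero)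
    show "x + y \<in> U" if "x \<in> U" "y \<in> U" for x y
    proof -
      have "finite ({i. Rep_ell2 (fst x) i \<noteq> 0} \<union> {i. Rep_ell2 (fst y) i \<noteq> 0})"
        using that by (auto simp: U_def)
      then have "finite {i. Rep_ell2 (fst x + fst y) i \<noteq> 0}"
        by (rule finite_subset[rotated]) (auto simp: Rep_ell2_add)
      then show ?thesis using that by (auto simp: U_def)
    qed
    show "r *\<^sub>R x \<in> U" if "x \<in> U" for r x
    proof -
      have "finite {i. Rep_ell2 (r *\<^sub>R fst x) i \<noteq> 0}"
        using that by (auto simp: U_def Rep_ell2_scaleR elim: finite_subset[rotated])
      then show ?thesis using that by (auto simp: U_def)
    qed
  qed
  define \<phi> where "\<phi> z = Re (\<Sum>i. cnj (Rep_ell2 (fst z) i) * C i)" for z :: "ell2 \<times> ell2"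
  have sm: "summable (\<lambda>i. cnj (Rep_ell2 (fst z) i) * C i)" if "z \<in> U" for z
    using that by (intro summable_finite[of "{i. Rep_ell2 (fst z) i \<noteq> 0}"]) (auto simp: U_def)
  obtain \<Phi> where \<Phi>: "linear \<Phi>" "\<And>x. \<Phi> x \<le> p x" "\<And>u. u \<in> U \<Longrightarrow> \<Phi> u = \<phi> u"
  proof (rule hahn_banach[OF subp U, of \<phi>])
    show "\<phi> (u + v) = \<phi> u + \<phi> v" if "u \<in> U" "v \<in> U" for u v
      using arg_cong[OF suminf_add[OF sm[OF that(1)] sm[OF that(2)]], of Re]
      by (simp add: \<phi>_def Rep_ell2_add ring_distribs)
    show "\<phi> (r *\<^sub>R u) = r * \<phi> u" if "u \<in> U" for r u
      using suminf_mult[OF sm[OF that], of "of_real r"] by (simp add: \<phi>_def Rep_ell2_scaleR mult.assoc)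
    fix u assume "u \<in> U"
    then obtain v where u: "u = (v, v)" and fin: "finite {i. Rep_ell2 v i \<noteq> 0}" by (auto simp: U_def)
    show "\<phi> u \<le> p u"
    proof (rule field_le_epsilon)
      fix e :: real assume e: "e > 0"
      \<comment> \<open>\<open>\<alpha> v + \<beta> v\<close> may vanish, whereas
        \<open>dual_form_bound\<close> divides by \<open>\<gamma>\<close>; after multiplication by
        \<open>s\<close> the extra summand costs at most \<open>e\<close>.\<close>
      define \<gamma> where "\<gamma> = \<alpha> v + \<beta> v + e / (s + 1)"
      have ep: "0 < e / (s + 1)" "s * (e / (s + 1)) \<le> e" using e s by (auto simp: field_simps)
      have mono: "colbound G \<gamma>" if "colbound G a" "a \<le> \<gamma>" for G :: "nat \<Rightarrow> (ell2 \<Rightarrow>\<^sub>L ell2)" and a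
        using that unfolding colbound_def by (meson mult_right_mono norm_ge_zero order_trans)
      have "Re (\<Sum>i. cnj (Rep_ell2 v i) * C i) \<le> s * \<gamma>"
      proof (rule dual_form_bound[OF dual _ _ _ fin C])
        show "colbound (\<lambda>j. hs (slice j v)) \<gamma>"
          by (rule mono[OF colbound_colnorm[OF b\<alpha>]]) (use nn[of v] ep in \<open>simp add: \<gamma>_def \<alpha>_def[symmetric]\<close>)
        show "colbound (\<lambda>j. adj (hs (slice j v))) \<gamma>"
          by (rule mono[OF colbound_colnorm[OF b\<beta>]]) (use nn[of v] ep in \<open>simp add: \<gamma>_def \<beta>_def[symmetric]\<close>)
        show "0 < \<gamma>" using nn[of v] ep by (simp add: \<gamma>_def)
      qed
      also have "s * \<gamma> = p u + s * (e / (s + 1))" by (simp add: \<gamma>_def p_def u ring_distribs)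
      also have "\<dots> \<le> p u + e" using ep by simp
      finally show "\<phi> u \<le> p u + e" by (simp add: \<phi>_def u)
    qed
  qed blast
  have riesz': "\<exists>A. \<forall>v. T v = Re (cinner A v)" if lin: "linear T" and le: "\<And>v. T v \<le> s * norm v" for T :: "ell2 \<Rightarrow> real"
  proof -
    have "norm (T v) \<le> norm v * s" for v
      using le[of v] le[of "- v"] linear_neg[OF lin, of v] by (simp add: abs_le_iff mult.commute)
    then have "bounded_linear T"
      using linear_add[OF lin] linear_scale[OF lin] by (intro bounded_linear_intro) auto
    then show ?thesis using riesz_real by metis
  qed
  have lin: "linear (\<lambda>v. \<Phi> (v, 0))" "linear (\<lambda>v. \<Phi> (0, v))"
    by (rule linearI; use linear_add[OF \<Phi>(1), of "(_, 0)" "(_, 0)"] linear_add[OF \<Phi>(1), of "(0, _)" "(0, _)"]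
        linear_scale[OF \<Phi>(1), of _ "(_, 0)"] linear_scale[OF \<Phi>(1), of _ "(0, _)"] in simp)+
  have zero: "\<alpha> 0 = 0" "\<beta> 0 = 0" using sublin_zero sub\<alpha> sub\<beta> by auto
  have le1: "\<Phi> (v, 0) \<le> s * \<alpha> v" and le2: "\<Phi> (0, v) \<le> s * \<beta> v" for v
    using \<Phi>(2)[of "(v, 0)"] \<Phi>(2)[of "(0, v)"] by (simp_all add: p_def zero)
  have ab: "\<alpha> v \<le> norm v" "\<beta> v \<le> norm v" for v
    unfolding \<alpha>_def \<beta>_def by (intro colnorm_le b\<alpha> b\<beta>)+
  obtain A where A: "\<And>v. \<Phi> (v, 0) = Re (cinner v A)"
    using riesz'[OF lin(1) order_trans[OF le1 mult_left_mono[OF ab(1) s]]] by (metis Re_cinner_commute)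
  obtain B where B: "\<And>v. \<Phi> (0, v) = Re (cinner v B)"
    using riesz'[OF lin(2) order_trans[OF le2 mult_left_mono[OF ab(2) s]]] by (metis Re_cinner_commute)
  have AB: "Rep_ell2 A i + Rep_ell2 B i = C i" for i
  proof -
    \<comment> \<open>The vectors \<open>z *\<^sub>C ket i\<close> with \<open>z = 1\<close> and
      \<open>z = \<i>\<close> extract a complex identity from a real-valued functional.\<close>
    have "Re (cnj z * (Rep_ell2 A i + Rep_ell2 B i)) = Re (cnj z * C i)" for z
    proof -
      let ?v = "z *\<^sub>C ket i"
      have "(?v, ?v) \<in> U" by (auto simp: U_def Rep_ell2_scaleC Rep_ket)
      then have "\<Phi> (?v, ?v) = \<phi> (?v, ?v)" by (rule \<Phi>(3))
      moreover have "\<Phi> (?v, ?v) = \<Phi> (?v, 0) + \<Phi> (0, ?v)"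
        using linear_add[OF \<Phi>(1), of "(?v, 0)" "(0, ?v)"] by simp
      moreover have "\<phi> (?v, ?v) = Re (cnj z * C i)"
        unfolding \<phi>_def by (subst suminf_finite[of "{i}"]) (auto simp: Rep_ell2_scaleC Rep_ket)
      ultimately show ?thesis
        by (simp only: A B cinner_scaleC_left cinner_ket_left distrib_left plus_complex.sel)
    qed
    from this[of 1] this[of \<i>] show ?thesis by (simp add: complex_eq_iff)
  qed
  show ?thesis
  proof (rule that[of A B])
    show "c j = hs (slice j A) + hs (slice j B)" for j
    proof (rule ell2_op_eqI[OF cl])
      show "Rep_ell2 (c j (ket l)) n = Rep_ell2 ((hs (slice j A) + hs (slice j B)) (ket l)) n" for n l
        using AB[of "prod_encode (j, prod_encode (n, l))"]
        by (simp add: blinfun.bilinear_simps Rep_ell2_add Rep_hs_ket Rep_slice C)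
    qed auto
    show "Re (cinner v A) \<le> s * colnorm (\<lambda>j. hs (slice j v))" for v using le1[of v] by (simp add: A \<alpha>_def)
    show "Re (cinner v B) \<le> s * colnorm (\<lambda>j. adj (hs (slice j v)))" for v using le2[of v] by (simp add: B \<beta>_def)
  qed
qed

text \<open>The bounds on \<open>A\<close> and \<open>B\<close> are what \<open>CE_norm_dual\<close>
  asks for, because every finite rank test column of norm at most 1 can be assembled into one vector
  \<open>v\<close>.\<close>

lemma triple_norm_dual:
  fixes c :: "nat \<Rightarrow> (ell2 \<Rightarrow>\<^sub>L ell2)"
  assumes cl: "\<And>j. clin (c j)" and s: "0 \<le> s"
    and dual: "\<And>N d v. admissible {..<N} v \<Longrightarrow>
      (\<Sum>j<N. Re (\<Sum>l<d. cinner (blinfun_apply (v j) (ket l)) (blinfun_apply (c j) (ket l)))) \<le> s"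
  shows "triple_norm c \<le> ennreal (2 * s)"
proof -
  obtain A B where AB: "\<And>j. c j = hs (slice j A) + hs (slice j B)"
    and A: "\<And>v. Re (cinner v A) \<le> s * colnorm (\<lambda>j. hs (slice j v))"
    and B: "\<And>v. Re (cinner v B) \<le> s * colnorm (\<lambda>j. adj (hs (slice j v)))"
    using decomposition_exists[OF cl s dual] by blast
  have sm: "summable (\<lambda>j. (norm (G j))\<^sup>2)" if "\<And>j. norm (G j) \<le> norm (slice j v)"
    for G :: "nat \<Rightarrow> (ell2 \<Rightarrow>\<^sub>L ell2)" and v
  proof (rule summableI_nonneg_bounded[where x = "(norm v)\<^sup>2"])
    fix N
    have "(\<Sum>j<N. (norm (G j))\<^sup>2) \<le> (\<Sum>j<N. (norm (slice j v))\<^sup>2)"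
      by (intro sum_mono power_mono that norm_ge_zero)
    also have "\<dots> \<le> (norm v)\<^sup>2" by (rule sum_norm_slice_le)
    finally show "(\<Sum>j<N. (norm (G j))\<^sup>2) \<le> (norm v)\<^sup>2" .
  qed simp
  have col1: "colnorm G \<le> 1"
    if G: "\<And>j h. G j h = (if j < N then \<Sum>i<n. cinner (x i) h *\<^sub>C p i j else 0)"
      and le: "\<And>h. (\<Sum>j<N. (norm (\<Sum>i<n. cinner (x i) h *\<^sub>C p i j))\<^sup>2) \<le> (norm h)\<^sup>2"
    for G :: "nat \<Rightarrow> (ell2 \<Rightarrow>\<^sub>L ell2)" and N n :: nat and x :: "nat \<Rightarrow> ell2" and p :: "nat \<Rightarrow> nat \<Rightarrow> ell2"
  proof (rule colnorm_le, unfold colbound_def, intro conjI allI)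
    fix M h
    have "(\<Sum>j<M. (norm (G j h))\<^sup>2) \<le> (\<Sum>j\<in>{..<M} \<inter> {..<N}. (norm (G j h))\<^sup>2)"
      by (rule eq_refl, rule sum.mono_neutral_right) (auto simp: G)
    also have "\<dots> \<le> (\<Sum>j<N. (norm (G j h))\<^sup>2)" by (intro sum_mono2) auto
    also have "\<dots> = (\<Sum>j<N. (norm (\<Sum>i<n. cinner (x i) h *\<^sub>C p i j))\<^sup>2)" by (intro sum.cong) (auto simp: G)
    also have "\<dots> \<le> (norm h)\<^sup>2" by (rule le)
    finally show "L2_set (\<lambda>j. norm (G j h)) {..<M} \<le> 1 * norm h"
      unfolding L2_set_def by (intro real_le_lsqrt) (auto intro: sum_nonneg)
  qed simp
  have slice_emb: "slice j (\<Sum>k<N. adj (slice k) (z k)) = (if j < N then z j else 0)" for j N z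
    by (simp add: blinfun.sum_right slice_adj_slice)
  have "CE_norm (\<lambda>j. hs (slice j A)) \<le> ennreal s"
  proof (rule CE_norm_dual[OF clin_hs sm[OF norm_hs_le] s])
    fix N n and p :: "nat \<Rightarrow> nat \<Rightarrow> ell2" and x :: "nat \<Rightarrow> ell2"
    assume le: "\<And>h. (\<Sum>j<N. (norm (\<Sum>i<n. cinner (x i) h *\<^sub>C p i j))\<^sup>2) \<le> (norm h)\<^sup>2"
    \<comment> \<open>\<open>v\<close> codes the test column itself, so \<open>cinner v A\<close> is
      the pairing to be bounded.\<close>
    define v where "v = (\<Sum>j<N. adj (slice j) (\<Sum>i<n. tens (p i j) (x i)))"
    have "hs (slice j v) h = (if j < N then \<Sum>i<n. cinner (x i) h *\<^sub>C p i j else 0)" for j h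
      by (simp add: v_def slice_emb hs_sum blinfun.sum_left hs_tens)
    then have "colnorm (\<lambda>j. hs (slice j v)) \<le> 1" by (rule col1[OF _ le])
    then have "Re (cinner v A) \<le> s * 1" using order_trans[OF A mult_left_mono[OF _ s]] by blast
    moreover have "cinner v A = (\<Sum>j<N. \<Sum>i<n. cinner (p i j) (hs (slice j A) (x i)))"
      by (simp add: v_def cinner_sum_left cinner_adj_left cinner_hs)
    ultimately show "(\<Sum>j<N. \<Sum>i<n. Re (cinner (p i j) (hs (slice j A) (x i)))) \<le> s" by simp
  qed
  moreover have "CE_norm (\<lambda>j. adj (hs (slice j B))) \<le> ennreal s"
  proof (rule CE_norm_dual[OF clin_adj[OF clin_hs] sm[OF order_trans[OF norm_adj_le[OF clin_hs] norm_hs_le]] s])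
    fix N n and p :: "nat \<Rightarrow> nat \<Rightarrow> ell2" and x :: "nat \<Rightarrow> ell2"
    assume le: "\<And>h. (\<Sum>j<N. (norm (\<Sum>i<n. cinner (x i) h *\<^sub>C p i j))\<^sup>2) \<le> (norm h)\<^sup>2"
    \<comment> \<open>\<open>x\<close> and \<open>p\<close> are exchanged in \<open>tens\<close>:
      here the adjoints of the coded operators form the test column.\<close>
    define v where "v = (\<Sum>j<N. adj (slice j) (\<Sum>i<n. tens (x i) (p i j)))"
    have adj0: "adj (0 :: ell2 \<Rightarrow>\<^sub>L ell2) = 0" by (rule adj_eqI) auto
    have "adj (hs (slice j v)) h = (if j < N then \<Sum>i<n. cinner (x i) h *\<^sub>C p i j else 0)" for j h
      by (simp add: v_def slice_emb hs_sum adj_sum adj_hs_tens blinfun.sum_left hs_tens adj0)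
    then have "colnorm (\<lambda>j. adj (hs (slice j v))) \<le> 1" by (rule col1[OF _ le])
    then have "Re (cinner v B) \<le> s * 1" using order_trans[OF B mult_left_mono[OF _ s]] by blast
    moreover have "cinner v B = (\<Sum>j<N. \<Sum>i<n. cinner (x i) (hs (slice j B) (p i j)))"
      by (simp add: v_def cinner_sum_left cinner_adj_left cinner_hs)
    moreover have "Re (cinner (p i j) (adj (hs (slice j B)) (x i))) = Re (cinner (x i) (hs (slice j B) (p i j)))" for i j
      by (simp add: cinner_adj_right Re_cinner_commute[of "x i"])
    ultimately show "(\<Sum>j<N. \<Sum>i<n. Re (cinner (p i j) (adj (hs (slice j B)) (x i)))) \<le> s" by simp
  qed
  ultimately have "CE_norm (\<lambda>j. hs (slice j A)) + CE_norm (\<lambda>j. op_adj (hs (slice j B))) \<le> ennreal s + ennreal s"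
    unfolding op_adj_eq[OF clin_hs] by (rule add_mono)
  also have "\<dots> = ennreal (2 * s)" using s by (simp flip: ennreal_plus)
  finally show ?thesis
    unfolding triple_norm_def
    by (intro INF_lower2[of "(\<lambda>j. hs (slice j A), \<lambda>j. hs (slice j B))"])
       (auto simp: compact_op_iff totbdd_hs AB)
qed

text \<open>The constant is \<open>2 * 2\<close>: one factor from the absorption behind
  \<open>dual_inequality\<close>, one from bounding column and row part separately in
  \<open>triple_norm_dual\<close>.\<close>

lemma ell2_inequality:
  fixes f :: "real \<Rightarrow> (ell2 \<Rightarrow>\<^sub>L ell2)"
  assumes k: "strongly_lacunary_seq k" and f: "f \<in> L1_S1"
    and van: "\<And>n. n \<notin> range (\<lambda>j. int (k j)) \<Longrightarrow> fourier_coeff f n = 0"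
  shows "triple_norm (\<lambda>j. fourier_coeff f (int (k j))) \<le> ennreal 4 * L1_norm f"
proof -
  have "L1_norm f < top"
    using f unfolding L1_norm_eq[OF f] L1_S1_iff by (simp add: ennreal_mult_less_top)
  then obtain F where F: "L1_norm f = ennreal F" "0 \<le> F" by (cases "L1_norm f") auto
  have "triple_norm (\<lambda>j. fourier_coeff f (int (k j))) \<le> ennreal (2 * (2 * F))"
  proof (rule triple_norm_dual)
    show "clin (fourier_coeff f (int (k j)))" for j by (intro S1_clin fourier_coeff_S1 f)
    show "(\<Sum>j<N. Re (\<Sum>l<d. cinner (v j (ket l)) (fourier_coeff f (int (k j)) (ket l)))) \<le> 2 * F"
      if "admissible {..<N} v" for N d v
      by (rule dual_inequality[OF k f F van bessel_ket that])
  qed (use F in simp)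
  also have "\<dots> = ennreal 4 * L1_norm f" using F by (simp add: ennreal_mult)
  finally show ?thesis .
qed

text \<open>The constant that the statement refers to was chosen for \<open>\<ell>\<^sup>2\<close> only, without any bound on
  its size; so the passage to other spaces must not lose a factor.\<close>

theorem corollary1p3:
  fixes k :: "nat \<Rightarrow> nat" and K :: "int set"
    and f :: "real \<Rightarrow> ('h::chilbert_space \<Rightarrow>\<^sub>L 'h)"
  assumes "strongly_lacunary_seq k"
    and "K = range (\<lambda>j. int (k j))"
    and "f \<in> L1_S1"
    and "\<And>n. n \<notin> K \<Longrightarrow> fourier_coeff f n = 0"
  shows "triple_norm (\<lambda>j. fourier_coeff f (int (k j))) \<le> ennreal absolute_constant * L1_norm f"
proof -
  have const: "triple_norm (\<lambda>j. fourier_coeff g (int (k j))) \<le> ennreal absolute_constant * L1_norm g"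
    if "g \<in> L1_S1" "\<And>n. n \<notin> K \<Longrightarrow> fourier_coeff g n = 0" for g :: "real \<Rightarrow> (ell2 \<Rightarrow>\<^sub>L ell2)"
  proof -
    \<comment> \<open>The choice in \<open>absolute_constant\<close> is effective as soon as one
      valid constant exists, and 4 is one.\<close>
    have "\<exists>C. \<forall>k (K :: int set) (f :: real \<Rightarrow> (ell2 \<Rightarrow>\<^sub>L ell2)).
        strongly_lacunary_seq k \<longrightarrow> K = range (\<lambda>j. int (k j)) \<longrightarrow>
        f \<in> L1_S1 \<longrightarrow> (\<forall>n. n \<notin> K \<longrightarrow> fourier_coeff f n = 0) \<longrightarrow>
        triple_norm (\<lambda>j. fourier_coeff f (int (k j))) \<le> ennreal C * L1_norm f"
      by (intro exI[of _ 4] allI impI ell2_inequality) auto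
    from someI_ex[OF this] show ?thesis
      unfolding absolute_constant_def[symmetric] using assms(1,2) that by blast
  qed
  obtain J :: "'h \<Rightarrow>\<^sub>L ell2" where J: "clin J" "\<And>x. norm (J x) \<le> norm x"
    "(\<lambda>t. J o\<^sub>L f t o\<^sub>L adj J) \<in> L1_S1" "L1_norm (\<lambda>t. J o\<^sub>L f t o\<^sub>L adj J) \<le> L1_norm f"
    "\<And>n. fourier_coeff (\<lambda>t. J o\<^sub>L f t o\<^sub>L adj J) n = J o\<^sub>L fourier_coeff f n o\<^sub>L adj J"
    "\<And>n. adj J o\<^sub>L (J o\<^sub>L fourier_coeff f n o\<^sub>L adj J) o\<^sub>L J = fourier_coeff f n"
    using compress_to_ell2[OF assms(3)] by blast
  define g where "g t = J o\<^sub>L f t o\<^sub>L adj J" for t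
  have gc: "fourier_coeff g n = J o\<^sub>L fourier_coeff f n o\<^sub>L adj J" for n
    unfolding g_def[abs_def] by (rule J(5))
  have "triple_norm (\<lambda>j. fourier_coeff f (int (k j)))
      = triple_norm (\<lambda>j. adj J o\<^sub>L fourier_coeff g (int (k j)) o\<^sub>L J)"
    by (simp add: gc J(6))
  also have "\<dots> \<le> triple_norm (\<lambda>j. fourier_coeff g (int (k j)))"
    by (rule triple_norm_compress[OF J(1,2)])
  also have "\<dots> \<le> ennreal absolute_constant * L1_norm g"
  proof (rule const)
    show "g \<in> L1_S1" using J(3) by (simp add: g_def[abs_def])
    fix n assume "n \<notin> K"
    then have "fourier_coeff f n = 0" by (rule assms(4))
    then show "fourier_coeff g n = 0"
      by (auto intro!: blinfun_eqI simp: gc blinfun.zero_right)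
  qed
  also have "\<dots> \<le> ennreal absolute_constant * L1_norm f"
    using J(4) by (intro mult_left_mono) (simp_all add: g_def[abs_def])
  finally show ?thesis .
qed

end
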